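(* Let $c:\mathbb{R}\to\mathbb{R}$ be a measurable, bounded function with $\int_{\mathbb{R}}c(x)\varphi(x)\,\mathrm{d}x=0$, and let $X_{n,1},\dots,X_{n,n}$, $n\in\mathbb{N}$, be a triangular array of row-wise independent and identically distributed random variables with Lebesgue density $$p_n(x)=\varphi(x)\cdot\Big(1+\tfrac{1}{\sqrt n}\,c(x)\Big),\quad x\in\mathbb{R}$$ ($n$ being large enough that $p_n\ge 0$). Let $G_n^{(2)}$ be the statistic computed from $X_{n,1},\dots,X_{n,n}$. Then, as $n\to\infty$, $$G_n^{(2)}\stackrel{\mathcal{D}}{\longrightarrow}\big\|\mathcal{Z}^{(2)}+\zeta\big\|_{L^2}^2,$$ where $\mathcal{Z}^{(2)}$ is the centred Gaussian element of $L^2$ with covariance kernel $\widetilde{\mathcal{K}}^{(2)}$ and $\zeta(s)=\int_{\mathbb{R}}\eta(x,s)\,c(x)\,\varphi(x)\,\mathrm{d}x$, $s\in\mathbb{R}$.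
   Context: $\varphi$ and $\Phi$ are the density and distribution function of the standard normal distribution, and $\varphi',\varphi'',\varphi'''$ are the first three derivatives of $\varphi$. $\omega:\mathbb{R}\to\mathbb{R}$ is a positive continuous weight function with $\int_{\mathbb{R}}t^4\,\omega(t)\,\mathrm{d}t<\infty$. $L^2=L^2(\mathbb{R},\mathcal{B},\omega\,\mathrm{d}\mathcal{L}^1)$ (with $\mathcal{B}$ the Borel $\sigma$-algebra and $\mathcal{L}^1$ Lebesgue measure) is the Hilbert space of measurable functions square integrable with respect to $\omega\,\mathrm{d}\mathcal{L}^1$, with $\|f\|_{L^2}^2=\int_{\mathbb{R}}f(t)^2\omega(t)\,\mathrm{d}t$. $\stackrel{\mathcal{D}}{\longrightarrow}$ denotes convergence in distribution and $\mathbf{1}$ the indicator. With $\overline{X}_n=n^{-1}\sum_{k=1}^n X_{n,k}$, $S_n^2=n^{-1}\sum_{k=1}^n(X_{n,k}-\overline{X}_n)^2$ and $Y_{n,j}=(X_{n,j}-\overline{X}_n)/S_n$, $j=1,\dots,n$, the statistic is $$G_n^{(2)}=n\int_{\mathbb{R}}\Big(\frac1n\sum_{j=1}^nY_{n,j}(Y_{n,j}-t)\mathbf{1}\{Y_{n,j}\le t\}-\Phi(t)\Big)^2\omega(t)\,\mathrm{d}t.$$ The function $\eta$ is $$\eta(x,s)=x(x-s)\mathbf{1}\{x\le s\}-\varphi(s)\Big(\tfrac12(1-x^2)s-2x\Big)-\Phi(s)(x^2-xs).$$ The kernel is $\widetilde{\mathcal{K}}^{(2)}(s,t)=\Psi^{(2)}_1(s,t)+\Psi^{(2)}_2(s,t)+\Psi^{(2)}_3(s,t)+\Psi^{(2)}_4(s,t)+\Psi^{(2)}_2(t,s)+\Psi^{(2)}_3(t,s)+\Psi^{(2)}_4(t,s)$,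 $s,t\in\mathbb{R}$, where, with $s\wedge t=\min\{s,t\}$, $$\begin{aligned}\Psi^{(2)}_1(s,t)=\;&\varphi'''(s\wedge t)+(s+t)\varphi''(s\wedge t)+(3+st)\varphi'(s\wedge t)+2(s+t)\varphi(s\wedge t)\\&+(3+st)\Phi(s\wedge t)+\big(-4+\tfrac32\,st\big)\varphi(s)\varphi(t)-(3+st)\Phi(s)\Phi(t),\\ \Psi^{(2)}_2(s,t)=\;&2\varphi(t)\big[-\varphi''(s)-s\varphi'(s)\big],\\ \Psi^{(2)}_3(s,t)=\;&\Phi(t)\big[-\varphi'''(s)-(s+t)\varphi''(s)-(3+st)\varphi'(s)-2(s+t)\varphi(s)\big],\\ \Psi^{(2)}_4(s,t)=\;&\tfrac12\,t\varphi(t)\big[\varphi'''(s)+s\varphi''(s)+2\varphi'(s)\big].\end{aligned}$$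
   Formalization: With true derivatives of φ the printed kernel is negative at s=t=3, so no such Gaussian element exists; the theorem also allows, and has content for, the kernel with the k-th derivative of φ read as (−x)^k φ(x), which equals E[η(X,s)η(X,t)] for X standard normal. *)

theory Defs
  imports "HOL-Probability.Probability"
begin

abbreviation phi :: "real \<Rightarrow> real" where
  "phi \<equiv> std_normal_density"

definition Phi :: "real \<Rightarrow> real" where
  "Phi = cdf std_normal_distribution"


text \<open>
  Elements of \<open>L\<^sup>2(M)\<close> are represented by square integrable functions rather than by their
  classes modulo equality almost everywhere. Every set in the generator of \<open>L2_borel\<close> is open for
  the seminorm topology and hence a union of such classes, so \<open>L2_borel\<close> is the Borel
  \<open>\<sigma>\<close>-algebra of the quotient.
\<close>

definition L2_space :: "'a measure \<Rightarrow> ('a \<Rightarrow> real) set" where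
  "L2_space M = {f \<in> borel_measurable M. integrable M (\<lambda>x. (f x)\<^sup>2)}"

definition L2_inner :: "'a measure \<Rightarrow> ('a \<Rightarrow> real) \<Rightarrow> ('a \<Rightarrow> real) \<Rightarrow> real" where
  "L2_inner M f g = (\<integral>x. f x * g x \<partial>M)"

definition L2_nrm :: "'a measure \<Rightarrow> ('a \<Rightarrow> real) \<Rightarrow> real" where
  "L2_nrm M f = sqrt (\<integral>x. (f x)\<^sup>2 \<partial>M)"

definition L2_borel :: "'a measure \<Rightarrow> ('a \<Rightarrow> real) measure" where
  "L2_borel M = sigma (L2_space M)
     {U. U \<subseteq> L2_space M \<and>
         (\<forall>f\<in>U. \<exists>e>0. \<forall>g\<in>L2_space M. L2_nrm M (\<lambda>x. g x - f x) < e \<longrightarrow> g \<in> U)}"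

text \<open>Point masses count as (degenerate) Gaussian laws.\<close>

definition gaussian_law :: "real measure \<Rightarrow> bool" where
  "gaussian_law \<mu> \<longleftrightarrow>
     (\<exists>m. \<mu> = return borel m) \<or>
     (\<exists>m \<sigma>. 0 < \<sigma> \<and> \<mu> = density lborel (\<lambda>x. ennreal (normal_density m \<sigma> x)))"

definition gaussian_L2_element :: "'w measure \<Rightarrow> 'a measure \<Rightarrow> ('w \<Rightarrow> 'a \<Rightarrow> real) \<Rightarrow> bool" where
  "gaussian_L2_element N M Z \<longleftrightarrow>
     Z \<in> measurable N (L2_borel M) \<and>
     (\<forall>g\<in>L2_space M. gaussian_law (distr N borel (\<lambda>w. L2_inner M (Z w) g)))"

definition centred_L2_element :: "'w measure \<Rightarrow> 'a measure \<Rightarrow> ('w \<Rightarrow> 'a \<Rightarrow> real) \<Rightarrow> bool" where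
  "centred_L2_element N M Z \<longleftrightarrow>
     (\<forall>g\<in>L2_space M. (\<integral>w. L2_inner M (Z w) g \<partial>N) = 0)"

text \<open>The covariance operator of \<open>Z\<close> is the integral operator with kernel \<open>K\<close>.\<close>

definition has_covariance_kernel ::
    "'w measure \<Rightarrow> 'a measure \<Rightarrow> ('w \<Rightarrow> 'a \<Rightarrow> real) \<Rightarrow> ('a \<Rightarrow> 'a \<Rightarrow> real) \<Rightarrow> bool" where
  "has_covariance_kernel N M Z K \<longleftrightarrow>
     (\<forall>g\<in>L2_space M. \<forall>h\<in>L2_space M.
        (\<integral>w. L2_inner M (Z w) g * L2_inner M (Z w) h \<partial>N) =
        (\<integral>s. (\<integral>t. K s t * g s * h t \<partial>M) \<partial>M))"

definition weighted_lebesgue :: "(real \<Rightarrow> real) \<Rightarrow> real measure" where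
  "weighted_lebesgue \<omega> = density lborel (\<lambda>t. ennreal (\<omega> t))"


definition sample_mean :: "nat \<Rightarrow> (nat \<Rightarrow> real) \<Rightarrow> real" where
  "sample_mean n x = (\<Sum>k=1..n. x k) / real n"

definition sample_sd :: "nat \<Rightarrow> (nat \<Rightarrow> real) \<Rightarrow> real" where
  "sample_sd n x = sqrt ((\<Sum>k=1..n. (x k - sample_mean n x)\<^sup>2) / real n)"

definition scaled_residual :: "nat \<Rightarrow> (nat \<Rightarrow> real) \<Rightarrow> nat \<Rightarrow> real" where
  "scaled_residual n x j = (x j - sample_mean n x) / sample_sd n x"

definition G2 :: "(real \<Rightarrow> real) \<Rightarrow> nat \<Rightarrow> (nat \<Rightarrow> real) \<Rightarrow> real" where
  "G2 \<omega> n x = real n *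
     (\<integral>t. ((1 / real n) *
             (\<Sum>j=1..n. scaled_residual n x j * (scaled_residual n x j - t) *
                         indicator {..t} (scaled_residual n x j))
           - Phi t)\<^sup>2 * \<omega> t \<partial>lborel)"

definition alternative_density :: "(real \<Rightarrow> real) \<Rightarrow> nat \<Rightarrow> real \<Rightarrow> real" where
  "alternative_density c n x = phi x * (1 + 1 / sqrt (real n) * c x)"

definition eta :: "real \<Rightarrow> real \<Rightarrow> real" where
  "eta x s = x * (x - s) * indicator {..s} x
     - phi s * (1 / 2 * (1 - x\<^sup>2) * s - 2 * x) - Phi s * (x\<^sup>2 - x * s)"

definition zeta :: "(real \<Rightarrow> real) \<Rightarrow> real \<Rightarrow> real" where
  "zeta c s = (\<integral>x. eta x s * c x * phi x \<partial>lborel)"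


text \<open>
  The published kernel is a formula in \<open>\<phi>\<close>, \<open>\<Phi>\<close> and \<open>\<phi>', \<phi>'', \<phi>'''\<close>; below, \<open>d k\<close> stands for
  the \<open>k\<close>-th ``derivative'' symbol of \<open>\<phi>\<close>.

  Read with the derivatives of \<open>\<phi>\<close> (\<open>phi_derivs\<close>) it is not a covariance kernel: its diagonal is
  \<open>2 s \<phi>(s) (1 - 2 \<Phi>(s)) + (3 + s\<^sup>2) \<Phi>(s) (1 - \<Phi>(s)) + (3/2) s\<^sup>2 \<phi>(s)\<^sup>2\<close>, which is negative at
  \<open>s = 3\<close> (use \<open>1 - \<Phi>(s) \<le> \<phi>(s) / s\<close>).

  Read with \<open>(- x) ^ k * \<phi>(x)\<close> for the \<open>k\<close>-th derivative (\<open>phi_powers\<close>; the same for \<open>k = 1\<close>) it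
  is the covariance \<open>\<integral> \<eta>(x,s) \<eta>(x,t) \<phi>(x) dx\<close>, which is where it comes from: with
  \<open>m = min s t\<close>, the part of this integral from the indicator terms is
  \<open>\<integral>\<^bsub>x \<le> m\<^esub> x\<^sup>2 (x - s) (x - t) \<phi>(x) dx =
   - m\<^sup>3 \<phi>(m) + (s + t) m\<^sup>2 \<phi>(m) - (3 + s t) m \<phi>(m) + 2 (s + t) \<phi>(m) + (3 + s t) \<Phi>(m)\<close>.
\<close>

definition phi_derivs :: "nat \<Rightarrow> real \<Rightarrow> real" where
  "phi_derivs k = (deriv ^^ k) phi"

definition phi_powers :: "nat \<Rightarrow> real \<Rightarrow> real" where
  "phi_powers k x = (- x) ^ k * phi x"

definition Psi1 :: "(nat \<Rightarrow> real \<Rightarrow> real) \<Rightarrow> real \<Rightarrow> real \<Rightarrow> real" where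
  "Psi1 d s t = d 3 (min s t) + (s + t) * d 2 (min s t) + (3 + s * t) * d 1 (min s t)
     + 2 * (s + t) * phi (min s t) + (3 + s * t) * Phi (min s t)
     + (- 4 + 3 / 2 * (s * t)) * phi s * phi t - (3 + s * t) * Phi s * Phi t"

definition Psi2 :: "(nat \<Rightarrow> real \<Rightarrow> real) \<Rightarrow> real \<Rightarrow> real \<Rightarrow> real" where
  "Psi2 d s t = 2 * phi t * (- d 2 s - s * d 1 s)"

definition Psi3 :: "(nat \<Rightarrow> real \<Rightarrow> real) \<Rightarrow> real \<Rightarrow> real \<Rightarrow> real" where
  "Psi3 d s t = Phi t *
     (- d 3 s - (s + t) * d 2 s - (3 + s * t) * d 1 s - 2 * (s + t) * phi s)"

definition Psi4 :: "(nat \<Rightarrow> real \<Rightarrow> real) \<Rightarrow> real \<Rightarrow> real \<Rightarrow> real" where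
  "Psi4 d s t = 1 / 2 * t * phi t * (d 3 s + s * d 2 s + 2 * d 1 s)"

definition kernel_K2 :: "(nat \<Rightarrow> real \<Rightarrow> real) \<Rightarrow> real \<Rightarrow> real \<Rightarrow> real" where
  "kernel_K2 d s t = Psi1 d s t + Psi2 d s t + Psi3 d s t + Psi4 d s t
     + Psi2 d t s + Psi3 d t s + Psi4 d t s"

end

theory Submission
  imports Defs
begin

text \<open>
  The random function \<open>V\<^sub>n\<close> with \<open>G\<^sub>n = \<parallel>V\<^sub>n\<parallel>\<^sup>2\<close> is close in \<open>L\<^sup>2\<close> to the normalised sum
  \<open>W\<^sub>n(s) = n\<^bsup>-1/2\<^esup> \<Sum>\<^sub>j \<eta>(X\<^sub>j, s)\<close>: in the summand \<open>x (x - u) 1{x \<le> u}\<close> the random threshold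
  \<open>u = m + \<sigma> s\<close> enters continuously, with derivative \<open>- x 1{x \<le> u}\<close>, so replacing \<open>u\<close> by \<open>s\<close> costs
  the mean derivative times \<open>u - s\<close> plus the integral of a centred process over a window of width
  \<open>O(n\<^bsup>-1/2\<^esup>)\<close>, which a second moment bound controls without any empirical process theory.
  The sum \<open>W\<^sub>n\<close> has mean \<open>\<zeta>\<close> under \<open>p\<^sub>n\<close> directly, so no contiguity argument is needed.

  To identify the limit of \<open>\<parallel>W\<^sub>n\<parallel>\<^sup>2\<close>, project on step functions over finer and finer cells; the
  projection error is small uniformly in \<open>n\<close>. The squared norm of a projection is a finite sum of
  squares \<open>a\<^sub>i\<^sup>2\<close> of linear functionals, and \<open>exp (- \<Sum> a\<^sub>i\<^sup>2 / 2)\<close> is the average of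
  \<open>exp (i \<Sum> \<xi>\<^sub>i a\<^sub>i)\<close> over independent standard normal \<open>\<xi>\<^sub>i\<close>. Convergence of Laplace transforms
  thus follows from the one-dimensional central limit theorem for the functionals
  \<open>\<langle>W\<^sub>n, g\<rangle>\<close>, whose limit variance is the covariance form of the kernel at \<open>g\<close>.

  With the true derivatives of \<open>\<phi>\<close> the kernel is negative at \<open>(3, 3)\<close>; no random element
  has such a covariance kernel and the hypotheses are contradictory.
\<close>

section \<open>Laplace transforms and weak convergence\<close>

text \<open>Only the squared norm is at stake, a nonnegative variable, so neither weak convergence
  nor tightness in \<open>L\<^sup>2\<close> has to be established: Laplace transforms reduce the
  claim to limits of numbers. Two obstacles shape the estimates. The window between \<open>s\<close>
  and \<open>u = m + \<sigma> * s\<close> depends on the sample, so moment bounds cannot be applied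
  on it directly; the difference is bounded pathwise instead, by Cauchy-Schwarz against the slope
  process on the whole line, whose weight \<open>1 / (1 + v\<^sup>2)\<close> keeps the mean finite.
  Moreover \<open>u - s\<close> grows linearly in \<open>s\<close>, so the second order remainder of
  \<open>Phi\<close> grows like \<open>s\<^sup>2\<close> and its square like \<open>s ^ 4\<close>:
  the fourth moment of the weight pays for this. Markov's inequality first freezes all sample
  quantities at a level \<open>K\<close>; the error constants are then polynomials in
  \<open>K\<close>, and \<open>1 / sqrt n\<close> beats them because \<open>K\<close> is chosen
  before \<open>n\<close>.\<close>

lemma cts_step_polynomial_approx:
  assumes "x < y" "0 < e"
  obtains a :: "nat \<Rightarrow> real" and m where
    "\<And>u. 0 \<le> u \<Longrightarrow> \<bar>cts_step x y u - (\<Sum>i\<le>m. a i * exp (- (real i * u)))\<bar> < e"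
proof -
  \<comment> \<open>The substitution \<open>v = exp (- u)\<close> carries the half-line to (0, 1].
    The value 0 for \<open>v \<le> 0\<close> extends the function continuously because
    \<open>cts_step x y\<close> vanishes beyond \<open>y\<close>.\<close>
  define h where "h v = (if v \<le> 0 then 0 else cts_step x y (- ln v))" for v
  have cont: "continuous_on UNIV (cts_step x y)"
    using cts_step_uniformly_continuous[OF \<open>x < y\<close>] by (rule uniformly_continuous_imp_continuous)
  have "continuous_on UNIV h"
  proof (rule continuous_at_imp_continuous_on, rule ballI)
    fix v :: real
    \<comment> \<open>The cases overlap: the first contains 0 with a neighbourhood, and there
      \<open>h\<close> is constantly 0.\<close>
    consider "v < exp (- y)" | "0 < v"
      by (metis exp_gt_zero linorder_less_linear order.strict_trans)
    then show "isCont h v"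
    proof cases
      case 1
      have "eventually (\<lambda>w. w < exp (- y)) (nhds v)"
        using 1 by (intro eventually_nhds_in_open[of "{..<exp (-y)}" v, simplified])
      then have "eventually (\<lambda>w. h w = 0) (nhds v)"
      proof eventually_elim
        case (elim w)
        show ?case
        proof (cases "w \<le> 0")
          case False
          then have "y < - ln w"
            using elim by (metis exp_less_cancel_iff exp_ln less_minus_iff not_le)
          then show ?thesis using \<open>x < y\<close> by (simp add: h_def cts_step_def)
        qed (simp add: h_def)
      qed
      then show ?thesis by (simp add: isCont_cong)
    next
      case 2
      have "eventually (\<lambda>w. 0 < w) (nhds v)"
        using 2 by (intro eventually_nhds_in_open[of "{0<..}" v, simplified])
      then have "eventually (\<lambda>w. h w = cts_step x y (- ln w)) (nhds v)"
        by eventually_elim (simp add: h_def)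
      moreover have "isCont (\<lambda>w. cts_step x y (- ln w)) v"
      proof (rule isCont_o2[where f = "\<lambda>w. - ln w" and g = "cts_step x y"])
        show "isCont (\<lambda>w. - ln w) v"
          using 2 by (intro continuous_intros) simp
        show "isCont (cts_step x y) (- ln v)"
          using cont by (simp add: continuous_on_eq_continuous_at)
      qed
      ultimately show ?thesis by (simp add: isCont_cong)
    qed
  qed
  then have "continuous_on {0..1} h" by (rule continuous_on_subset) simp
  then obtain g where g: "real_polynomial_function g" "\<And>v. v \<in> {0..1} \<Longrightarrow> \<bar>h v - g v\<bar> < e"
    using Stone_Weierstrass_real_polynomial_function[of "{0..1::real}" h e] \<open>0 < e\<close> by auto
  obtain a m where gp: "g = (\<lambda>v. \<Sum>i\<le>m. a i * v ^ i)"
    using g(1) unfolding real_polynomial_function_iff_sum by blast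
  show ?thesis
  proof
    fix u :: real assume "0 \<le> u"
    then have "\<bar>h (exp (- u)) - g (exp (- u))\<bar> < e"
      by (intro g(2)) auto
    then show "\<bar>cts_step x y u - (\<Sum>i\<le>m. a i * exp (- (real i * u)))\<bar> < e"
      by (simp add: h_def gp flip: exp_of_nat_mult)
  qed
qed

text \<open>Laplace transforms at the integers suffice, since test functions are uniformly close to
  polynomials in \<open>exp (- x)\<close>.\<close>

lemma laplace_conv_imp_weak_conv:
  fixes \<mu> :: "nat \<Rightarrow> real measure" and \<nu> :: "real measure"
  assumes \<mu>: "\<And>n. real_distribution (\<mu> n)" and \<nu>: "real_distribution \<nu>"
    and \<mu>_nonneg: "\<And>n. AE x in \<mu> n. 0 \<le> x" and \<nu>_nonneg: "AE x in \<nu>. 0 \<le> x"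
    and conv: "\<And>k::nat. (\<lambda>n. \<integral>x. exp (- (real k * x)) \<partial>\<mu> n) \<longlonglongrightarrow> (\<integral>x. exp (- (real k * x)) \<partial>\<nu>)"
  shows "weak_conv_m \<mu> \<nu>"
proof (rule integral_cts_step_conv_imp_weak_conv[OF \<mu> \<nu>])
  fix x y :: real assume xy: "x < y"
  have approx: "\<bar>(\<integral>u. cts_step x y u \<partial>\<rho>) - (\<Sum>i\<le>m. a i * (\<integral>u. exp (- (real i * u)) \<partial>\<rho>))\<bar> \<le> e"
    if "real_distribution \<rho>" "AE u in \<rho>. 0 \<le> u"
      and a: "\<And>u. 0 \<le> u \<Longrightarrow> \<bar>cts_step x y u - (\<Sum>i\<le>m. a i * exp (- (real i * u)))\<bar> < e"
    for \<rho> :: "real measure" and a :: "nat \<Rightarrow> real" and m e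
  proof -
    interpret real_distribution \<rho> by fact
    have int: "integrable \<rho> (\<lambda>u. exp (- (real i * u)))" for i
      using that(2) by (intro integrable_const_bound[of _ 1]) (auto elim!: eventually_mono)
    have "\<bar>(\<integral>u. cts_step x y u \<partial>\<rho>) - (\<Sum>i\<le>m. a i * (\<integral>u. exp (- (real i * u)) \<partial>\<rho>))\<bar>
        = \<bar>\<integral>u. cts_step x y u - (\<Sum>i\<le>m. a i * exp (- (real i * u))) \<partial>\<rho>\<bar>"
      using int integrable_cts_step[OF xy] by simp
    also have "\<dots> \<le> (\<integral>u. \<bar>cts_step x y u - (\<Sum>i\<le>m. a i * exp (- (real i * u)))\<bar> \<partial>\<rho>)"
      by (rule integral_abs_bound)
    also have "\<dots> \<le> (\<integral>u. e \<partial>\<rho>)"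
      using that(2) int integrable_cts_step[OF xy]
      by (intro integral_mono_AE) (auto elim!: eventually_mono intro: less_imp_le a)
    finally show ?thesis using prob_space by simp
  qed
  have abs_triangle_three: "\<bar>p - q\<bar> < r" if "\<bar>p - p'\<bar> \<le> r / 3" "\<bar>p' - q'\<bar> < r / 3" "\<bar>q - q'\<bar> \<le> r / 3"
    for p p' q q' r :: real
    using that by linarith
  show "(\<lambda>n. \<integral>u. cts_step x y u \<partial>\<mu> n) \<longlonglongrightarrow> (\<integral>u. cts_step x y u \<partial>\<nu>)"
  proof (rule LIMSEQ_I)
    fix r :: real assume "0 < r"
    then have "0 < r / 3" by simp
    from cts_step_polynomial_approx[OF xy this] obtain a m where
      a: "\<And>u. 0 \<le> u \<Longrightarrow> \<bar>cts_step x y u - (\<Sum>i\<le>m. a i * exp (- (real i * u)))\<bar> < r / 3"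
      by blast
    have "(\<lambda>n. \<Sum>i\<le>m. a i * (\<integral>u. exp (- (real i * u)) \<partial>\<mu> n))
        \<longlonglongrightarrow> (\<Sum>i\<le>m. a i * (\<integral>u. exp (- (real i * u)) \<partial>\<nu>))"
      by (intro tendsto_intros conv)
    then have "\<exists>n0. \<forall>n\<ge>n0. norm ((\<Sum>i\<le>m. a i * (\<integral>u. exp (- (real i * u)) \<partial>\<mu> n))
          - (\<Sum>i\<le>m. a i * (\<integral>u. exp (- (real i * u)) \<partial>\<nu>))) < r / 3"
      using \<open>0 < r\<close> by (intro LIMSEQ_D) auto
    then obtain n0 where
      n0: "\<And>n. n \<ge> n0 \<Longrightarrow> \<bar>(\<Sum>i\<le>m. a i * (\<integral>u. exp (- (real i * u)) \<partial>\<mu> n))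
          - (\<Sum>i\<le>m. a i * (\<integral>u. exp (- (real i * u)) \<partial>\<nu>))\<bar> < r / 3"
      unfolding real_norm_def by blast
    have "norm ((\<integral>u. cts_step x y u \<partial>\<mu> n) - (\<integral>u. cts_step x y u \<partial>\<nu>)) < r" if "n \<ge> n0" for n
      unfolding real_norm_def
      using abs_triangle_three[OF approx[OF \<mu> \<mu>_nonneg a, of n] n0[OF that] approx[OF \<nu> \<nu>_nonneg a]]
      .
    then show "\<exists>n0. \<forall>n\<ge>n0. norm ((\<integral>u. cts_step x y u \<partial>\<mu> n) - (\<integral>u. cts_step x y u \<partial>\<nu>)) < r"
      by blast
  qed
qed

section \<open>Squares in the exponent as Gaussian averages of characters\<close>

lemma exp_neg_half_square:
  "complex_of_real (exp (- (a\<^sup>2 / 2))) = (\<integral>z. iexp (a * z) \<partial>std_normal_distribution)"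
  using char_std_normal_distribution by (simp add: char_def fun_eq_iff)

text \<open>Fubini applied to \<open>exp_neg_half_square\<close>. The factor \<open>Y\<close> stands
  for everything that is not randomised at this step; its bound 1 gives integrability on the
  product.\<close>

lemma gaussian_randomisation_step:
  fixes A :: "'a \<Rightarrow> real" and Y :: "'a \<Rightarrow> complex"
  assumes M: "prob_space M" and [measurable]: "A \<in> borel_measurable M" "Y \<in> borel_measurable M"
    and Y: "\<And>w. norm (Y w) \<le> 1"
  shows "(\<integral>w. exp (- ((A w)\<^sup>2 / 2)) * Y w \<partial>M)
    = (\<integral>z. (\<integral>w. iexp (A w * z) * Y w \<partial>M) \<partial>std_normal_distribution)"
proof -
  interpret M: prob_space M by fact
  interpret G: real_distribution std_normal_distribution by (rule real_dist_normal_dist)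
  interpret P: pair_prob_space M std_normal_distribution ..
  have "integrable (M \<Otimes>\<^sub>M std_normal_distribution) (\<lambda>(w, z). iexp (A w * z) * Y w)"
    by (rule P.P.integrable_const_bound[of _ 1]) (auto simp: norm_mult Y split_beta)
  then have "(\<integral>z. (\<integral>w. iexp (A w * z) * Y w \<partial>M) \<partial>std_normal_distribution)
      = (\<integral>w. (\<integral>z. iexp (A w * z) * Y w \<partial>std_normal_distribution) \<partial>M)"
    using P.Fubini_integral[of "\<lambda>w z. iexp (A w * z) * Y w"] by simp
  also have "\<dots> = (\<integral>w. exp (- ((A w)\<^sup>2 / 2)) * Y w \<partial>M)"
    by (intro Bochner_Integration.integral_cong refl)
      (simp add: exp_neg_half_square integral_mult_left_zero)
  finally show ?thesis ..
qed

text \<open>Multiplying by \<open>exp (- A\<^sup>2 / 2)\<close> amounts to averaging over a random Gaussian shift of the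
  coefficient of \<open>A\<close> in the characteristic function.\<close>

lemma laplace_sum_squares_conv:
  fixes A :: "nat \<Rightarrow> 'i \<Rightarrow> 'a \<Rightarrow> real" and B :: "'i \<Rightarrow> 'b \<Rightarrow> real"
  assumes M: "\<And>n. prob_space (M n)" and N: "prob_space N"
    and A: "\<And>n i. A n i \<in> borel_measurable (M n)" and B: "\<And>i. B i \<in> borel_measurable N"
    and I: "finite I"
    and conv: "\<And>\<xi>. (\<lambda>n. \<integral>w. iexp (\<Sum>i\<in>I. \<xi> i * A n i w) \<partial>M n) \<longlonglongrightarrow> (\<integral>w. iexp (\<Sum>i\<in>I. \<xi> i * B i w) \<partial>N)"
  shows "(\<lambda>n. \<integral>w. exp (- ((\<Sum>i\<in>I. (A n i w)\<^sup>2) / 2)) \<partial>M n) \<longlonglongrightarrow> (\<integral>w. exp (- ((\<Sum>i\<in>I. (B i w)\<^sup>2) / 2)) \<partial>N)"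
proof -
  have [measurable]: "A n i \<in> borel_measurable (M n)" "B i \<in> borel_measurable N" for n i
    using A B by auto
  interpret G: real_distribution std_normal_distribution by (rule real_dist_normal_dist)
  \<comment> \<open>\<open>E J\<close> holds the squares that are not yet randomised,
    \<open>L \<xi>\<close> the character produced by the others.\<close>
  define E where "E J a = complex_of_real (exp (- ((\<Sum>i\<in>J. (a i)\<^sup>2) / 2)))" for J and a :: "'i \<Rightarrow> real"
  define L where "L \<xi> a = iexp (\<Sum>i\<in>I. \<xi> i * a i)" for \<xi> and a :: "'i \<Rightarrow> real"
  have nE: "norm (E J a) \<le> 1" for J a
    unfolding E_def by (simp add: sum_nonneg)
  have nL: "norm (L \<xi> a) = 1" for \<xi> a
    unfolding L_def by simp
  have L_upd: "iexp (a j * z) * L \<xi> a = L (\<xi>(j := \<xi> j + z)) a" if "j \<in> I" for j z \<xi> a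
  proof -
    have "(\<Sum>i\<in>I. (\<xi>(j := \<xi> j + z)) i * a i) = (\<Sum>i\<in>I. \<xi> i * a i + (if i = j then a j * z else 0))"
      by (intro sum.cong) (auto simp: algebra_simps)
    also have "\<dots> = (\<Sum>i\<in>I. \<xi> i * a i) + a j * z"
      using I that by (simp add: sum.distrib)
    finally show ?thesis
      unfolding L_def by (simp add: exp_add[symmetric] algebra_simps)
  qed
  have E_insert: "E (insert j J) a = complex_of_real (exp (- ((a j)\<^sup>2 / 2))) * E J a" if "finite J" "j \<notin> J" for j J a
  proof -
    have "exp (- ((\<Sum>i\<in>insert j J. (a i)\<^sup>2) / 2)) = exp (- ((a j)\<^sup>2 / 2)) * exp (- ((\<Sum>i\<in>J. (a i)\<^sup>2) / 2))"
      using that by (simp add: add_divide_distrib flip: exp_add)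
    then show ?thesis
      unfolding E_def by (simp del: of_real_exp)
  qed
  have step: "(\<integral>w. E (insert j J) (\<lambda>i. C i w) * L \<xi> (\<lambda>i. C i w) \<partial>P)
      = (\<integral>z. (\<integral>w. E J (\<lambda>i. C i w) * L (\<xi>(j := \<xi> j + z)) (\<lambda>i. C i w) \<partial>P) \<partial>std_normal_distribution)"
    if P: "prob_space P" and [measurable]: "\<And>i. C i \<in> borel_measurable P"
      and j: "finite J" "j \<notin> J" "j \<in> I" for P :: "'c measure" and C j J \<xi>
  proof -
    have "(\<integral>w. exp (- ((C j w)\<^sup>2 / 2)) * (E J (\<lambda>i. C i w) * L \<xi> (\<lambda>i. C i w)) \<partial>P)
      = (\<integral>z. (\<integral>w. iexp (C j w * z) * (E J (\<lambda>i. C i w) * L \<xi> (\<lambda>i. C i w)) \<partial>P) \<partial>std_normal_distribution)"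
    proof (rule gaussian_randomisation_step[OF P])
      show "(\<lambda>w. E J (\<lambda>i. C i w) * L \<xi> (\<lambda>i. C i w)) \<in> borel_measurable P"
        unfolding E_def L_def by measurable
      show "norm (E J (\<lambda>i. C i w) * L \<xi> (\<lambda>i. C i w)) \<le> 1" for w
        using nE by (simp add: norm_mult nL)
    qed simp
    moreover have "iexp (C j w * z) * (E J (\<lambda>i. C i w) * L \<xi> (\<lambda>i. C i w))
        = E J (\<lambda>i. C i w) * L (\<xi>(j := \<xi> j + z)) (\<lambda>i. C i w)" for w z
      using L_upd[OF j(3), of "\<lambda>i. C i w"] by (simp add: mult.left_commute)
    ultimately show ?thesis by (simp only: E_insert[OF j(1,2)] mult.assoc)
  qed
  \<comment> \<open>The induction is on the set of squares still present and for all
    \<open>\<xi>\<close> at once, since every step shifts one coordinate of \<open>\<xi>\<close>.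
    The empty set is \<open>conv\<close>; the full set with \<open>\<xi> = 0\<close> is the
    claim.\<close>
  have main: "(\<lambda>n. \<integral>w. E J (\<lambda>i. A n i w) * L \<xi> (\<lambda>i. A n i w) \<partial>M n)
      \<longlonglongrightarrow> (\<integral>w. E J (\<lambda>i. B i w) * L \<xi> (\<lambda>i. B i w) \<partial>N)" if "J \<subseteq> I" for J \<xi>
    using finite_subset[OF that I] that
  proof (induction J arbitrary: \<xi> rule: finite_induct)
    case empty
    then show ?case using conv[of \<xi>] by (simp add: E_def L_def)
  next
    case (insert j J)
    have j: "j \<in> I" using insert.prems by auto
    \<comment> \<open>Uniform in \<open>\<xi>\<close>, hence a majorant for dominated convergence in
      the outer Gaussian variable.\<close>
    have bd: "norm (\<integral>w. E J (\<lambda>i. C i w) * L \<xi> (\<lambda>i. C i w) \<partial>P) \<le> 1"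
      if P: "prob_space P" and [measurable]: "\<And>i. C i \<in> borel_measurable P" for P :: "'c measure" and C \<xi>
    proof -
      interpret P: prob_space P by fact
      have "norm (\<integral>w. E J (\<lambda>i. C i w) * L \<xi> (\<lambda>i. C i w) \<partial>P)
          \<le> (\<integral>w. norm (E J (\<lambda>i. C i w) * L \<xi> (\<lambda>i. C i w)) \<partial>P)"
        by (rule integral_norm_bound)
      also have "\<dots> \<le> 1"
        by (rule P.integral_le_const)
          (auto simp: norm_mult nL nE E_def L_def sum_nonneg intro!: P.integrable_const_bound[of _ 1])
      finally show ?thesis .
    qed
    have meas: "(\<lambda>z. \<integral>w. E J (\<lambda>i. C i w) * L (\<xi>(j := \<xi> j + z)) (\<lambda>i. C i w) \<partial>P)
        \<in> borel_measurable std_normal_distribution"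
      if P: "prob_space P" and [measurable]: "\<And>i. C i \<in> borel_measurable P" for P :: "'c measure" and C
    proof -
      interpret P: prob_space P by fact
      show ?thesis
        unfolding E_def L_def fun_upd_def by measurable
    qed
    show ?case
      unfolding step[OF M A insert.hyps j] step[OF N B insert.hyps j]
      by (rule integral_dominated_convergence[where w = "\<lambda>_. 1"])
        (use insert bd[OF M A] meas[OF M A] meas[OF N B] in auto)
  qed
  from tendsto_Re[OF main[OF order_refl, of "\<lambda>_. 0"]] show ?thesis
    by (simp add: E_def L_def integral_complex_of_real)
qed

section \<open>Rows of the triangular array\<close>

abbreviation gauss :: "real measure" where
  "gauss \<equiv> std_normal_distribution"

interpretation gauss: real_distribution gauss
  by (rule real_dist_normal_dist)

lemma (in prob_space) expectation_square_ge:
  fixes f :: "'a \<Rightarrow> real"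
  assumes [measurable]: "f \<in> borel_measurable M" and "integrable M (\<lambda>x. (f x)\<^sup>2)"
  shows "(expectation f)\<^sup>2 \<le> expectation (\<lambda>x. (f x)\<^sup>2)"
proof -
  have "integrable M f" by (rule square_integrable_imp_integrable[OF assms])
  then show ?thesis using variance_eq[of f] variance_positive[of f] assms(2) by simp
qed

text \<open>Deliberately not centred at the row mean: for \<open>f\<close> with Gaussian mean 0 the
  sum keeps the mean \<open>\<integral>x. f x * c x \<partial>gauss\<close> under the alternative,
  and this becomes the shift \<open>zeta\<close>.\<close>

definition normsum :: "nat \<Rightarrow> (real \<Rightarrow> real) \<Rightarrow> (nat \<Rightarrow> real) \<Rightarrow> real" where
  "normsum n f x = (\<Sum>j=1..n. f (x j)) / sqrt (real n)"

text \<open>The central limit theorem for one functional, in terms of characteristic functions. The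
  term \<open>c / sqrt n\<close> of the density meets the first order term of the exponential; their
  product is of order \<open>1 / n\<close> and produces the limiting mean.\<close>

lemma char_power_tendsto:
  fixes h c :: "real \<Rightarrow> real"
  assumes [measurable]: "c \<in> borel_measurable borel" "h \<in> borel_measurable borel"
    and c: "\<And>x. \<bar>c x\<bar> \<le> C" and c0: "(\<integral>x. c x \<partial>gauss) = 0"
    and h2: "integrable gauss (\<lambda>x. (h x)\<^sup>2)" and h0: "(\<integral>x. h x \<partial>gauss) = 0"
  shows "(\<lambda>n. (\<integral>x. (1 + c x / sqrt (real n)) *\<^sub>R iexp (h x / sqrt (real n)) \<partial>gauss) ^ n)
    \<longlonglongrightarrow> exp (\<i> * (\<integral>x. h x * c x \<partial>gauss) - (\<integral>x. (h x)\<^sup>2 \<partial>gauss) / 2)"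
proof -
  have h1: "integrable gauss h"
    using h2 by (rule gauss.square_integrable_imp_integrable[rotated]) simp
  have C0: "0 \<le> C" using c[of 0] by linarith
  have ic: "integrable gauss c"
    by (rule gauss.integrable_const_bound[of _ C]) (auto simp: c)
  have ihc: "integrable gauss (\<lambda>x. h x * c x)"
    by (rule Bochner_Integration.integrable_bound[OF integrable_mult_right[OF h1, of C]])
      (auto simp: abs_mult C0 mult.commute intro!: mult_right_mono c)
  define \<psi> where "\<psi> = \<i> * (\<integral>x. h x * c x \<partial>gauss) - (\<integral>x. (h x)\<^sup>2 \<partial>gauss) / 2"
  define z where "z n = (\<integral>x. (1 + c x / sqrt (real n)) *\<^sub>R iexp (h x / sqrt (real n)) \<partial>gauss)" for n
  \<comment> \<open>\<open>n\<close> times the second order remainder of the exponential, weighted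
    by the likelihood ratio.\<close>
  define r where "r n x = (1 + c x / sqrt (real n)) *\<^sub>R
      (of_nat n * (iexp (h x / sqrt (real n)) - 1 - \<i> * (h x / sqrt (real n))))" for n x
  have [measurable]: "r n \<in> borel_measurable borel" for n
    unfolding r_def by measurable
  have r_bd: "norm (r n x) \<le> (1 + C) * (h x)\<^sup>2" if "n \<ge> 1" for n x
  proof -
    have 1: "1 \<le> sqrt (real n)" using that by simp
    have "\<bar>c x\<bar> / sqrt (real n) \<le> C / 1"
      using c[of x] 1 C0 by (intro frac_le) auto
    then have a: "\<bar>1 + c x / sqrt (real n)\<bar> \<le> 1 + C"
      using abs_triangle_ineq[of 1 "c x / sqrt (real n)"] by (simp add: abs_divide)
    have "norm (iexp (h x / sqrt (real n)) - (\<Sum>k\<le>1. (\<i> * (h x / sqrt (real n)))^k / fact k))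
        \<le> \<bar>h x / sqrt (real n)\<bar> ^ Suc 1 / fact (Suc 1)"
      by (rule iexp_approx1)
    then have b: "norm (iexp (h x / sqrt (real n)) - 1 - \<i> * (h x / sqrt (real n))) \<le> (h x)\<^sup>2 / (2 * real n)"
      using that by (simp add: power_divide field_simps flip: power2_eq_square)
    have "norm (r n x) \<le> (1 + C) * (real n * ((h x)\<^sup>2 / (2 * real n)))"
      unfolding r_def norm_scaleR norm_mult norm_of_nat using a b C0
      by (intro mult_mono) auto
    also have "\<dots> \<le> (1 + C) * (h x)\<^sup>2"
      using that C0 by (intro mult_left_mono) (auto simp: field_simps)
    finally show ?thesis .
  qed
  have int_r: "integrable gauss (r n)" if "n \<ge> 1" for n
    by (rule Bochner_Integration.integrable_bound[OF integrable_mult_right[OF h2, of "1 + C"]])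
      (use r_bd[OF that] C0 in \<open>auto simp: abs_mult\<close>)
  \<comment> \<open>Orders 0 and 1 are integrated exactly: the means of \<open>c\<close> and
    \<open>h\<close> vanish, and only their product survives.\<close>
  have eq: "of_nat n * (z n - 1) = (\<integral>x. r n x \<partial>gauss) + \<i> * (\<integral>x. h x * c x \<partial>gauss)" if "n \<ge> 1" for n
  proof -
    let ?g = "\<lambda>x. complex_of_real (1 + c x / sqrt (real n)) + \<i> * complex_of_real (h x / sqrt (real n) + h x * c x / real n)"
    have pw: "(1 + c x / sqrt (real n)) *\<^sub>R iexp (h x / sqrt (real n)) = r n x / of_nat n + ?g x" for x
    proof -
      have alg: "(1 + c' / s) * e = (1 + c' / s) * (s * s * (e - 1 - \<i> * (h' / s))) / (s * s)
          + ((1 + c' / s) + \<i> * (h' / s + h' * c' / (s * s)))" if "s \<noteq> 0" for s e c' h' :: complex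
        using that by (simp add: field_simps)
      have "sqrt (real n) * sqrt (real n) = real n" by simp
      then have "complex_of_real (sqrt (real n)) * complex_of_real (sqrt (real n)) = of_nat n"
        by (metis of_real_mult of_real_of_nat_eq)
      moreover have "complex_of_real (sqrt (real n)) \<noteq> 0" using that by simp
      ultimately show ?thesis
        using alg[of "complex_of_real (sqrt (real n))" "complex_of_real (c x)"
          "iexp (h x / sqrt (real n))" "complex_of_real (h x)"]
        unfolding r_def scaleR_conv_of_real by simp
    qed
    have ig: "integrable gauss ?g"
      using ic h1 ihc by (intro Bochner_Integration.integrable_add integrable_mult_right integrable_of_real
        integrable_divide) auto
    have "z n = (\<integral>x. r n x / of_nat n + ?g x \<partial>gauss)"
      unfolding z_def pw ..
    also have "\<dots> = (\<integral>x. r n x \<partial>gauss) / of_nat n + (\<integral>x. ?g x \<partial>gauss)"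
      using int_r[OF that] ig by (subst Bochner_Integration.integral_add) auto
    also have "(\<integral>x. ?g x \<partial>gauss) = 1 + \<i> * ((\<integral>x. h x * c x \<partial>gauss) / real n)"
      using ic h1 ihc gauss.prob_space
      by (subst Bochner_Integration.integral_add)
        (auto simp: c0 h0 integral_complex_of_real simp del: of_real_add of_real_divide of_real_mult
          simp flip: of_real_divide)
    finally show ?thesis using that by (simp add: field_simps)
  qed
  \<comment> \<open>The index starts at 1 because the majorant \<open>r_bd\<close> does.\<close>
  have rlim1: "(\<lambda>n. \<integral>x. r (n + 1) x \<partial>gauss) \<longlonglongrightarrow> (\<integral>x. - complex_of_real ((h x)\<^sup>2) / 2 \<partial>gauss)"
  proof (rule integral_dominated_convergence[where w = "\<lambda>x. (1 + C) * (h x)\<^sup>2"])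
    show "integrable gauss (\<lambda>x. (1 + C) * (h x)\<^sup>2)" using h2 by simp
    show "AE x in gauss. norm (r (n + 1) x) \<le> (1 + C) * (h x)\<^sup>2" for n
      using r_bd[of "n + 1"] by auto
    show "AE x in gauss. (\<lambda>n. r (n + 1) x) \<longlonglongrightarrow> - complex_of_real ((h x)\<^sup>2) / 2"
    proof (rule AE_I2)
      fix x
      have s0: "(\<lambda>n. 1 / sqrt (real n)) \<longlonglongrightarrow> 0"
        by (intro tendsto_divide_0[OF tendsto_const] filterlim_at_top_imp_at_infinity
            filterlim_compose[OF sqrt_at_top] filterlim_real_sequentially)
      have "(\<lambda>n. of_nat n * (iexp (h x / sqrt (real n)) - 1 - \<i> * (h x / sqrt (real n))) - (- complex_of_real ((h x)\<^sup>2) / 2)) \<longlonglongrightarrow> 0"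
      proof (rule Lim_null_comparison)
        show "(\<lambda>n. \<bar>h x\<bar> ^ 3 / 6 * (1 / sqrt (real n))) \<longlonglongrightarrow> 0"
          using tendsto_mult_right_zero[OF s0] .
        show "\<forall>\<^sub>F n in sequentially. norm (of_nat n * (iexp (h x / sqrt (real n)) - 1 - \<i> * (h x / sqrt (real n)))
            - (- complex_of_real ((h x)\<^sup>2) / 2)) \<le> \<bar>h x\<bar> ^ 3 / 6 * (1 / sqrt (real n))"
          using eventually_ge_at_top[of 1]
        proof eventually_elim
          case (elim n)
          define y where "y = h x / sqrt (real n)"
          have sq: "sqrt (real n) > 0" using elim by simp
          have hy: "h x = y * sqrt (real n)" using sq by (simp add: y_def)
          have y2: "(h x)\<^sup>2 = real n * y\<^sup>2" by (simp add: hy power_mult_distrib)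
          have "norm (iexp y - (\<Sum>k\<le>2. (\<i> * y)^k / fact k)) \<le> \<bar>y\<bar> ^ Suc 2 / fact (Suc 2)"
            by (rule iexp_approx1)
          also have "(\<Sum>k\<le>2. (\<i> * y)^k / fact k) = 1 + \<i> * y - complex_of_real (y\<^sup>2) / 2"
            by (simp add: numeral_2_eq_2 power_mult_distrib)
          finally have 3: "norm (iexp y - 1 - \<i> * y + complex_of_real (y\<^sup>2) / 2) \<le> \<bar>y\<bar> ^ 3 / 6"
            by (simp add: fact_numeral algebra_simps eval_nat_numeral)
          have "norm (of_nat n * (iexp y - 1 - \<i> * y) - (- complex_of_real ((h x)\<^sup>2) / 2))
              = norm (of_nat n * (iexp y - 1 - \<i> * y + complex_of_real (y\<^sup>2) / 2))"
            unfolding y2 by (simp add: algebra_simps)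
          also have "\<dots> \<le> real n * (\<bar>y\<bar> ^ 3 / 6)"
            unfolding norm_mult norm_of_nat using 3 by (intro mult_left_mono) auto
          also have "\<dots> = \<bar>h x\<bar> ^ 3 / 6 * (1 / sqrt (real n))"
          proof -
            have "real n = sqrt (real n) * sqrt (real n)" by simp
            then show ?thesis using sq
              by (simp add: hy abs_mult power_mult_distrib eval_nat_numeral field_simps)
          qed
          finally show ?case by (simp add: y_def)
        qed
      qed
      then have A: "(\<lambda>n. of_nat n * (iexp (h x / sqrt (real n)) - 1 - \<i> * (h x / sqrt (real n)))) \<longlonglongrightarrow> - complex_of_real ((h x)\<^sup>2) / 2"
        by (rule LIM_zero_cancel)
      have B: "(\<lambda>n. 1 + c x / sqrt (real n)) \<longlonglongrightarrow> 1"
        using tendsto_add[OF tendsto_const[of 1] tendsto_mult_right_zero[OF s0, of "c x"]] by simp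
      have "(\<lambda>n. r n x) \<longlonglongrightarrow> - complex_of_real ((h x)\<^sup>2) / 2"
        using tendsto_scaleR[OF B A] by (simp only: scaleR_one r_def)
      then show "(\<lambda>n. r (n + 1) x) \<longlonglongrightarrow> - complex_of_real ((h x)\<^sup>2) / 2"
        by (rule LIMSEQ_ignore_initial_segment)
    qed
  qed auto
  have rlim2: "(\<integral>x. - complex_of_real ((h x)\<^sup>2) / 2 \<partial>gauss) = - (\<integral>x. (h x)\<^sup>2 \<partial>gauss) / 2"
    by (simp add: integral_complex_of_real del: of_real_power)
  have rlim: "(\<lambda>n. \<integral>x. r n x \<partial>gauss) \<longlonglongrightarrow> complex_of_real (- (\<integral>x. (h x)\<^sup>2 \<partial>gauss) / 2)"
    using rlim1 unfolding rlim2 by (rule LIMSEQ_offset)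
  have zlim: "(\<lambda>n. of_nat n * (z n - 1)) \<longlonglongrightarrow> \<psi>"
  proof (rule Lim_transform_eventually)
    show "(\<lambda>n. (\<integral>x. r n x \<partial>gauss) + \<i> * (\<integral>x. h x * c x \<partial>gauss)) \<longlonglongrightarrow> \<psi>"
      using tendsto_add[OF rlim tendsto_const[of "\<i> * complex_of_real (\<integral>x. h x * c x \<partial>gauss)"]]
      by (simp add: \<psi>_def)
    show "\<forall>\<^sub>F n in sequentially. (\<integral>x. r n x \<partial>gauss) + \<i> * (\<integral>x. h x * c x \<partial>gauss) = of_nat n * (z n - 1)"
      using eventually_ge_at_top[of 1] by eventually_elim (simp add: eq)
  qed
  have elim: "(\<lambda>n. of_nat n * (exp (\<psi> / of_nat n) - 1)) \<longlonglongrightarrow> \<psi>"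
  proof -
    have "((\<lambda>u. exp (\<psi> * u)) has_field_derivative exp (\<psi> * 0) * \<psi>) (at 0)"
      by (auto intro!: derivative_eq_intros)
    then have "((\<lambda>u. (exp (\<psi> * u) - 1) / u) \<longlongrightarrow> \<psi>) (at 0)"
      by (simp add: has_field_derivative_iff)
    moreover have "filterlim (\<lambda>n. 1 / of_nat (Suc n) :: complex) (at 0) sequentially"
      unfolding filterlim_at using LIMSEQ_Suc[OF lim_1_over_n[where 'a = complex]]
      by (auto simp del: of_nat_Suc)
    ultimately have "(\<lambda>n. (exp (\<psi> * (1 / of_nat (Suc n))) - 1) / (1 / of_nat (Suc n))) \<longlonglongrightarrow> \<psi>"
      by (rule filterlim_compose)
    then have "(\<lambda>n. of_nat (Suc n) * (exp (\<psi> / of_nat (Suc n)) - 1)) \<longlonglongrightarrow> \<psi>"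
      by (simp add: mult.commute del: of_nat_Suc)
    then show ?thesis by (rule LIMSEQ_imp_Suc)
  qed
  \<comment> \<open>In the closed unit disc, n-th powers differ by at most n times the difference of
    the bases. \<open>z n\<close> lies in the disc because the likelihood ratio is nonnegative for
    \<open>C \<le> sqrt n\<close>, and \<open>exp (\<psi> / n)\<close> because the real part of
    \<open>\<psi>\<close> is at most 0.\<close>
  have "(\<lambda>n. z n ^ n - exp \<psi>) \<longlonglongrightarrow> 0"
  proof (rule Lim_null_comparison)
    show "(\<lambda>n. norm (of_nat n * (z n - 1) - of_nat n * (exp (\<psi> / of_nat n) - 1))) \<longlonglongrightarrow> 0"
      using tendsto_norm[OF tendsto_diff[OF zlim elim]] by simp
    have "\<forall>\<^sub>F n in sequentially. C \<le> sqrt (real n)"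
      by (rule filterlim_at_top[THEN iffD1, rule_format])
        (intro filterlim_compose[OF sqrt_at_top] filterlim_real_sequentially)
    then show "\<forall>\<^sub>F n in sequentially. norm (z n ^ n - exp \<psi>) \<le> norm (of_nat n * (z n - 1) - of_nat n * (exp (\<psi> / of_nat n) - 1))"
      using eventually_ge_at_top[of 1]
    proof eventually_elim
      case (elim n)
      have nn: "0 \<le> 1 + c x / sqrt (real n)" for x
      proof -
        have "- (c x) \<le> sqrt (real n)" using c[of x] elim by linarith
        then show ?thesis using elim by (simp add: field_simps)
      qed
      have "norm (z n) \<le> (\<integral>x. norm ((1 + c x / sqrt (real n)) *\<^sub>R iexp (h x / sqrt (real n))) \<partial>gauss)"
        unfolding z_def by (rule integral_norm_bound)
      also have "\<dots> = (\<integral>x. 1 + c x / sqrt (real n) \<partial>gauss)"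
        using nn by simp
      also have "\<dots> = 1" using ic c0 gauss.prob_space by simp
      finally have zn: "norm (z n) \<le> 1" .
      have en: "norm (exp (\<psi> / of_nat n)) \<le> 1"
        by (simp add: norm_exp_eq_Re \<psi>_def Re_divide_of_nat)
      have "exp \<psi> = exp (\<psi> / of_nat n) ^ n"
        using elim by (simp flip: exp_of_nat_mult)
      then have "norm (z n ^ n - exp \<psi>) \<le> real n * norm (z n - exp (\<psi> / of_nat n))"
        using norm_power_diff[OF zn en, of n] by simp
      also have "\<dots> = norm (of_nat n * (z n - exp (\<psi> / of_nat n)))"
        by (simp add: norm_mult)
      finally show ?case by (simp add: algebra_simps)
    qed
  qed
  then show ?thesis
    unfolding z_def[symmetric] \<psi>_def[symmetric] by (rule LIM_zero_cancel)
qed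

text \<open>One row at a fixed \<open>n\<close>. The condition \<open>C_le\<close> keeps the
  likelihood ratio against \<open>gauss\<close> between 0 and \<open>1 + C\<close>, so every moment
  under the row law is controlled by a Gaussian one.\<close>

locale alternative_row = prob_space M
  for M :: "'a measure" +
  fixes c :: "real \<Rightarrow> real" and C :: real and n :: nat and X :: "nat \<Rightarrow> 'a \<Rightarrow> real"
  assumes n_ge: "1 \<le> n"
    and c_meas [measurable]: "c \<in> borel_measurable borel"
    and c_bound: "\<And>x. \<bar>c x\<bar> \<le> C"
    and C_le: "C \<le> sqrt (real n)"
    and indep: "indep_vars (\<lambda>_. borel) X {1..n}"
    and density: "\<And>k. k \<in> {1..n} \<Longrightarrow> distributed M lborel (X k) (\<lambda>x. ennreal (alternative_density c n x))"
begin

lemma C_nonneg: "0 \<le> C"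
  using c_bound[of 0] by linarith

lemma likelihood_nonneg: "0 \<le> 1 + c x / sqrt (real n)"
proof -
  have "- c x \<le> sqrt (real n)" using c_bound[of x] C_le by linarith
  then show ?thesis using n_ge by (simp add: field_simps)
qed

lemma likelihood_le: "1 + c x / sqrt (real n) \<le> 1 + C"
proof -
  have "c x / sqrt (real n) \<le> C / 1"
    using c_bound[of x] n_ge C_nonneg by (intro frac_le) auto
  then show ?thesis by simp
qed

lemma measurable_X [measurable]: "k \<in> {1..n} \<Longrightarrow> X k \<in> borel_measurable M"
  using density by (simp add: distributed_def)

lemma distr_X:
  assumes "k \<in> {1..n}"
  shows "distr M borel (X k) = density gauss (\<lambda>x. ennreal (1 + c x / sqrt (real n)))"
proof -
  have "distr M borel (X k) = distr M lborel (X k)"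
    by (rule distr_cong) auto
  also have "\<dots> = density lborel (\<lambda>x. ennreal (alternative_density c n x))"
    using density[OF assms] by (simp add: distributed_def)
  also have "\<dots> = density gauss (\<lambda>x. ennreal (1 + c x / sqrt (real n)))"
    using likelihood_nonneg by (subst density_density_eq)
      (auto simp: alternative_density_def ennreal_mult)
  finally show ?thesis .
qed

lemma expectation_X:
  fixes f :: "real \<Rightarrow> 'b::{banach, second_countable_topology}"
  assumes k: "k \<in> {1..n}" and f: "integrable gauss f"
  shows "integrable M (\<lambda>w. f (X k w))"
    and "(\<integral>w. f (X k w) \<partial>M) = (\<integral>x. (1 + c x / sqrt (real n)) *\<^sub>R f x \<partial>gauss)"
proof -
  have [measurable]: "f \<in> borel_measurable borel" using f by (simp add: integrable_iff_bounded)
  have "integrable gauss (\<lambda>x. (1 + c x / sqrt (real n)) *\<^sub>R f x)"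
  proof (rule Bochner_Integration.integrable_bound[OF integrable_mult_right[OF integrable_norm[OF f], of "1 + C"]])
    show "AE x in gauss. norm ((1 + c x / sqrt (real n)) *\<^sub>R f x) \<le> norm ((1 + C) * norm (f x))"
      using likelihood_nonneg likelihood_le C_nonneg by (auto intro!: AE_I2 mult_right_mono simp: abs_mult)
  qed auto
  then have "integrable (distr M borel (X k)) f"
    unfolding distr_X[OF k] using likelihood_nonneg by (subst integrable_density) auto
  then show "integrable M (\<lambda>w. f (X k w))"
    using k by (subst (asm) integrable_distr_eq) auto
  have "(\<integral>w. f (X k w) \<partial>M) = (\<integral>x. f x \<partial>distr M borel (X k))"
    using k by (subst integral_distr) auto
  also have "\<dots> = (\<integral>x. (1 + c x / sqrt (real n)) *\<^sub>R f x \<partial>gauss)"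
    unfolding distr_X[OF k] using likelihood_nonneg by (subst integral_density) auto
  finally show "(\<integral>w. f (X k w) \<partial>M) = (\<integral>x. (1 + c x / sqrt (real n)) *\<^sub>R f x \<partial>gauss)" .
qed

lemma normsum_measurable [measurable]:
  assumes [measurable]: "f \<in> borel_measurable borel"
  shows "(\<lambda>w. normsum n f (\<lambda>k. X k w)) \<in> borel_measurable M"
  unfolding normsum_def by measurable

text \<open>A diagonal term costs at most \<open>(1 + C) * V\<close>, and each of the
  \<open>n\<^sup>2\<close> pairs is allowed \<open>m\<^sup>2\<close> in addition. As
  \<open>m\<close> is of order \<open>1 / sqrt n\<close>, the latter sum to
  \<open>(\<integral>x. c x * f x \<partial>gauss)\<^sup>2\<close> after division by
  \<open>n\<close>, which is at most \<open>C\<^sup>2 * V\<close>. Hence a constant free of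
  \<open>n\<close>.\<close>

lemma normsum_second_moment:
  assumes [measurable]: "f \<in> borel_measurable borel"
    and f2: "integrable gauss (\<lambda>x. (f x)\<^sup>2)" and f0: "(\<integral>x. f x \<partial>gauss) = 0"
  shows "integrable M (\<lambda>w. (normsum n f (\<lambda>k. X k w))\<^sup>2)"
    and "(\<integral>w. (normsum n f (\<lambda>k. X k w))\<^sup>2 \<partial>M) \<le> (1 + C + C\<^sup>2) * (\<integral>x. (f x)\<^sup>2 \<partial>gauss)"
proof -
  have f1: "integrable gauss f"
    using f2 by (rule gauss.square_integrable_imp_integrable[rotated]) simp
  have ifc: "integrable gauss (\<lambda>x. c x * f x)"
    by (rule Bochner_Integration.integrable_bound[OF integrable_mult_right[OF f1, of C]])
      (auto simp: abs_mult C_nonneg intro!: mult_right_mono c_bound)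
  define m where "m = (\<integral>x. c x * f x \<partial>gauss) / sqrt (real n)"
  define V where "V = (\<integral>x. (f x)\<^sup>2 \<partial>gauss)"
  have m_eq: "(\<integral>x. (1 + c x / sqrt (real n)) *\<^sub>R f x \<partial>gauss) = m"
  proof -
    have "(\<integral>x. (1 + c x / sqrt (real n)) *\<^sub>R f x \<partial>gauss) = (\<integral>x. f x + c x * f x / sqrt (real n) \<partial>gauss)"
      by (simp add: algebra_simps)
    then show ?thesis using f1 ifc by (simp add: f0 m_def)
  qed
  have int: "integrable M (\<lambda>w. f (X i w) * f (X j w))"
    and E: "(\<integral>w. f (X i w) * f (X j w) \<partial>M) \<le> (if i = j then (1 + C) * V else 0) + m\<^sup>2"
    if ij: "i \<in> {1..n}" "j \<in> {1..n}" for i j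
  proof -
    have "integrable M (\<lambda>w. f (X i w) * f (X j w)) \<and>
      (\<integral>w. f (X i w) * f (X j w) \<partial>M) \<le> (if i = j then (1 + C) * V else 0) + m\<^sup>2"
    proof (cases "i = j")
      case True
      have "(\<integral>w. (f (X i w))\<^sup>2 \<partial>M) = (\<integral>x. (1 + c x / sqrt (real n)) *\<^sub>R (f x)\<^sup>2 \<partial>gauss)"
        by (rule expectation_X(2)[OF ij(1) f2])
      also have "\<dots> \<le> (\<integral>x. (1 + C) * (f x)\<^sup>2 \<partial>gauss)"
      proof (rule integral_mono')
        show "integrable gauss (\<lambda>x. (1 + C) * (f x)\<^sup>2)" using f2 by simp
      qed (use likelihood_le C_nonneg in \<open>auto intro!: mult_right_mono\<close>)
      also have "\<dots> = (1 + C) * V" by (simp add: V_def)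
      finally have "(\<integral>w. (f (X i w))\<^sup>2 \<partial>M) \<le> (1 + C) * V + m\<^sup>2"
        using zero_le_power2[of m] by linarith
      then show ?thesis
        using expectation_X(1)[OF ij(1) f2] True by (simp add: power2_eq_square)
    next
      case False
      have ind: "indep_vars (\<lambda>_. borel) (\<lambda>k w. f (X k w)) {i, j}"
        by (rule indep_vars_compose2[OF indep_vars_subset[OF indep]]) (use ij in auto)
      have i1: "k \<in> {i, j} \<Longrightarrow> integrable M (\<lambda>w. f (X k w))" for k
        using ij expectation_X(1)[OF _ f1] by auto
      from indep_vars_lebesgue_integral[OF _ ind i1] indep_vars_integrable[OF _ ind i1]
      show ?thesis
        using False ij expectation_X(2)[OF _ f1] by (simp add: m_eq[unfolded real_scaleR_def] power2_eq_square)
    qed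
    then show "integrable M (\<lambda>w. f (X i w) * f (X j w))"
      and "(\<integral>w. f (X i w) * f (X j w) \<partial>M) \<le> (if i = j then (1 + C) * V else 0) + m\<^sup>2" by auto
  qed
  have sq: "(normsum n f (\<lambda>k. X k w))\<^sup>2 = (\<Sum>i=1..n. \<Sum>j=1..n. f (X i w) * f (X j w)) / real n" for w
    by (simp add: normsum_def power_divide power2_eq_square sum_product)
  show "integrable M (\<lambda>w. (normsum n f (\<lambda>k. X k w))\<^sup>2)"
    unfolding sq by (intro integrable_divide Bochner_Integration.integrable_sum int) auto
  have "(\<integral>w. (normsum n f (\<lambda>k. X k w))\<^sup>2 \<partial>M) = (\<Sum>i=1..n. \<Sum>j=1..n. \<integral>w. f (X i w) * f (X j w) \<partial>M) / real n"
  proof -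
    have "(\<integral>w. (\<Sum>i=1..n. \<Sum>j=1..n. f (X i w) * f (X j w)) \<partial>M) = (\<Sum>i=1..n. \<integral>w. (\<Sum>j=1..n. f (X i w) * f (X j w)) \<partial>M)"
      by (intro Bochner_Integration.integral_sum Bochner_Integration.integrable_sum int)
    also have "\<dots> = (\<Sum>i=1..n. \<Sum>j=1..n. \<integral>w. f (X i w) * f (X j w) \<partial>M)"
      by (intro sum.cong refl Bochner_Integration.integral_sum int)
    finally show ?thesis
      unfolding sq integral_divide_zero by (rule arg_cong[where f = "\<lambda>z. z / real n"])
  qed
  also have "\<dots> \<le> (\<Sum>i=1..n. \<Sum>j=1..n. (if i = j then (1 + C) * V else 0) + m\<^sup>2) / real n"
    by (intro divide_right_mono sum_mono E) auto
  also have "\<dots> = (1 + C) * V + real n * m\<^sup>2"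
    using n_ge by (simp add: sum.distrib add_divide_distrib)
  also have "real n * m\<^sup>2 = (\<integral>x. c x * f x \<partial>gauss)\<^sup>2"
    using n_ge by (simp add: m_def power_divide)
  also have "\<dots> \<le> (\<integral>x. (c x * f x)\<^sup>2 \<partial>gauss)"
  proof (rule gauss.expectation_square_ge)
    show "integrable gauss (\<lambda>x. (c x * f x)\<^sup>2)"
      by (rule Bochner_Integration.integrable_bound[OF integrable_mult_right[OF f2, of "C\<^sup>2"]])
        (auto simp: power_mult_distrib intro!: mult_right_mono abs_le_square_iff[THEN iffD1] order_trans[OF c_bound])
  qed simp
  also have "\<dots> \<le> (\<integral>x. C\<^sup>2 * (f x)\<^sup>2 \<partial>gauss)"
  proof (rule integral_mono')
    show "integrable gauss (\<lambda>x. C\<^sup>2 * (f x)\<^sup>2)" using f2 by simp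
  qed (auto simp: power_mult_distrib intro!: mult_right_mono abs_le_square_iff[THEN iffD1] order_trans[OF c_bound])
  also have "\<dots> = C\<^sup>2 * V" by (simp add: V_def)
  finally show "(\<integral>w. (normsum n f (\<lambda>k. X k w))\<^sup>2 \<partial>M) \<le> (1 + C + C\<^sup>2) * (\<integral>x. (f x)\<^sup>2 \<partial>gauss)"
    by (simp add: V_def algebra_simps)
qed

lemma char_normsum:
  assumes [measurable]: "h \<in> borel_measurable borel"
  shows "(\<integral>w. iexp (normsum n h (\<lambda>k. X k w)) \<partial>M)
    = (\<integral>x. (1 + c x / sqrt (real n)) *\<^sub>R iexp (h x / sqrt (real n)) \<partial>gauss) ^ n"
proof -
  have i: "integrable gauss (\<lambda>x. iexp (h x / sqrt (real n)))"
    by (rule gauss.integrable_const_bound[of _ 1]) auto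
  have ind: "indep_vars (\<lambda>_. borel) (\<lambda>k w. iexp (h (X k w) / sqrt (real n))) {1..n}"
    by (rule indep_vars_compose2[OF indep]) auto
  have "(\<integral>w. iexp (normsum n h (\<lambda>k. X k w)) \<partial>M) = (\<integral>w. (\<Prod>k=1..n. iexp (h (X k w) / sqrt (real n))) \<partial>M)"
    by (simp add: normsum_def exp_sum sum_distrib_left sum_divide_distrib)
  also have "\<dots> = (\<Prod>k=1..n. \<integral>w. iexp (h (X k w) / sqrt (real n)) \<partial>M)"
    by (rule indep_vars_lebesgue_integral[OF _ ind]) (use expectation_X(1)[OF _ i] in auto)
  also have "\<dots> = (\<Prod>k=1..n. \<integral>x. (1 + c x / sqrt (real n)) *\<^sub>R iexp (h x / sqrt (real n)) \<partial>gauss)"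
    by (rule prod.cong) (use expectation_X(2)[OF _ i] in auto)
  finally show ?thesis by simp
qed

end

section \<open>Step functions in a weighted L2 space\<close>

lemma L2_spaceD:
  assumes "f \<in> L2_space M"
  shows "f \<in> borel_measurable M" "integrable M (\<lambda>x. (f x)\<^sup>2)"
  using assms by (auto simp: L2_space_def)

lemma L2_mult_integrable:
  assumes "f \<in> L2_space M" "g \<in> L2_space M"
  shows "integrable M (\<lambda>x. f x * g x)"
proof (rule Bochner_Integration.integrable_bound)
  show "integrable M (\<lambda>x. (f x)\<^sup>2 + (g x)\<^sup>2)"
    using assms by (auto simp: L2_space_def)
  show "AE x in M. norm (f x * g x) \<le> norm ((f x)\<^sup>2 + (g x)\<^sup>2)"
  proof (rule AE_I2)
    fix x
    have "2 * \<bar>f x\<bar> * \<bar>g x\<bar> \<le> \<bar>f x\<bar>\<^sup>2 + \<bar>g x\<bar>\<^sup>2" by (rule sum_squares_bound)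
    moreover have "0 \<le> \<bar>f x\<bar> * \<bar>g x\<bar>" by simp
    ultimately have "\<bar>f x\<bar> * \<bar>g x\<bar> \<le> (f x)\<^sup>2 + (g x)\<^sup>2" unfolding power2_abs by linarith
    then show "norm (f x * g x) \<le> norm ((f x)\<^sup>2 + (g x)\<^sup>2)"
      by (simp add: abs_mult)
  qed
qed (use assms in \<open>auto simp: L2_space_def\<close>)

lemma L2_add: "f \<in> L2_space M \<Longrightarrow> g \<in> L2_space M \<Longrightarrow> (\<lambda>x. f x + g x) \<in> L2_space M"
  using integrable_mult_right[OF L2_mult_integrable[of f M g], of 2]
  by (auto simp: L2_space_def power2_sum mult.assoc intro!: Bochner_Integration.integrable_add)

lemma L2_zero: "(\<lambda>x. 0) \<in> L2_space M"
  by (simp add: L2_space_def)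

lemma L2_cmult: "f \<in> L2_space M \<Longrightarrow> (\<lambda>x. a * f x) \<in> L2_space M"
  by (auto simp: L2_space_def power_mult_distrib)

lemma L2_diff: "f \<in> L2_space M \<Longrightarrow> g \<in> L2_space M \<Longrightarrow> (\<lambda>x. f x - g x) \<in> L2_space M"
  using L2_add[OF _ L2_cmult[of g M "-1"], of f] by simp

lemma L2_sum: "(\<And>i. i \<in> I \<Longrightarrow> f i \<in> L2_space M) \<Longrightarrow> (\<lambda>x. \<Sum>i\<in>I. f i x) \<in> L2_space M"
  by (induction I rule: infinite_finite_induct) (auto intro: L2_add L2_zero)

lemma (in finite_measure) L2_bounded:
  assumes [measurable]: "f \<in> borel_measurable M" and "\<And>x. \<bar>f x\<bar> \<le> B"
  shows "f \<in> L2_space M"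
proof -
  have "(f x)\<^sup>2 \<le> B\<^sup>2" for x
    using assms(2)[of x] by (intro abs_le_square_iff[THEN iffD1]) auto
  then have "integrable M (\<lambda>x. (f x)\<^sup>2)"
    by (intro integrable_const_bound[of _ "B\<^sup>2"]) auto
  then show ?thesis by (auto simp: L2_space_def)
qed

lemma L2_inner_add: "f \<in> L2_space M \<Longrightarrow> g \<in> L2_space M \<Longrightarrow> h \<in> L2_space M \<Longrightarrow>
    L2_inner M (\<lambda>x. f x + g x) h = L2_inner M f h + L2_inner M g h"
  unfolding L2_inner_def distrib_right
  by (intro Bochner_Integration.integral_add L2_mult_integrable)

lemma L2_inner_Cauchy_Schwarz:
  assumes "f \<in> L2_space M" "g \<in> L2_space M"
  shows "\<bar>L2_inner M f g\<bar> \<le> L2_nrm M f * L2_nrm M g"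
proof -
  define a b c where "a = (\<integral>x. (f x)\<^sup>2 \<partial>M)" "b = L2_inner M f g" "c = (\<integral>x. (g x)\<^sup>2 \<partial>M)"
  have "0 \<le> a" "0 \<le> c" by (auto simp: a_b_c_def)
  \<comment> \<open>Nonnegativity of the integral of \<open>(t * f x + g x)\<^sup>2\<close>, used
    below at the minimiser \<open>t = - b / a\<close>. For \<open>a = 0\<close> the polynomial is
    affine in \<open>t\<close>, and the \<open>t\<close> chosen there gives the value -1 unless
    \<open>b = 0\<close>.\<close>
  have "0 \<le> t\<^sup>2 * a + 2 * t * b + c" for t
  proof -
    have "0 \<le> (\<integral>x. (t * f x + g x)\<^sup>2 \<partial>M)" by simp
    also have "\<dots> = (\<integral>x. t\<^sup>2 * (f x)\<^sup>2 + 2 * t * (f x * g x) + (g x)\<^sup>2 \<partial>M)"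
      by (simp add: power2_sum power_mult_distrib algebra_simps)
    also have "\<dots> = t\<^sup>2 * a + 2 * t * b + c"
      unfolding a_b_c_def L2_inner_def using L2_mult_integrable[OF assms] assms
      by (simp add: L2_space_def)
    finally show ?thesis .
  qed
  then have "b\<^sup>2 \<le> a * c"
  proof (cases "a = 0")
    case True
    have "b = 0"
    proof (rule ccontr)
      assume "b \<noteq> 0"
      then have "2 * (- (c + 1) / (2 * b)) * b = - (c + 1)" by simp
      then show False
        using \<open>\<And>t. 0 \<le> t\<^sup>2 * a + 2 * t * b + c\<close>[of "- (c + 1) / (2 * b)"]
        unfolding True by linarith
    qed
    then show ?thesis using True by simp
  next
    case False
    then show ?thesis
      using \<open>\<And>t. 0 \<le> t\<^sup>2 * a + 2 * t * b + c\<close>[of "- b / a"] \<open>0 \<le> a\<close>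
      by (simp add: field_simps power2_eq_square)
  qed
  then have "\<bar>b\<bar> \<le> sqrt (a * c)" by (simp add: real_le_rsqrt)
  then show ?thesis
    by (simp add: L2_nrm_def a_b_c_def real_sqrt_mult)
qed

text \<open>The functional is Lipschitz by Cauchy-Schwarz, so preimages of open sets are open for
  the seminorm and thus members of the generator of \<open>L2_borel\<close> itself.\<close>

lemma measurable_L2_inner:
  assumes g: "g \<in> L2_space M"
  shows "(\<lambda>f. L2_inner M f g) \<in> borel_measurable (L2_borel M)"
proof (rule borel_measurableI)
  fix S :: "real set" assume S: "open S"
  let ?G = "{U. U \<subseteq> L2_space M \<and> (\<forall>f\<in>U. \<exists>e>0. \<forall>g\<in>L2_space M. L2_nrm M (\<lambda>x. g x - f x) < e \<longrightarrow> g \<in> U)}"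
  have G: "?G \<subseteq> Pow (L2_space M)" by auto
  have space: "space (L2_borel M) = L2_space M"
    unfolding L2_borel_def using G by (rule space_measure_of)
  let ?U = "(\<lambda>f. L2_inner M f g) -` S \<inter> L2_space M"
  have "?U \<in> ?G"
  proof (intro CollectI conjI ballI)
    fix f assume f: "f \<in> ?U"
    obtain d where d: "d > 0" "\<And>y. \<bar>y - L2_inner M f g\<bar> < d \<Longrightarrow> y \<in> S"
      using S f unfolding open_dist dist_real_def by blast
    \<comment> \<open>The added 1 covers the case \<open>L2_nrm M g = 0\<close>.\<close>
    define e where "e = d / (L2_nrm M g + 1)"
    have ng: "0 \<le> L2_nrm M g" by (simp add: L2_nrm_def)
    show "\<exists>e>0. \<forall>h\<in>L2_space M. L2_nrm M (\<lambda>x. h x - f x) < e \<longrightarrow> h \<in> ?U"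
    proof (intro exI conjI ballI impI)
      show "e > 0" using d(1) ng by (simp add: e_def)
      fix h assume h: "h \<in> L2_space M" "L2_nrm M (\<lambda>x. h x - f x) < e"
      have hf: "(\<lambda>x. h x - f x) \<in> L2_space M" using h f by (intro L2_diff) auto
      have "L2_inner M h g - L2_inner M f g = L2_inner M (\<lambda>x. h x - f x) g"
        using L2_inner_add[OF hf _ g, of f] f by simp
      then have "\<bar>L2_inner M h g - L2_inner M f g\<bar> \<le> L2_nrm M (\<lambda>x. h x - f x) * L2_nrm M g"
        using L2_inner_Cauchy_Schwarz[OF hf g] by simp
      also have "\<dots> \<le> e * L2_nrm M g" using h ng by (intro mult_right_mono) auto
      also have "\<dots> < d"
        using d(1) ng by (simp add: e_def field_simps)
      finally show "h \<in> ?U" using d(2) h by auto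
    qed
  qed auto
  then show "(\<lambda>f. L2_inner M f g) -` S \<inter> space (L2_borel M) \<in> sets (L2_borel M)"
    unfolding space unfolding L2_borel_def using G by (simp add: sets_measure_of)
qed

lemma space_L2_borel: "space (L2_borel M) = L2_space M"
  unfolding L2_borel_def by (rule space_measure_of) auto

text \<open>\<open>step_cells m\<close> indexes the cells of mesh \<open>1 / (m + 1)\<close> near the origin, and \<open>step_proj\<close> is
  the orthogonal projection onto the step functions they carry. A null cell contributes 0, by
  division by 0.\<close>

definition cell :: "nat \<Rightarrow> int \<Rightarrow> real set" where
  "cell m i = {x. \<lceil>x * (real m + 1)\<rceil> = i}"

definition step_cells :: "nat \<Rightarrow> int set" where
  "step_cells m = {- (int m + 1)\<^sup>2..(int m + 1)\<^sup>2}"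

definition step_proj :: "real measure \<Rightarrow> nat \<Rightarrow> (real \<Rightarrow> real) \<Rightarrow> real \<Rightarrow> real" where
  "step_proj \<mu> m f x = (\<Sum>i\<in>step_cells m.
     L2_inner \<mu> f (indicator (cell m i)) / measure \<mu> (cell m i) * indicator (cell m i) x)"

text \<open>The squared norm of \<open>step_proj \<mu> m f\<close>, see Pythagoras in
  \<open>dist_step_proj\<close>; in this form it is visibly a finite sum of squares of linear
  functionals of \<open>f\<close>.\<close>

definition step_norm2 :: "real measure \<Rightarrow> nat \<Rightarrow> (real \<Rightarrow> real) \<Rightarrow> real" where
  "step_norm2 \<mu> m f = (\<Sum>i\<in>step_cells m. (L2_inner \<mu> f (indicator (cell m i)))\<^sup>2 / measure \<mu> (cell m i))"

lemma finite_step_cells [simp]: "finite (step_cells m)"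
  by (simp add: step_cells_def)

lemma cell_measurable [measurable]: "cell m i \<in> sets borel"
  unfolding cell_def by measurable

lemma step_function_apply:
  "(\<Sum>i\<in>step_cells m. b i * indicator (cell m i) x)
    = (if \<lceil>x * (real m + 1)\<rceil> \<in> step_cells m then b \<lceil>x * (real m + 1)\<rceil> else (0::real))"
proof -
  have "(\<Sum>i\<in>step_cells m. b i * indicator (cell m i) x)
      = (\<Sum>i\<in>step_cells m. if \<lceil>x * (real m + 1)\<rceil> = i then b i else 0)"
    by (intro sum.cong) (auto simp: cell_def)
  then show ?thesis by simp
qed

text \<open>With \<open>(m + 1)\<^sup>2\<close> cells of width \<open>1 / (m + 1)\<close> on each
  side of 0, all points with absolute value at most \<open>m + 1\<close> are covered.\<close>

lemma eventually_step_cells: "\<forall>\<^sub>F m in sequentially. \<lceil>x * (real m + 1)\<rceil> \<in> step_cells m"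
proof -
  obtain k :: nat where k: "\<bar>x\<bar> \<le> real k" using real_arch_simple by blast
  show ?thesis
    using eventually_ge_at_top[of k]
  proof eventually_elim
    case (elim m)
    have "\<bar>x * (real m + 1)\<bar> \<le> (real m + 1) * (real m + 1)"
      unfolding abs_mult using k elim by (intro mult_mono) auto
    then have "\<bar>x * (real m + 1)\<bar> \<le> of_int ((int m + 1)\<^sup>2)"
      by (simp add: power2_eq_square)
    then show ?case
      unfolding step_cells_def by (auto simp: abs_le_iff ceiling_le_iff le_ceiling_iff)
  qed
qed

locale finite_borel_measure = finite_measure \<mu> for \<mu> :: "real measure" +
  assumes sets_eq [measurable_cong]: "sets \<mu> = sets borel"
begin

lemma indicator_L2: "A \<in> sets borel \<Longrightarrow> indicator A \<in> L2_space \<mu>"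
  by (rule L2_bounded[of _ 1]) (auto simp: indicator_def)

lemma step_function_L2: "(\<lambda>x. \<Sum>i\<in>step_cells m. b i * indicator (cell m i) x) \<in> L2_space \<mu>"
  by (intro L2_sum L2_cmult indicator_L2) simp

lemma step_proj_L2: "step_proj \<mu> m f \<in> L2_space \<mu>"
  unfolding step_proj_def[abs_def] by (rule step_function_L2)

text \<open>The cells are disjoint, so mixed terms vanish and the distance is a sum of one quadratic
  polynomial per coefficient; each \<open>b i\<close> can then be optimised on its own.\<close>

lemma dist_step_function:
  assumes f: "f \<in> L2_space \<mu>"
  shows "(\<integral>x. (f x - (\<Sum>i\<in>step_cells m. b i * indicator (cell m i) x))\<^sup>2 \<partial>\<mu>)
    = (\<integral>x. (f x)\<^sup>2 \<partial>\<mu>) + (\<Sum>i\<in>step_cells m. (b i)\<^sup>2 * measure \<mu> (cell m i) - 2 * b i * L2_inner \<mu> f (indicator (cell m i)))"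
proof -
  have pw: "(f x - (\<Sum>i\<in>step_cells m. b i * indicator (cell m i) x))\<^sup>2
      = (f x)\<^sup>2 + (\<Sum>i\<in>step_cells m. (b i)\<^sup>2 * indicator (cell m i) x - 2 * b i * (f x * indicator (cell m i) x))" for x
  proof -
    have "(\<Sum>i\<in>step_cells m. (b i)\<^sup>2 * indicator (cell m i) x - 2 * b i * (f x * indicator (cell m i) x))
        = (\<Sum>i\<in>step_cells m. ((b i)\<^sup>2 - 2 * b i * f x) * indicator (cell m i) x)"
      by (simp add: algebra_simps)
    then show ?thesis
      unfolding step_function_apply by (simp add: power2_diff)
  qed
  have ind: "integrable \<mu> (indicator (cell m i) :: real \<Rightarrow> real)" for i
    by (rule integrable_real_indicator) (auto simp: less_top[symmetric])
  have i: "integrable \<mu> (\<lambda>x. (b i)\<^sup>2 * indicator (cell m i) x - 2 * b i * (f x * indicator (cell m i) x))" for i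
    using L2_mult_integrable[OF f indicator_L2, of "cell m i"]
    by (intro Bochner_Integration.integrable_diff integrable_mult_right ind) auto
  have "(\<integral>x. (b i)\<^sup>2 * indicator (cell m i) x - 2 * b i * (f x * indicator (cell m i) x) \<partial>\<mu>)
      = (b i)\<^sup>2 * measure \<mu> (cell m i) - 2 * b i * L2_inner \<mu> f (indicator (cell m i))" for i
    using L2_mult_integrable[OF f indicator_L2, of "cell m i"]
    unfolding L2_inner_def using ind by (subst Bochner_Integration.integral_diff) auto
  then show ?thesis
    unfolding pw using L2_spaceD(2)[OF f] i
    by (subst Bochner_Integration.integral_add) (auto simp: Bochner_Integration.integral_sum)
qed

lemma inner_null_cell:
  assumes "measure \<mu> (cell m i) = 0"
  shows "L2_inner \<mu> f (indicator (cell m i)) = 0"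
proof -
  have "AE x in \<mu>. x \<notin> cell m i"
    using assms by (intro AE_not_in null_setsI) (auto simp: emeasure_eq_measure)
  then have "AE x in \<mu>. f x * indicator (cell m i) x = 0" by eventually_elim simp
  then show ?thesis unfolding L2_inner_def by (rule integral_eq_zero_AE)
qed

lemma dist_step_proj:
  assumes f: "f \<in> L2_space \<mu>"
  shows "(\<integral>x. (f x - step_proj \<mu> m f x)\<^sup>2 \<partial>\<mu>) = (\<integral>x. (f x)\<^sup>2 \<partial>\<mu>) - step_norm2 \<mu> m f"
proof -
  have "(F / a)\<^sup>2 * a - 2 * (F / a) * F = - (F\<^sup>2 / a)" for F a :: real
    by (cases "a = 0") (auto simp: field_simps power2_eq_square)
  then show ?thesis
    unfolding step_proj_def dist_step_function[OF f] step_norm2_def by (simp add: sum_negf)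
qed

text \<open>Completing the square cell by cell. On a null cell both sides are 0 by
  \<open>inner_null_cell\<close>, in agreement with division by 0.\<close>

lemma step_proj_best:
  assumes f: "f \<in> L2_space \<mu>"
  shows "(\<integral>x. (f x - step_proj \<mu> m f x)\<^sup>2 \<partial>\<mu>)
    \<le> (\<integral>x. (f x - (\<Sum>i\<in>step_cells m. b i * indicator (cell m i) x))\<^sup>2 \<partial>\<mu>)"
proof -
  have "- ((L2_inner \<mu> f (indicator (cell m i)))\<^sup>2 / measure \<mu> (cell m i))
      \<le> (b i)\<^sup>2 * measure \<mu> (cell m i) - 2 * b i * L2_inner \<mu> f (indicator (cell m i))" for i
  proof (cases "measure \<mu> (cell m i) = 0")
    case True
    then show ?thesis by (simp add: inner_null_cell)
  next
    case False
    define a F where "a = measure \<mu> (cell m i)" "F = L2_inner \<mu> f (indicator (cell m i))"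
    have a: "a > 0" using False by (simp add: a_F_def zero_less_measure_iff)
    have "0 \<le> (b i * a - F)\<^sup>2 / a" using a by simp
    also have "\<dots> = (b i)\<^sup>2 * a - 2 * b i * F + F\<^sup>2 / a"
      using a by (simp add: field_simps power2_eq_square)
    finally show ?thesis by (simp add: a_F_def)
  qed
  then show ?thesis
    unfolding dist_step_proj[OF f] dist_step_function[OF f] step_norm2_def
    by (simp add: sum_negf[symmetric] sum_mono del: sum_negf)
qed

text \<open>The meshes \<open>1 / (m + 1)\<close> are not nested and the errors need not decrease in
  \<open>m\<close>; density of the step functions is therefore expressed as convergence along the
  whole sequence.\<close>

definition step_approximable :: "(real \<Rightarrow> real) \<Rightarrow> bool" where
  "step_approximable f \<longleftrightarrow> (\<lambda>m. \<integral>x. (f x - step_proj \<mu> m f x)\<^sup>2 \<partial>\<mu>) \<longlonglongrightarrow> 0"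

lemma step_approximableI:
  assumes f: "f \<in> L2_space \<mu>"
    and lim: "(\<lambda>m. \<integral>x. (f x - (\<Sum>i\<in>step_cells m. b m i * indicator (cell m i) x))\<^sup>2 \<partial>\<mu>) \<longlonglongrightarrow> 0"
  shows "step_approximable f"
  unfolding step_approximable_def
  by (rule tendsto_sandwich[OF always_eventually always_eventually tendsto_const lim])
    (simp, intro allI step_proj_best[OF f])

lemma L2_dist_add:
  assumes "f \<in> L2_space \<mu>" "g \<in> L2_space \<mu>"
  shows "(\<integral>x. (f x + g x)\<^sup>2 \<partial>\<mu>) \<le> 2 * (\<integral>x. (f x)\<^sup>2 \<partial>\<mu>) + 2 * (\<integral>x. (g x)\<^sup>2 \<partial>\<mu>)"
proof -
  have "(\<integral>x. (f x + g x)\<^sup>2 \<partial>\<mu>) \<le> (\<integral>x. 2 * (f x)\<^sup>2 + 2 * (g x)\<^sup>2 \<partial>\<mu>)"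
  proof (rule integral_mono)
    show "integrable \<mu> (\<lambda>x. (f x + g x)\<^sup>2)"
      using L2_add[OF assms] by (rule L2_spaceD(2))
    show "integrable \<mu> (\<lambda>x. 2 * (f x)\<^sup>2 + 2 * (g x)\<^sup>2)"
      using assms by (auto simp: L2_space_def)
    show "(f x + g x)\<^sup>2 \<le> 2 * (f x)\<^sup>2 + 2 * (g x)\<^sup>2" for x
      using sum_squares_bound[of "f x" "g x"] by (simp add: power2_sum)
  qed
  also have "\<dots> = 2 * (\<integral>x. (f x)\<^sup>2 \<partial>\<mu>) + 2 * (\<integral>x. (g x)\<^sup>2 \<partial>\<mu>)"
    using assms by (simp add: L2_space_def)
  finally show ?thesis .
qed

lemma step_approximable_closed:
  assumes f: "f \<in> L2_space \<mu>"
    and approx: "\<And>e. 0 < e \<Longrightarrow> \<exists>g\<in>L2_space \<mu>. step_approximable g \<and> (\<integral>x. (f x - g x)\<^sup>2 \<partial>\<mu>) < e"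
  shows "step_approximable f"
  unfolding step_approximable_def
proof (rule LIMSEQ_I)
  fix r :: real assume "0 < r"
  \<comment> \<open>Two errors below \<open>r / 4\<close>, each doubled by
    \<open>L2_dist_add\<close>.\<close>
  then obtain g where g: "g \<in> L2_space \<mu>" "step_approximable g" "(\<integral>x. (f x - g x)\<^sup>2 \<partial>\<mu>) < r / 4"
    using approx[of "r / 4"] by auto
  obtain m0 where m0: "\<And>m. m \<ge> m0 \<Longrightarrow> (\<integral>x. (g x - step_proj \<mu> m g x)\<^sup>2 \<partial>\<mu>) < r / 4"
    using LIMSEQ_D[OF g(2)[unfolded step_approximable_def], of "r / 4"] \<open>0 < r\<close> by auto
  have "norm ((\<integral>x. (f x - step_proj \<mu> m f x)\<^sup>2 \<partial>\<mu>) - 0) < r" if "m \<ge> m0" for m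
  proof -
    have "(\<integral>x. (f x - step_proj \<mu> m f x)\<^sup>2 \<partial>\<mu>) \<le> (\<integral>x. (f x - step_proj \<mu> m g x)\<^sup>2 \<partial>\<mu>)"
      unfolding step_proj_def[of _ _ g] by (rule step_proj_best[OF f])
    also have "\<dots> = (\<integral>x. ((f x - g x) + (g x - step_proj \<mu> m g x))\<^sup>2 \<partial>\<mu>)"
      by simp
    also have "\<dots> \<le> 2 * (\<integral>x. (f x - g x)\<^sup>2 \<partial>\<mu>) + 2 * (\<integral>x. (g x - step_proj \<mu> m g x)\<^sup>2 \<partial>\<mu>)"
      by (intro L2_dist_add L2_diff f g step_proj_L2)
    also have "\<dots> < r" using g(3) m0[OF that] by linarith
    finally show ?thesis by simp
  qed
  then show "\<exists>m0. \<forall>m\<ge>m0. norm ((\<integral>x. (f x - step_proj \<mu> m f x)\<^sup>2 \<partial>\<mu>) - 0) < r" by blast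
qed

lemma step_approximable_limit:
  assumes f: "f \<in> L2_space \<mu>" and g: "\<And>k. g k \<in> L2_space \<mu>" "\<And>k. step_approximable (g k)"
    and w: "w \<in> L2_space \<mu>" "\<And>k x. \<bar>f x - g k x\<bar> \<le> \<bar>w x\<bar>"
    and lim: "\<And>x. (\<lambda>k. g k x) \<longlonglongrightarrow> f x"
  shows "step_approximable f"
proof (rule step_approximable_closed[OF f])
  fix e :: real assume e: "0 < e"
  have [measurable]: "f \<in> borel_measurable \<mu>" "g k \<in> borel_measurable \<mu>" for k
    using f g L2_spaceD by auto
  have "(\<lambda>k. \<integral>x. (f x - g k x)\<^sup>2 \<partial>\<mu>) \<longlonglongrightarrow> (\<integral>x. 0 \<partial>\<mu>)"
  proof (rule integral_dominated_convergence[where w = "\<lambda>x. (w x)\<^sup>2"])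
    have "(\<lambda>k. (f x - g k x)\<^sup>2) \<longlonglongrightarrow> (f x - f x)\<^sup>2" for x
      by (intro tendsto_intros lim)
    then show "AE x in \<mu>. (\<lambda>k. (f x - g k x)\<^sup>2) \<longlonglongrightarrow> 0" by simp
    show "AE x in \<mu>. norm ((f x - g k x)\<^sup>2) \<le> (w x)\<^sup>2" for k
      using w(2) by (auto simp: abs_le_square_iff)
  qed (use L2_spaceD(2)[OF w(1)] in auto)
  from LIMSEQ_D[OF this, of e] e obtain k where "(\<integral>x. (f x - g k x)\<^sup>2 \<partial>\<mu>) < e" by auto
  then show "\<exists>g\<in>L2_space \<mu>. step_approximable g \<and> (\<integral>x. (f x - g x)\<^sup>2 \<partial>\<mu>) < e"
    using g by blast
qed

lemma step_approximable_add:
  assumes f: "f \<in> L2_space \<mu>" "step_approximable f" and g: "g \<in> L2_space \<mu>" "step_approximable g"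
  shows "step_approximable (\<lambda>x. f x + g x)"
proof -
  let ?b = "\<lambda>f m i. L2_inner \<mu> f (indicator (cell m i)) / measure \<mu> (cell m i)"
  have eq: "(\<Sum>i\<in>step_cells m. (?b f m i + ?b g m i) * indicator (cell m i) x) = step_proj \<mu> m f x + step_proj \<mu> m g x" for m x
    by (simp add: step_proj_def sum.distrib distrib_right)
  show ?thesis
  proof (rule step_approximableI[where b = "\<lambda>m i. ?b f m i + ?b g m i"], rule L2_add[OF f(1) g(1)])
    have le: "(\<integral>x. (f x + g x - (step_proj \<mu> m f x + step_proj \<mu> m g x))\<^sup>2 \<partial>\<mu>)
        \<le> 2 * (\<integral>x. (f x - step_proj \<mu> m f x)\<^sup>2 \<partial>\<mu>) + 2 * (\<integral>x. (g x - step_proj \<mu> m g x)\<^sup>2 \<partial>\<mu>)" for m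
      using L2_dist_add[OF L2_diff[OF f(1) step_proj_L2] L2_diff[OF g(1) step_proj_L2], of m f m g]
      by (simp add: algebra_simps)
    have lim: "(\<lambda>m. 2 * (\<integral>x. (f x - step_proj \<mu> m f x)\<^sup>2 \<partial>\<mu>) + 2 * (\<integral>x. (g x - step_proj \<mu> m g x)\<^sup>2 \<partial>\<mu>)) \<longlonglongrightarrow> 0"
      using tendsto_add[OF tendsto_mult_right_zero[OF f(2)[unfolded step_approximable_def], of 2]
          tendsto_mult_right_zero[OF g(2)[unfolded step_approximable_def], of 2]] by simp
    show "(\<lambda>m. \<integral>x. (f x + g x - (\<Sum>i\<in>step_cells m. (?b f m i + ?b g m i) * indicator (cell m i) x))\<^sup>2 \<partial>\<mu>) \<longlonglongrightarrow> 0"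
      unfolding eq by (rule tendsto_sandwich[OF _ _ tendsto_const lim]) (auto intro!: always_eventually le)
  qed
qed

lemma step_approximable_cmult:
  assumes f: "f \<in> L2_space \<mu>" "step_approximable f"
  shows "step_approximable (\<lambda>x. a * f x)"
proof -
  have "step_proj \<mu> m (\<lambda>x. a * f x) x = a * step_proj \<mu> m f x" for m x
    by (simp add: step_proj_def L2_inner_def mult.assoc sum_distrib_left)
  then have "(\<integral>x. (a * f x - step_proj \<mu> m (\<lambda>x. a * f x) x)\<^sup>2 \<partial>\<mu>) = a\<^sup>2 * (\<integral>x. (f x - step_proj \<mu> m f x)\<^sup>2 \<partial>\<mu>)" for m
    by (simp add: power_mult_distrib flip: right_diff_distrib)
  then show ?thesis
    using tendsto_mult_right_zero[OF f(2)[unfolded step_approximable_def], of "a\<^sup>2"]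
    by (simp add: step_approximable_def)
qed

lemma step_approximable_zero: "step_approximable (\<lambda>x. 0)"
  by (simp add: step_approximable_def step_proj_def L2_inner_def)

lemma step_approximable_sum:
  assumes "\<And>i. i \<in> I \<Longrightarrow> f i \<in> L2_space \<mu>" "\<And>i. i \<in> I \<Longrightarrow> step_approximable (f i)"
  shows "step_approximable (\<lambda>x. \<Sum>i\<in>I. f i x)"
  using assms
  by (induction I rule: infinite_finite_induct) (auto intro!: step_approximable_add L2_sum step_approximable_zero)

text \<open>Keep all cells up to the one that contains \<open>a\<close>. At a fixed
  \<open>x > a\<close> this is wrong only while \<open>x\<close> shares the cell of
  \<open>a\<close>, that is, not once the mesh is smaller than \<open>x - a\<close>; dominated
  convergence does the rest.\<close>

lemma step_approximable_atMost: "step_approximable (indicator {..a})"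
proof (rule step_approximableI[where b = "\<lambda>m i. if i \<le> \<lceil>a * (real m + 1)\<rceil> then 1 else 0"])
  let ?g = "\<lambda>m x. \<Sum>i\<in>step_cells m. (if i \<le> \<lceil>a * (real m + 1)\<rceil> then 1 else 0) * indicator (cell m i) x :: real"
  have "(\<lambda>m. \<integral>x. (indicator {..a} x - ?g m x)\<^sup>2 \<partial>\<mu>) \<longlonglongrightarrow> (\<integral>x. 0 \<partial>\<mu>)"
  proof (rule integral_dominated_convergence[where w = "\<lambda>x. 1"])
    show "AE x in \<mu>. (\<lambda>m. (indicator {..a} x - ?g m x)\<^sup>2) \<longlonglongrightarrow> 0"
    proof (rule AE_I2, rule tendsto_eventually)
      fix x
      show "\<forall>\<^sub>F m in sequentially. (indicator {..a} x - ?g m x)\<^sup>2 = 0"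
      proof (cases "x \<le> a")
        case True
        show ?thesis
          using eventually_step_cells[of x]
        proof eventually_elim
          case (elim m)
          then show ?case
            using True unfolding step_function_apply by (auto intro!: ceiling_mono mult_right_mono)
        qed
      next
        case False
        obtain k :: nat where k: "1 / (x - a) < real k" using reals_Archimedean2 by blast
        show ?thesis
          using eventually_ge_at_top[of k]
        proof eventually_elim
          case (elim m)
          have "1 < real k * (x - a)" using k False by (simp add: field_simps)
          also have "\<dots> \<le> (real m + 1) * (x - a)" using elim False by (intro mult_right_mono) auto
          finally have "a * (real m + 1) + 1 < x * (real m + 1)" by (simp add: algebra_simps)
          then have "\<lceil>a * (real m + 1)\<rceil> < \<lceil>x * (real m + 1)\<rceil>" by linarith
          then show ?case using False unfolding step_function_apply by simp
        qed
      qed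
    qed
    show "AE x in \<mu>. norm ((indicator {..a} x - ?g m x)\<^sup>2) \<le> 1" for m
      unfolding step_function_apply by (auto simp: indicator_def)
    show "(\<lambda>x. (indicator {..a} x - ?g m x)\<^sup>2) \<in> borel_measurable \<mu>" for m
      by measurable
  qed simp_all
  then show "(\<lambda>m. \<integral>x. (indicator {..a} x - ?g m x)\<^sup>2 \<partial>\<mu>) \<longlonglongrightarrow> 0" by simp
qed (simp add: indicator_L2)

text \<open>Half-lines form an intersection-stable generator of the Borel sets, so closure under
  complements and countable disjoint unions suffices.\<close>

lemma step_approximable_indicator:
  assumes "A \<in> sets borel"
  shows "step_approximable (indicator A)"
proof -
  \<comment> \<open>The constant 1 is not a half-line, yet the complement step needs it; it is the
    limit of the half-lines up to \<open>k\<close>.\<close>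
  have one: "step_approximable (\<lambda>x. 1)"
  proof (rule step_approximable_limit[where g = "\<lambda>k. indicator {..real k}" and w = "\<lambda>x. 1"])
    show "(\<lambda>k. indicator {..real k} x) \<longlonglongrightarrow> (1::real)" for x
    proof (rule tendsto_eventually)
      obtain k :: nat where k: "x \<le> real k" using real_arch_simple by blast
      show "\<forall>\<^sub>F k in sequentially. indicator {..real k} x = (1::real)"
        using eventually_ge_at_top[of k] by eventually_elim (use k in auto)
    qed
  qed (auto simp: indicator_L2 step_approximable_atMost indicator_def intro!: L2_bounded)
  have "Int_stable (range (\<lambda>a::real. {..a}))"
  proof (rule Int_stableI)
    fix A B assume "A \<in> range (\<lambda>a::real. {..a})" "B \<in> range (\<lambda>a::real. {..a})"
    then obtain a b where "A = {..a}" "B = {..b}" by auto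
    then have "A \<inter> B = {..min a b}" by auto
    then show "A \<inter> B \<in> range (\<lambda>a::real. {..a})" by blast
  qed
  moreover have "range (\<lambda>a::real. {..a}) \<subseteq> Pow UNIV" by simp
  moreover have "A \<in> sigma_sets UNIV (range (\<lambda>a::real. {..a}))"
    using assms by (simp add: borel_eq_atMost)
  ultimately show ?thesis
  proof (induction rule: sigma_sets_induct_disjoint)
    case (basic A)
    then show ?case using step_approximable_atMost by auto
  next
    case empty
    then show ?case using step_approximable_zero by (simp add: indicator_def)
  next
    case (compl A)
    then have A: "A \<in> sets borel" by (simp add: borel_eq_atMost)
    have "step_approximable (\<lambda>x. 1 + (-1) * indicator A x)"
      using compl A one by (intro step_approximable_add step_approximable_cmult L2_cmult indicator_L2)
        (auto intro!: L2_bounded)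
    moreover have "(\<lambda>x. 1 + (-1) * indicator A x) = (indicator (UNIV - A) :: real \<Rightarrow> real)"
      by (auto simp: indicator_def)
    ultimately show ?case by simp
  next
    case (union A)
    then have A: "A i \<in> sets borel" for i by (auto simp: borel_eq_atMost)
    have eq: "(\<Sum>i<k. indicator (A i) x) = (indicator (\<Union>i<k. A i) x :: real)" for k x
      using union(1) by (subst indicator_UN_disjoint) (auto intro: disjoint_family_on_mono)
    show ?case
    proof (rule step_approximable_limit[where g = "\<lambda>k x. \<Sum>i<k. indicator (A i) x" and w = "\<lambda>x. 1"])
      show "(\<lambda>k. \<Sum>i<k. indicator (A i) x) \<longlonglongrightarrow> (indicator (\<Union>i. A i) x :: real)" for x
        unfolding eq by (rule LIMSEQ_indicator_UN)
      show "\<bar>indicator (\<Union>i. A i) x - (\<Sum>i<k. indicator (A i) x)\<bar> \<le> \<bar>1::real\<bar>" for k x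
        unfolding eq by (auto simp: indicator_def)
    qed (use A union in \<open>auto intro!: indicator_L2 L2_sum L2_bounded step_approximable_sum\<close>)
  qed
qed

lemma step_approximable_L2:
  assumes f: "f \<in> L2_space \<mu>"
  shows "step_approximable f"
proof -
  have [measurable]: "f \<in> borel_measurable \<mu>" using L2_spaceD[OF f] by simp
  have sp: "space \<mu> = UNIV" using sets_eq_imp_space_eq[OF sets_eq] by simp
  obtain F where "\<forall>i. simple_function \<mu> (F i)" "\<forall>x\<in>space \<mu>. (\<lambda>i. F i x) \<longlonglongrightarrow> f x"
    "\<forall>i. \<forall>x\<in>space \<mu>. dist (F i x) 0 \<le> 2 * dist (f x) 0"
    using borel_measurable_implies_sequence_metric[OF \<open>f \<in> borel_measurable \<mu>\<close>, of 0]
    by (elim exE conjE) (rule that)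
  then have F: "\<And>i. simple_function \<mu> (F i)" "\<And>x. (\<lambda>i. F i x) \<longlonglongrightarrow> f x"
    "\<And>i x. dist (F i x) 0 \<le> 2 * dist (f x) 0"
    by (auto simp: sp)
  have F_eq: "F k = (\<lambda>x. \<Sum>y\<in>range (F k). y * indicator (F k -` {y}) x)" for k
  proof
    fix x
    have "(\<Sum>y\<in>range (F k). y * indicator (F k -` {y}) x) = (\<Sum>y\<in>range (F k). if F k x = y then y else 0)"
      by (intro sum.cong) auto
    then show "F k x = (\<Sum>y\<in>range (F k). y * indicator (F k -` {y}) x)"
      using F(1)[of k] by (simp add: simple_function_def sp)
  qed
  have meas: "F k -` {y} \<in> sets borel" for k y
    using simple_functionD(2)[OF F(1)[of k], of "{y}"] by (simp add: sp sets_eq)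
  show ?thesis
  \<comment> \<open>The factor 3 is 1 + 2: the simple functions satisfy
    \<open>\<bar>F k x\<bar> \<le> 2 * \<bar>f x\<bar>\<close>.\<close>
  proof (rule step_approximable_limit[where g = F and w = "\<lambda>x. 3 * f x", OF f])
    show "F k \<in> L2_space \<mu>" for k
      by (subst F_eq) (intro L2_sum L2_cmult indicator_L2 meas)
    show "step_approximable (F k)" for k
      by (subst F_eq) (intro step_approximable_sum L2_cmult step_approximable_cmult indicator_L2
          step_approximable_indicator meas)
    show "\<bar>f x - F k x\<bar> \<le> \<bar>3 * f x\<bar>" for k x
      using F(3)[of k x] by simp
    show "(\<lambda>k. F k x) \<longlonglongrightarrow> f x" for x
      by (rule F(2))
  qed (rule L2_cmult[OF f])
qed

lemma step_norm2_tendsto: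
  assumes "f \<in> L2_space \<mu>"
  shows "(\<lambda>m. step_norm2 \<mu> m f) \<longlonglongrightarrow> (\<integral>x. (f x)\<^sup>2 \<partial>\<mu>)"
proof -
  have "(\<lambda>m. (\<integral>x. (f x)\<^sup>2 \<partial>\<mu>) - (\<integral>x. (f x - step_proj \<mu> m f x)\<^sup>2 \<partial>\<mu>)) \<longlonglongrightarrow> (\<integral>x. (f x)\<^sup>2 \<partial>\<mu>) - 0"
    using step_approximable_L2[OF assms] by (intro tendsto_diff tendsto_const) (simp add: step_approximable_def)
  then show ?thesis using dist_step_proj[OF assms] by simp
qed

end

section \<open>Gaussian moments and the covariance of the kernel function\<close>

lemma phi_le_1: "phi x \<le> 1"
proof -
  have "1 \<le> sqrt (2 * pi)" using pi_gt3 by simp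
  then have "1 / sqrt (2 * pi) * exp (- x\<^sup>2 / 2) \<le> 1 * 1"
    by (intro mult_mono) (auto simp: divide_le_eq)
  then show ?thesis by (simp add: std_normal_density_def)
qed

lemma DERIV_phi: "(phi has_real_derivative - x * phi x) (at x)"
  unfolding std_normal_density_def[abs_def]
  by (auto intro!: derivative_eq_intros simp: field_simps)

lemma continuous_phi [continuous_intros]: "continuous_on A f \<Longrightarrow> continuous_on A (\<lambda>x. phi (f x))"
  unfolding std_normal_density_def by (intro continuous_intros) auto

lemma gauss_integral: "f \<in> borel_measurable borel \<Longrightarrow> (\<integral>x. f x \<partial>gauss) = (\<integral>x. phi x * f x \<partial>lborel)"
  for f :: "real \<Rightarrow> real"
  by (subst integral_density) auto

lemma gauss_integrable: "f \<in> borel_measurable borel \<Longrightarrow> integrable gauss f \<longleftrightarrow> integrable lborel (\<lambda>x. phi x * f x)"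
  for f :: "real \<Rightarrow> real"
  by (subst integrable_density) auto

lemma gauss_power_integrable: "integrable gauss (\<lambda>x. x ^ k)"
  by (rule integrable_std_normal_distribution_moment)

lemma power_phi_at_bot: "((\<lambda>x. x ^ k * phi x) \<longlongrightarrow> 0) at_bot"
  unfolding filterlim_at_bot_mirror
proof (rule Lim_null_comparison)
  show "((\<lambda>x::real. x ^ k / exp x) \<longlongrightarrow> 0) at_top" by (rule tendsto_power_div_exp_0)
  show "\<forall>\<^sub>F x::real in at_top. norm ((- x) ^ k * phi (- x)) \<le> x ^ k / exp x"
    \<comment> \<open>From 2 on, \<open>x\<^sup>2 / 2\<close> is at least \<open>x\<close>, so the
      density falls below \<open>exp (- x)\<close>.\<close>
    using eventually_ge_at_top[of 2]
  proof eventually_elim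
    case (elim x)
    have s: "1 \<le> sqrt (2 * pi)" using pi_gt3 by simp
    have "x * 2 \<le> x * x" using elim by (intro mult_left_mono) auto
    then have "exp (- x\<^sup>2 / 2) \<le> exp (- x)" by (simp add: power2_eq_square)
    then have "1 / sqrt (2 * pi) * exp (- x\<^sup>2 / 2) \<le> 1 * exp (- x)"
      using s by (intro mult_mono) (auto simp: divide_le_eq)
    then have "phi (- x) \<le> 1 / exp x"
      by (simp add: std_normal_density_def exp_minus inverse_eq_divide)
    then have "x ^ k * phi (- x) \<le> x ^ k * (1 / exp x)"
      using elim by (intro mult_left_mono) auto
    then show ?case
      using elim by (simp add: abs_mult power_abs)
  qed
qed

definition gmoment :: "nat \<Rightarrow> real \<Rightarrow> real" where
  "gmoment k m = (\<integral>x. x ^ k * indicator {..m} x \<partial>gauss)"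

lemma gmoment_integrable: "integrable gauss (\<lambda>x. x ^ k * indicator {..m} x)"
  using integrable_mult_indicator[OF _ gauss_power_integrable[of k], of "{..m}"]
  by (simp add: mult.commute)

lemma gmoment_0: "gmoment 0 m = Phi m"
  by (simp add: gmoment_def Phi_def cdf_def)

text \<open>Integration by parts: \<open>f\<close> is the derivative of
  \<open>x ^ k * phi x\<close>, and the boundary term at minus infinity vanishes. For
  \<open>k = 0\<close> the truncated difference \<open>k - 1\<close> is multiplied by 0.\<close>

lemma gmoment_Suc: "gmoment (Suc k) m = real k * gmoment (k - 1) m - m ^ k * phi m"
proof -
  define f where "f x = real k * x ^ (k - 1) * phi x - x ^ Suc k * phi x" for x
  have D: "((\<lambda>x. x ^ k * phi x) has_real_derivative f x) (at x)" for x
    unfolding f_def by (auto intro!: derivative_eq_intros DERIV_phi simp: algebra_simps)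
  have i: "integrable lborel (\<lambda>x. phi x * (x ^ j * indicator {..m} x))" for j
    using gmoment_integrable[of j m] by (subst (asm) gauss_integrable) auto
  have if_: "integrable lborel (\<lambda>x. indicator {..m} x * f x)"
  proof -
    have "integrable lborel (\<lambda>x. real k * (phi x * (x ^ (k - 1) * indicator {..m} x)) - phi x * (x ^ Suc k * indicator {..m} x))"
      by (intro Bochner_Integration.integrable_diff integrable_mult_right i)
    then show ?thesis
      by (rule Bochner_Integration.integrable_cong[THEN iffD1, rotated 2]) (auto simp: f_def algebra_simps)
  qed
  \<comment> \<open>The interval integral is over the open half-line, so the endpoint
    \<open>m\<close> has to be discarded as a null set.\<close>
  have AEm: "AE x in lborel. x \<noteq> m" by (rule AE_lborel_singleton)
  have ae: "AE x in lborel. indicator {..m} x * f x = indicator (einterval (-\<infinity>) (ereal m)) x * f x"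
    using AEm by eventually_elim (auto simp: einterval_def indicator_def)
  have setint: "set_integrable lborel (einterval (-\<infinity>) (ereal m)) f"
    unfolding set_integrable_def real_scaleR_def
    using if_ by (rule integrable_cong_AE_imp) (use ae in \<open>auto simp: f_def intro: AE_symmetric\<close>)
  have cf: "isCont f x" for x
    unfolding f_def std_normal_density_def by (intro continuous_intros) auto
  have "(LBINT x=-\<infinity>..ereal m. f x) = m ^ k * phi m - 0"
  proof (rule interval_integral_FTC_integrable)
    show "((\<lambda>x. x ^ k * phi x) has_vector_derivative f x) (at x)" for x
      using D by (simp add: has_real_derivative_iff_has_vector_derivative)
    show "(((\<lambda>x. x ^ k * phi x) \<circ> real_of_ereal) \<longlongrightarrow> 0) (at_right (- \<infinity>))"
      using power_phi_at_bot[of k] by (simp add: ereal_tendsto_simps)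
    have "((\<lambda>x. x ^ k * phi x) \<longlongrightarrow> m ^ k * phi m) (at_left m)"
      using DERIV_isCont[OF D[of m]] unfolding isCont_def by (rule tendsto_mono[rotated]) (simp add: at_le)
    then show "(((\<lambda>x. x ^ k * phi x) \<circ> real_of_ereal) \<longlongrightarrow> m ^ k * phi m) (at_left (ereal m))"
      by (simp add: ereal_tendsto_simps1)
  qed (use setint cf in auto)
  also have "(LBINT x=-\<infinity>..ereal m. f x) = (\<integral>x. indicator (einterval (-\<infinity>) (ereal m)) x * f x \<partial>lborel)"
    by (simp add: interval_lebesgue_integral_def set_lebesgue_integral_def)
  also have "\<dots> = (\<integral>x. indicator {..m} x * f x \<partial>lborel)"
    by (rule integral_cong_AE[OF _ _ AE_symmetric[OF ae]]) (auto simp: f_def)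
  also have "\<dots> = (\<integral>x. real k * (phi x * (x ^ (k - 1) * indicator {..m} x)) - phi x * (x ^ Suc k * indicator {..m} x) \<partial>lborel)"
    by (intro Bochner_Integration.integral_cong) (auto simp: f_def algebra_simps)
  also have "\<dots> = real k * gmoment (k - 1) m - gmoment (Suc k) m"
  proof -
    have g: "gmoment j m = (\<integral>x. phi x * (x ^ j * indicator {..m} x) \<partial>lborel)" for j
      unfolding gmoment_def by (rule gauss_integral) simp
    show ?thesis
      unfolding g by (subst Bochner_Integration.integral_diff[OF integrable_mult_right[OF i] i])
        (simp only: integral_mult_right_zero)
  qed
  finally show ?thesis by simp
qed

lemma gmoment_simps:
  "gmoment (Suc 0) m = - phi m"
  "gmoment 2 m = Phi m - m * phi m"
  "gmoment 3 m = - (m\<^sup>2 + 2) * phi m"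
  "gmoment 4 m = 3 * Phi m - (m ^ 3 + 3 * m) * phi m"
proof -
  show 1: "gmoment (Suc 0) m = - phi m" using gmoment_Suc[of 0 m] by simp
  show 2: "gmoment 2 m = Phi m - m * phi m"
    using gmoment_Suc[of 1 m] by (simp add: gmoment_0 numeral_2_eq_2)
  show "gmoment 3 m = - (m\<^sup>2 + 2) * phi m"
    using gmoment_Suc[of 2 m] 1 by (simp add: eval_nat_numeral algebra_simps)
  have "gmoment 4 m = 3 * gmoment 2 m - m ^ 3 * phi m"
    using gmoment_Suc[of 3 m] by simp
  then show "gmoment 4 m = 3 * Phi m - (m ^ 3 + 3 * m) * phi m"
    using 2 by (simp add: algebra_simps)
qed

lemma gauss_moments:
  "(\<integral>x. x \<partial>gauss) = 0" "(\<integral>x. x\<^sup>2 \<partial>gauss) = 1" "(\<integral>x. x ^ 3 \<partial>gauss) = 0" "(\<integral>x. x ^ 4 \<partial>gauss) = 3"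
  using integral_std_normal_distribution_moment_odd[of 1] integral_std_normal_distribution_moment_odd[of 3]
    std_normal_distribution_even_moments(1)[of 1] std_normal_distribution_even_moments(1)[of 2]
  by (simp_all add: fact_numeral)

text \<open>\<open>eta x s\<close> is quadratic in \<open>x\<close> on either side of
  \<open>s\<close>. Products of two such functions are piecewise quartic, so that all their Gaussian
  integrals can be read off from five coefficients and the table
  \<open>gmoment_simps\<close>.\<close>

definition poly4 :: "real \<Rightarrow> real \<Rightarrow> real \<Rightarrow> real \<Rightarrow> real \<Rightarrow> real \<Rightarrow> real" where
  "poly4 a0 a1 a2 a3 a4 x = a0 + a1 * x + a2 * x\<^sup>2 + a3 * x ^ 3 + a4 * x ^ 4"

lemma poly4_measurable [measurable]: "poly4 a0 a1 a2 a3 a4 \<in> borel_measurable borel"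
  unfolding poly4_def[abs_def] by measurable

lemma poly4_integral:
  "integrable gauss (poly4 a0 a1 a2 a3 a4)"
  "(\<integral>x. poly4 a0 a1 a2 a3 a4 x \<partial>gauss) = a0 + a2 + 3 * a4"
proof -
  have i: "integrable gauss (\<lambda>x. x)" "integrable gauss (\<lambda>x. x ^ k)" for k
    using gauss_power_integrable[of 1] gauss_power_integrable[of k] by auto
  show "integrable gauss (poly4 a0 a1 a2 a3 a4)"
    unfolding poly4_def[abs_def] using i by simp
  show "(\<integral>x. poly4 a0 a1 a2 a3 a4 x \<partial>gauss) = a0 + a2 + 3 * a4"
    unfolding poly4_def using i gauss.prob_space by (simp add: gauss_moments)
qed

lemma poly4_halfline_integral:
  "integrable gauss (\<lambda>x. poly4 a0 a1 a2 a3 a4 x * indicator {..m} x)"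
  "(\<integral>x. poly4 a0 a1 a2 a3 a4 x * indicator {..m} x \<partial>gauss)
    = a0 * gmoment 0 m + a1 * gmoment (Suc 0) m + a2 * gmoment 2 m + a3 * gmoment 3 m + a4 * gmoment 4 m"
proof -
  have eq: "poly4 a0 a1 a2 a3 a4 x * indicator {..m} x = a0 * (x ^ 0 * indicator {..m} x) + a1 * (x ^ Suc 0 * indicator {..m} x)
      + a2 * (x ^ 2 * indicator {..m} x) + a3 * (x ^ 3 * indicator {..m} x) + a4 * (x ^ 4 * indicator {..m} x)" for x
    by (simp add: poly4_def algebra_simps)
  have i: "integrable gauss (\<lambda>x. a * (x ^ k * indicator {..m} x))" for a k
    by (intro integrable_mult_right gmoment_integrable)
  show "integrable gauss (\<lambda>x. poly4 a0 a1 a2 a3 a4 x * indicator {..m} x)"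
    unfolding eq by (intro Bochner_Integration.integrable_add i)
  show "(\<integral>x. poly4 a0 a1 a2 a3 a4 x * indicator {..m} x \<partial>gauss)
    = a0 * gmoment 0 m + a1 * gmoment (Suc 0) m + a2 * gmoment 2 m + a3 * gmoment 3 m + a4 * gmoment 4 m"
    unfolding eq gmoment_def
    by (intro has_bochner_integral_integral_eq has_bochner_integral_add has_bochner_integral_mult_right
        has_bochner_integral_integrable gmoment_integrable)
qed

lemma eta_poly:
  "eta x s = (x\<^sup>2 - s * x) * indicator {..s} x
    - ((1 / 2 * s * phi s) + (- 2 * phi s - s * Phi s) * x + (Phi s - 1 / 2 * s * phi s) * x\<^sup>2)"
  by (simp add: eta_def field_simps power2_eq_square)

lemma eta_covariance:
  "integrable gauss (\<lambda>x. eta x s * eta x t)"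
  "(\<integral>x. eta x s * eta x t \<partial>gauss) = kernel_K2 phi_powers s t"
proof -
  define p0 p1 p2 where "p0 s = 1 / 2 * s * phi s" and "p1 s = - 2 * phi s - s * Phi s" and "p2 s = Phi s - 1 / 2 * s * phi s" for s
  \<comment> \<open>Write \<open>eta x s\<close> as \<open>A * I - P\<close> with quadratic
    \<open>A\<close>, \<open>P\<close> and the indicator \<open>I\<close> of the half-line up to
    \<open>s\<close>. Then \<open>I1\<close> is the product of the two \<open>A\<close>,
    \<open>I2 s t\<close> is the \<open>A\<close> of \<open>s\<close> times the \<open>P\<close> of
    \<open>t\<close>, and \<open>I3\<close> is the product of the two \<open>P\<close>.\<close>
  define I1 where "I1 = poly4 0 0 (s * t) (- (s + t)) 1"
  define I2 where "I2 s t = poly4 0 (- s * p0 t) (p0 t - s * p1 t) (p1 t - s * p2 t) (p2 t)" for s t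
  define I3 where "I3 = poly4 (p0 s * p0 t) (p0 s * p1 t + p1 s * p0 t) (p0 s * p2 t + p1 s * p1 t + p2 s * p0 t)
    (p1 s * p2 t + p2 s * p1 t) (p2 s * p2 t)"
  have eta_p: "eta x s = (x\<^sup>2 - s * x) * indicator {..s} x - (p0 s + p1 s * x + p2 s * x\<^sup>2)" for x s
    unfolding eta_poly p0_def p1_def p2_def ..
  have prod: "(A * I - P) * (B * J - Q) = A * B * (I * J) - A * Q * I - B * P * J + P * Q" for A B I J P Q :: real
    by (simp add: algebra_simps)
  have eq: "eta x s * eta x t = I1 x * indicator {..min s t} x - I2 s t x * indicator {..s} x - I2 t s x * indicator {..t} x + I3 x" for x
  proof -
    have ind: "indicator {..s} x * indicator {..t} x = (indicator {..min s t} x :: real)"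
      by (auto simp: indicator_def)
    show ?thesis
      unfolding eta_p prod ind I1_def I2_def I3_def poly4_def
      by (simp add: algebra_simps power2_eq_square power3_eq_cube power4_eq_xxxx)
  qed
  have i: "integrable gauss (\<lambda>x. I1 x * indicator {..min s t} x)" "integrable gauss I3"
    "integrable gauss (\<lambda>x. I2 s t x * indicator {..m} x)" for s t m
    unfolding I1_def I2_def I3_def by (rule poly4_halfline_integral(1) poly4_integral(1))+
  show "integrable gauss (\<lambda>x. eta x s * eta x t)"
    unfolding eq by (intro Bochner_Integration.integrable_add Bochner_Integration.integrable_diff i)
  have "(\<integral>x. eta x s * eta x t \<partial>gauss) = (\<integral>x. I1 x * indicator {..min s t} x \<partial>gauss)
      - (\<integral>x. I2 s t x * indicator {..s} x \<partial>gauss) - (\<integral>x. I2 t s x * indicator {..t} x \<partial>gauss) + (\<integral>x. I3 x \<partial>gauss)"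
    unfolding eq by (simp add: i Bochner_Integration.integral_add Bochner_Integration.integral_diff)
  also have "\<dots> = kernel_K2 phi_powers s t"
    unfolding I1_def I2_def I3_def poly4_halfline_integral(2) poly4_integral(2) gmoment_0 gmoment_simps
      kernel_K2_def Psi1_def Psi2_def Psi3_def Psi4_def phi_powers_def p0_def p1_def p2_def
    by (simp add: field_simps power2_eq_square power3_eq_cube)
  finally show "(\<integral>x. eta x s * eta x t \<partial>gauss) = kernel_K2 phi_powers s t" .
qed

lemma eta_centred: "(\<integral>x. eta x s \<partial>gauss) = 0"
proof -
  have eq: "eta x s = poly4 0 (- s) 1 0 0 x * indicator {..s} x
      - poly4 (1 / 2 * s * phi s) (- 2 * phi s - s * Phi s) (Phi s - 1 / 2 * s * phi s) 0 0 x" for x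
    unfolding eta_poly by (simp add: poly4_def)
  show ?thesis
    unfolding eq by (subst Bochner_Integration.integral_diff[OF poly4_halfline_integral(1) poly4_integral(1)])
      (simp add: poly4_halfline_integral(2) poly4_integral(2) gmoment_simps)
qed

section \<open>Growth and measurability of the kernel function\<close>

lemma Phi_bounds: "0 \<le> Phi x" "Phi x \<le> 1"
  by (simp_all add: Phi_def gauss.cdf_nonneg gauss.cdf_bounded_prob)

lemma abs_le_one_plus_square: "\<bar>x\<bar> \<le> 1 + x\<^sup>2" for x :: real
  using sum_squares_bound[of "\<bar>x\<bar>" 1] abs_ge_zero[of x] unfolding power2_abs by simp

text \<open>A product of a function of \<open>x\<close> and a function of \<open>s\<close>, so that
  Fubini needs no joint estimate. Quadratic growth in \<open>x\<close> fits the Gaussian moments,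
  linear growth in \<open>s\<close> the moments of the weight; 4 is 1 + 2 + 1 from the three terms
  of \<open>eta\<close>.\<close>

lemma eta_bound: "\<bar>eta x s\<bar> \<le> 4 * (1 + x\<^sup>2) * (1 + \<bar>s\<bar>)"
proof -
  have x: "\<bar>x\<bar> \<le> 1 + x\<^sup>2" by (rule abs_le_one_plus_square)
  have xs: "\<bar>x * (x - s)\<bar> \<le> (1 + x\<^sup>2) * (1 + \<bar>s\<bar>)"
  proof -
    have "\<bar>x * (x - s)\<bar> \<le> x\<^sup>2 + \<bar>x\<bar> * \<bar>s\<bar>"
      using abs_triangle_ineq4[of "x * x" "x * s"] by (simp add: power2_eq_square algebra_simps abs_mult)
    also have "\<dots> \<le> (1 + x\<^sup>2) + (1 + x\<^sup>2) * \<bar>s\<bar>"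
      using x by (intro add_mono mult_right_mono) auto
    finally show ?thesis by (simp add: algebra_simps)
  qed
  have a: "\<bar>x * (x - s) * indicator {..s} x\<bar> \<le> (1 + x\<^sup>2) * (1 + \<bar>s\<bar>)"
    using xs by (auto simp: indicator_def)
  have q: "\<bar>1 / 2 * (1 - x\<^sup>2) * s - 2 * x\<bar> \<le> 2 * ((1 + x\<^sup>2) * (1 + \<bar>s\<bar>))"
  proof -
    have "\<bar>1 / 2 * (1 - x\<^sup>2) * s\<bar> \<le> (1 + x\<^sup>2) * \<bar>s\<bar>"
      unfolding abs_mult by (intro mult_right_mono) (auto simp: abs_le_iff)
    moreover have "\<bar>a - 2 * x\<bar> \<le> b + 2 * y" if "\<bar>a\<bar> \<le> b" "\<bar>x\<bar> \<le> y" for a b y :: real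
      using that by (simp add: abs_le_iff)
    ultimately have "\<bar>1 / 2 * (1 - x\<^sup>2) * s - 2 * x\<bar> \<le> (1 + x\<^sup>2) * \<bar>s\<bar> + 2 * (1 + x\<^sup>2)"
      using x by blast
    also have "\<dots> \<le> 2 * ((1 + x\<^sup>2) * (1 + \<bar>s\<bar>))"
      by (simp add: algebra_simps)
    finally show ?thesis .
  qed
  have b: "\<bar>phi s * (1 / 2 * (1 - x\<^sup>2) * s - 2 * x)\<bar> \<le> 1 * (2 * ((1 + x\<^sup>2) * (1 + \<bar>s\<bar>)))"
    unfolding abs_mult[of "phi s"] using q phi_le_1[of s] by (intro mult_mono) auto
  have c: "\<bar>Phi s * (x * (x - s))\<bar> \<le> 1 * ((1 + x\<^sup>2) * (1 + \<bar>s\<bar>))"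
    unfolding abs_mult[of "Phi s"] using xs Phi_bounds[of s] by (intro mult_mono) auto
  have "eta x s = x * (x - s) * indicator {..s} x - phi s * (1 / 2 * (1 - x\<^sup>2) * s - 2 * x) - Phi s * (x * (x - s))"
    by (simp add: eta_def algebra_simps power2_eq_square)
  then have "\<bar>eta x s\<bar> \<le> (1 + x\<^sup>2) * (1 + \<bar>s\<bar>) + 2 * ((1 + x\<^sup>2) * (1 + \<bar>s\<bar>)) + (1 + x\<^sup>2) * (1 + \<bar>s\<bar>)"
    using a b c by linarith
  then show ?thesis by (simp add: algebra_simps)
qed

lemma Phi_measurable [measurable]: "Phi \<in> borel_measurable borel"
  unfolding Phi_def
  by (intro borel_measurable_mono monoI gauss.cdf_nondecreasing)

lemma eta_measurable [measurable]: "(\<lambda>(x, s). eta x s) \<in> borel_measurable (borel \<Otimes>\<^sub>M borel)"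
proof -
  have "(\<lambda>(x, s). eta x s) = (\<lambda>z. fst z * (fst z - snd z) * (if fst z \<le> snd z then 1 else 0)
     - phi (snd z) * (1 / 2 * (1 - (fst z)\<^sup>2) * snd z - 2 * fst z) - Phi (snd z) * ((fst z)\<^sup>2 - fst z * snd z))"
    by (auto simp: eta_def fun_eq_iff)
  then show ?thesis by simp
qed

lemma DERIV_Phi: "(Phi has_real_derivative phi x) (at x)"
proof -
  \<comment> \<open>The base point \<open>x - 1\<close> keeps \<open>x\<close> in the interior of
    the interval of integration.\<close>
  have eq: "Phi y = Phi (x - 1) + integral {x - 1..y} phi" if "x - 1 < y" for y
  proof -
    have "Phi y - Phi (x - 1) = measure gauss {x - 1<..y}"
      unfolding Phi_def using that by (rule gauss.cdf_diff_eq)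
    also have "\<dots> = (\<integral>z. phi z * indicator {x - 1<..y} z \<partial>lborel)"
      using gauss_integral[of "indicator {x - 1<..y}"] by simp
    also have "\<dots> = (\<integral>z. indicator {x - 1..y} z *\<^sub>R phi z \<partial>lborel)"
    proof (rule integral_cong_AE)
      show "AE z in lborel. phi z * indicator {x - 1<..y} z = indicator {x - 1..y} z *\<^sub>R phi z"
        using AE_lborel_singleton[of "x - 1"] by eventually_elim (auto simp: indicator_def)
    qed auto
    also have "\<dots> = integral {x - 1..y} phi"
      by (rule set_borel_integral_eq_integral(2)[unfolded set_lebesgue_integral_def,
            OF borel_integrable_atLeastAtMost'[OF continuous_phi[OF continuous_on_id]]])
    finally show ?thesis by simp
  qed
  have "((\<lambda>y. integral {x - 1..y} phi) has_real_derivative phi x) (at x within {x - 1..x + 1})"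
    by (rule integral_has_real_derivative) (auto intro!: continuous_intros)
  then have "((\<lambda>y. Phi (x - 1) + integral {x - 1..y} phi) has_real_derivative phi x) (at x)"
    by (auto intro!: derivative_eq_intros simp: at_within_Icc_at)
  moreover have "\<forall>\<^sub>F y in nhds x. x - 1 < y"
    by (intro eventually_nhds_in_open[of "{x - 1<..}" x, simplified])
  then have "\<forall>\<^sub>F y in nhds x. Phi y = Phi (x - 1) + integral {x - 1..y} phi"
    by eventually_elim (rule eq)
  ultimately show ?thesis
    using DERIV_cong_ev[OF refl _ refl, of Phi "\<lambda>y. Phi (x - 1) + integral {x - 1..y} phi" x "phi x"] by simp
qed

lemma continuous_Phi [continuous_intros]: "continuous_on A f \<Longrightarrow> continuous_on A (\<lambda>x. Phi (f x))"
  using DERIV_continuous_on[of UNIV Phi phi] DERIV_Phi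
  by (intro continuous_on_compose2[of UNIV Phi A f]) auto

section \<open>Linearisation of the empirical process\<close>

text \<open>Centred summands met when \<open>Y (Y - s) 1{Y \<le> s}\<close> is expanded in the sample mean and scale;
  \<open>slope_part\<close> is minus the derivative of \<open>quad_part\<close> in the threshold.\<close>

definition quad_part :: "real \<Rightarrow> real \<Rightarrow> real" where
  "quad_part s x = x * (x - s) * indicator {..s} x - Phi s"

definition lin_part :: "real \<Rightarrow> real \<Rightarrow> real" where
  "lin_part s x = (x - s) * indicator {..s} x + phi s + s * Phi s"

definition slope_part :: "real \<Rightarrow> real \<Rightarrow> real" where
  "slope_part v x = x * indicator {..v} x + phi v"

text \<open>The \<open>V\<^sub>n\<close> of the overview; \<open>G2_eq_emp_process\<close> gives the
  link to \<open>G2\<close>.\<close>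

definition emp_process :: "nat \<Rightarrow> (nat \<Rightarrow> real) \<Rightarrow> real \<Rightarrow> real" where
  "emp_process n x t = sqrt (real n) * ((1 / real n) *
     (\<Sum>j=1..n. scaled_residual n x j * (scaled_residual n x j - t) * indicator {..t} (scaled_residual n x j))
     - Phi t)"

section \<open>First order expansions of the normal density and distribution function\<close>

lemma phi_lipschitz: "\<bar>phi u - phi s\<bar> \<le> \<bar>u - s\<bar>"
proof -
  have "\<bar>x * phi x\<bar> \<le> 1" for x
  proof -
    have "\<bar>x\<bar> * exp (- x\<^sup>2 / 2) \<le> 1"
    proof -
      have "\<bar>x\<bar> \<le> 1 + x\<^sup>2 / 2"
        using sum_squares_bound[of "\<bar>x\<bar>" 1] by (simp add: power2_eq_square)
      also have "\<dots> \<le> exp (x\<^sup>2 / 2)" by (rule exp_ge_add_one_self)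
      finally show ?thesis by (simp add: exp_minus field_simps)
    qed
    moreover have "1 \<le> sqrt (2 * pi)" using pi_gt3 by simp
    ultimately have "1 / sqrt (2 * pi) * (\<bar>x\<bar> * exp (- x\<^sup>2 / 2)) \<le> 1 * 1"
      by (intro mult_mono) (auto simp: divide_le_eq)
    then show ?thesis by (simp add: std_normal_density_def abs_mult)
  qed
  then have bd: "norm (- x * phi x) \<le> 1" for x by simp
  have "norm (phi u - phi s) \<le> 1 * norm (u - s)"
    by (rule field_differentiable_bound[of UNIV phi "\<lambda>x. - x * phi x", OF _ DERIV_phi bd]) simp_all
  then show ?thesis by simp
qed

text \<open>The mean value theorem replaces the increment by \<open>(u - s) * phi z\<close>, and the
  Lipschitz bound moves \<open>z\<close> to \<open>s\<close>.\<close>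

lemma Phi_taylor: "\<bar>Phi u - Phi s - (u - s) * phi s\<bar> \<le> (u - s)\<^sup>2"
proof (cases "u = s")
  case False
  obtain z where z: "min s u < z" "z < max s u" "Phi u - Phi s = (u - s) * phi z"
  proof (cases "s < u")
    case True
    from MVT2[OF True DERIV_Phi] that show ?thesis by auto
  next
    case False
    then have "u < s" using \<open>u \<noteq> s\<close> by simp
    from MVT2[OF this DERIV_Phi] obtain z where "u < z" "z < s" "Phi s - Phi u = (s - u) * phi z" by auto
    then show ?thesis using that[of z] by (simp add: algebra_simps)
  qed
  have "\<bar>Phi u - Phi s - (u - s) * phi s\<bar> = \<bar>u - s\<bar> * \<bar>phi z - phi s\<bar>"
    unfolding z(3) by (simp add: abs_mult flip: right_diff_distrib)
  also have "\<dots> \<le> \<bar>u - s\<bar> * \<bar>u - s\<bar>"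
    using z phi_lipschitz[of z s] by (intro mult_left_mono) auto
  finally show ?thesis by (simp add: power2_eq_square)
qed simp

lemma slope_part_measurable [measurable]: "(\<lambda>(x, v). slope_part v x) \<in> borel_measurable (borel \<Otimes>\<^sub>M borel)"
proof -
  have "(\<lambda>(x, v). slope_part v x) = (\<lambda>z. fst z * (if fst z \<le> snd z then 1 else 0) + phi (snd z))"
    by (auto simp: slope_part_def fun_eq_iff)
  then show ?thesis by simp
qed

text \<open>\<open>x * (x - s)\<close> vanishes exactly where its indicator jumps, so
  \<open>quad_part s x\<close> is continuous in \<open>s\<close> and the integral of its
  derivative.\<close>

lemma quad_part_diff:
  assumes "s \<le> u"
  shows "integrable lborel (\<lambda>v. indicator {s..u} v * slope_part v x)"
    and "quad_part u x - quad_part s x = - (\<integral>v. indicator {s..u} v * slope_part v x \<partial>lborel)"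
proof -
  have eq: "indicator {s..u} v * slope_part v x = x * indicator {max s x..u} v + indicator {s..u} v *\<^sub>R phi v" for v
    by (auto simp: slope_part_def indicator_def)
  have si: "set_integrable lborel {s..u} phi"
    by (rule borel_integrable_atLeastAtMost'[OF continuous_phi[OF continuous_on_id]])
  have i: "integrable lborel (\<lambda>v. x * indicator {max s x..u} v)"
    by (cases "max s x \<le> u") auto
  show "integrable lborel (\<lambda>v. indicator {s..u} v * slope_part v x)"
    unfolding eq using i si unfolding set_integrable_def by (rule Bochner_Integration.integrable_add)
  have "(\<integral>v. indicator {s..u} v *\<^sub>R phi v \<partial>lborel) = Phi u - Phi s"
  proof (rule integral_FTC_Icc[OF assms])
    show "(Phi has_vector_derivative phi x) (at x within {s..u})" for x
      using DERIV_subset[OF DERIV_Phi subset_UNIV]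
      by (simp add: has_real_derivative_iff_has_vector_derivative)
    show "continuous_on {s..u} phi" by (rule continuous_phi[OF continuous_on_id])
  qed
  then have "(\<integral>v. indicator {s..u} v * slope_part v x \<partial>lborel) = x * measure lborel {max s x..u} + (Phi u - Phi s)"
    unfolding eq using i si unfolding set_integrable_def by (subst Bochner_Integration.integral_add) auto
  also have "x * measure lborel {max s x..u} = x * (x - s) * indicator {..s} x - x * (x - u) * indicator {..u} x"
    using assms by (auto simp: indicator_def max_def algebra_simps)
  finally show "quad_part u x - quad_part s x = - (\<integral>v. indicator {s..u} v * slope_part v x \<partial>lborel)"
    by (simp add: quad_part_def)
qed

text \<open>A pathwise estimate, because it is going to be used with \<open>u\<close> computed from
  the sample. Cauchy-Schwarz separates the length of the window from the integral of the squared
  slope process; \<open>B\<close> undoes the weight \<open>1 / (1 + v\<^sup>2)\<close> on the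
  window. The squared increment is thus small in proportion to \<open>u - s\<close>.\<close>

lemma normsum_quad_part_diff_le:
  fixes x :: "nat \<Rightarrow> real"
  assumes su: "s \<le> u"
    and R: "(\<integral>\<^sup>+v. ennreal ((normsum n (slope_part v) x)\<^sup>2 / (1 + v\<^sup>2)) \<partial>lborel) \<le> ennreal K" and K: "0 \<le> K"
    and B: "\<And>v. s \<le> v \<Longrightarrow> v \<le> u \<Longrightarrow> 1 + v\<^sup>2 \<le> B"
  shows "(normsum n (quad_part u) x - normsum n (quad_part s) x)\<^sup>2 \<le> (u - s) * (B * K)"
proof -
  define d where "d v = normsum n (slope_part v) x" for v
  have [measurable]: "d \<in> borel_measurable borel"
    unfolding d_def normsum_def by measurable
  have pos: "0 < 1 + v\<^sup>2" for v :: real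
    using zero_le_power2[of v] by linarith
  have iR: "integrable lborel (\<lambda>v. (d v)\<^sup>2 / (1 + v\<^sup>2))"
  proof (rule integrableI_bounded)
    have "(\<integral>\<^sup>+v. ennreal (norm ((d v)\<^sup>2 / (1 + v\<^sup>2))) \<partial>lborel) \<le> ennreal K"
      using R pos unfolding d_def[symmetric] by (simp add: abs_of_nonneg less_imp_le)
    then show "(\<integral>\<^sup>+v. ennreal (norm ((d v)\<^sup>2 / (1 + v\<^sup>2))) \<partial>lborel) < \<infinity>"
      by (rule order_le_less_trans) simp
  qed simp
  have "ennreal (\<integral>v. (d v)\<^sup>2 / (1 + v\<^sup>2) \<partial>lborel) \<le> ennreal K"
    using R iR pos unfolding d_def[symmetric] by (subst nn_integral_eq_integral[symmetric]) (auto simp: less_imp_le)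
  then have R': "(\<integral>v. (d v)\<^sup>2 / (1 + v\<^sup>2) \<partial>lborel) \<le> K" using K by simp
  have B0: "0 \<le> B" using B[of s] su zero_le_power2[of s] by linarith
  have ptw: "(indicator {s..u} v * d v)\<^sup>2 \<le> B * ((d v)\<^sup>2 / (1 + v\<^sup>2))" for v
  proof (cases "v \<in> {s..u}")
    case True
    then have "(d v)\<^sup>2 * (1 + v\<^sup>2) \<le> (d v)\<^sup>2 * B" using B[of v] by (intro mult_left_mono) auto
    then show ?thesis using True pos[of v] by (simp add: field_simps)
  next
    case False
    then show ?thesis using B0 pos[of v] by simp
  qed
  have id2: "integrable lborel (\<lambda>v. (indicator {s..u} v * d v)\<^sup>2)"
    by (rule Bochner_Integration.integrable_bound[OF integrable_mult_right[OF iR, of B]])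
      (use ptw B0 pos in \<open>auto simp: abs_of_nonneg less_imp_le\<close>)
  have ind2: "(indicator {s..u} v :: real)\<^sup>2 = indicator {s..u} v" for v
    by (simp add: indicator_def)
  have L2: "(\<lambda>v. indicator {s..u} v * d v) \<in> L2_space lborel" "(indicator {s..u} :: real \<Rightarrow> real) \<in> L2_space lborel"
    using id2 su by (simp_all add: L2_space_def ind2)
  have n1: "L2_nrm lborel (indicator {s..u}) = sqrt (u - s)"
    using su by (simp add: L2_nrm_def ind2)
  have n2: "L2_nrm lborel (\<lambda>v. indicator {s..u} v * d v) \<le> sqrt (B * K)"
    unfolding L2_nrm_def
  proof (rule real_sqrt_le_mono)
    have "(\<integral>v. (indicator {s..u} v * d v)\<^sup>2 \<partial>lborel) \<le> (\<integral>v. B * ((d v)\<^sup>2 / (1 + v\<^sup>2)) \<partial>lborel)"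
      by (intro integral_mono id2 integrable_mult_right iR ptw)
    also have "\<dots> \<le> B * K" unfolding integral_mult_right_zero using R' B0 by (rule mult_left_mono)
    finally show "(\<integral>v. (indicator {s..u} v * d v)\<^sup>2 \<partial>lborel) \<le> B * K" .
  qed
  have "normsum n (quad_part u) x - normsum n (quad_part s) x = (\<Sum>j=1..n. quad_part u (x j) - quad_part s (x j)) / sqrt (real n)"
    by (simp add: normsum_def sum_subtractf diff_divide_distrib)
  also have "\<dots> = - ((\<Sum>j=1..n. \<integral>v. indicator {s..u} v * slope_part v (x j) \<partial>lborel) / sqrt (real n))"
    by (simp add: quad_part_diff[OF su] sum_negf)
  also have "(\<Sum>j=1..n. \<integral>v. indicator {s..u} v * slope_part v (x j) \<partial>lborel) / sqrt (real n)
      = (\<integral>v. (\<Sum>j=1..n. indicator {s..u} v * slope_part v (x j)) / sqrt (real n) \<partial>lborel)"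
    by (simp only: integral_divide_zero Bochner_Integration.integral_sum[OF quad_part_diff(1)[OF su]])
  \<comment> \<open>The indicator is its own square; one copy goes into each factor, so that the
    first has norm \<open>sqrt (u - s)\<close>.\<close>
  also have "\<dots> = L2_inner lborel (indicator {s..u}) (\<lambda>v. indicator {s..u} v * d v)"
    unfolding L2_inner_def d_def normsum_def
    by (intro Bochner_Integration.integral_cong refl) (auto simp: indicator_def)
  finally have "\<bar>normsum n (quad_part u) x - normsum n (quad_part s) x\<bar> \<le> sqrt (u - s) * L2_nrm lborel (\<lambda>v. indicator {s..u} v * d v)"
    using L2_inner_Cauchy_Schwarz[OF L2(2,1)] by (simp add: n1)
  also have "\<dots> \<le> sqrt (u - s) * sqrt (B * K)"
    using n2 su by (intro mult_left_mono) auto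
  finally have "\<bar>normsum n (quad_part u) x - normsum n (quad_part s) x\<bar>\<^sup>2 \<le> (sqrt ((u - s) * (B * K)))\<^sup>2"
    by (intro power_mono) (auto simp: real_sqrt_mult)
  then show ?thesis using su B0 K by simp
qed

text \<open>Here \<open>a\<close>, \<open>b\<close> are the normalised errors of the first two sample moments, \<open>\<sigma>\<close> is the sample
  standard deviation and \<open>N = \<surd>n\<close>.\<close>

lemma scale_expansion:
  fixes N K a b \<sigma> :: real
  assumes K: "1 \<le> K" and N: "4 * K\<^sup>2 \<le> N" and a: "\<bar>a\<bar> \<le> K" and b: "\<bar>b\<bar> \<le> K"
    and \<sigma>: "0 \<le> \<sigma>" "\<sigma>\<^sup>2 = 1 + (b - a\<^sup>2 / N) / N"
  shows "0 < \<sigma>" "\<bar>N * (\<sigma> - 1)\<bar> \<le> 2 * K\<^sup>2" "\<bar>N * (\<sigma> - 1) - b / 2\<bar> \<le> 3 * K ^ 4 / N"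
    "\<bar>1 / \<sigma>\<^sup>2 - 1\<bar> \<le> 4 * K\<^sup>2 / N" "\<bar>N * (1 / \<sigma>\<^sup>2 - 1) + b\<bar> \<le> 9 * K ^ 4 / N"
proof -
  \<comment> \<open>\<open>\<sigma>\<^sup>2 = 1 + \<tau> / N\<close>, and
    \<open>4 * K\<^sup>2 \<le> N\<close> gives \<open>\<bar>\<tau> / N\<bar> \<le> 1 / 2\<close>,
    which keeps \<open>\<sigma>\<close> away from 0.\<close>
  define \<tau> where "\<tau> = b - a\<^sup>2 / N"
  have K2: "1 \<le> K\<^sup>2" "K \<le> K\<^sup>2"
    using K self_le_power[OF K, of 2] by (simp_all only: one_le_power)
  have K4: "K\<^sup>2 \<le> K ^ 4" using K by (simp add: power_increasing)
  have N1: "1 \<le> N" using N K2 by linarith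
  have a2: "a\<^sup>2 \<le> K\<^sup>2" using a K by (simp add: abs_le_square_iff[symmetric])
  have aN: "0 \<le> a\<^sup>2 / N" "a\<^sup>2 / N \<le> K\<^sup>2"
    using a2 N1 K2 by (auto simp: divide_le_eq intro!: order_trans[OF a2] mult_le_cancel_left1[THEN iffD2])
  have aN2: "a\<^sup>2 / N \<le> K\<^sup>2 / N" using a2 N1 by (intro divide_right_mono) auto
  have \<tau>: "\<bar>\<tau>\<bar> \<le> 2 * K\<^sup>2" using b aN K2 unfolding \<tau>_def by linarith
  have \<tau>2: "\<tau>\<^sup>2 \<le> 4 * K ^ 4"
  proof -
    have "\<bar>\<tau>\<bar>\<^sup>2 \<le> (2 * K\<^sup>2)\<^sup>2" using \<tau> by (intro power_mono) auto
    then show ?thesis by (simp add: power_mult_distrib flip: power_mult)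
  qed
  have "\<bar>\<tau> / N\<bar> \<le> 1 / 2"
    using \<tau> N N1 by (simp add: abs_divide divide_le_eq)
  then have s2: "1 / 2 \<le> \<sigma>\<^sup>2" unfolding \<sigma>(2) \<tau>_def[symmetric] by linarith
  then show pos: "0 < \<sigma>" using \<sigma>(1) by (cases "\<sigma> = 0") auto
  have id: "N * (\<sigma> - 1) * (\<sigma> + 1) = \<tau>"
    using \<sigma>(2) N1 by (simp add: \<tau>_def power2_eq_square field_simps)
  then have id1: "N * (\<sigma> - 1) = \<tau> / (\<sigma> + 1)" using pos by (simp add: field_simps)
  have "\<bar>\<tau>\<bar> / (\<sigma> + 1) \<le> \<bar>\<tau>\<bar> / 1" using pos by (intro divide_left_mono) auto
  then show "\<bar>N * (\<sigma> - 1)\<bar> \<le> 2 * K\<^sup>2" unfolding id1 using \<tau> pos by (simp add: abs_divide)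
  \<comment> \<open>\<open>\<tau> / (\<sigma> + 1)\<close> differs from \<open>\<tau> / 2\<close> by
    a multiple of \<open>\<sigma> - 1\<close>, itself of order \<open>1 / N\<close>.\<close>
  have id2: "N * (\<sigma> - 1) - \<tau> / 2 = - (\<tau>\<^sup>2 / (2 * N * (\<sigma> + 1)\<^sup>2))"
  proof -
    have "N * (\<sigma> + 1) \<noteq> 0" using N1 pos by simp
    moreover have "(\<sigma> - 1) * (N * (\<sigma> + 1)) = \<tau>" using id by (simp only: mult_ac)
    ultimately have "\<sigma> - 1 = \<tau> / (N * (\<sigma> + 1))" by (simp only: eq_divide_eq) simp
    moreover have "N * (\<sigma> - 1) - \<tau> / 2 = - (\<tau> * (\<sigma> - 1) / (2 * (\<sigma> + 1)))"
      unfolding id1 using pos by (simp add: field_simps)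
    ultimately show ?thesis by (simp add: power2_eq_square)
  qed
  have "\<tau>\<^sup>2 / (2 * N * (\<sigma> + 1)\<^sup>2) \<le> \<tau>\<^sup>2 / (2 * N)"
    using N1 pos by (intro divide_left_mono) (auto simp: one_le_power)
  also have "\<dots> \<le> 4 * K ^ 4 / (2 * N)" using \<tau>2 N1 by (intro divide_right_mono) auto
  finally have "\<bar>N * (\<sigma> - 1) - \<tau> / 2\<bar> \<le> 2 * K ^ 4 / N"
    unfolding id2 using N1 pos by simp
  moreover have "\<bar>\<tau> / 2 - b / 2\<bar> \<le> K ^ 4 / N"
  proof -
    have eq: "\<tau> / 2 - b / 2 = - (a\<^sup>2 / N / 2)" by (simp add: \<tau>_def diff_divide_distrib)
    have "\<bar>\<tau> / 2 - b / 2\<bar> = a\<^sup>2 / N / 2"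
      unfolding eq abs_minus_cancel using aN(1) by (intro abs_of_nonneg) simp
    also have "\<dots> \<le> K\<^sup>2 / N"
    proof -
      have "y / 2 \<le> y" if "0 \<le> y" for y :: real using that by simp
      from order_trans[OF this[OF aN(1)] aN2] show ?thesis .
    qed
    also have "\<dots> \<le> K ^ 4 / N" using K4 N1 by (intro divide_right_mono) auto
    finally show ?thesis .
  qed
  ultimately show "\<bar>N * (\<sigma> - 1) - b / 2\<bar> \<le> 3 * K ^ 4 / N"
    by (simp add: abs_le_iff)
  have rho: "1 / \<sigma>\<^sup>2 - 1 = - (\<tau> / (N * \<sigma>\<^sup>2))"
  proof -
    have \<tau>': "\<tau> = N * \<sigma>\<^sup>2 - N" unfolding \<sigma>(2) \<tau>_def using N1 by (simp add: field_simps)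
    show ?thesis unfolding \<tau>' using pos N1 by (simp add: field_simps)
  qed
  have "\<bar>\<tau> / (N * \<sigma>\<^sup>2)\<bar> \<le> 2 * K\<^sup>2 / (N * (1 / 2))"
    unfolding abs_divide using \<tau> s2 N1 K2 by (intro frac_le) auto
  then show rho_le: "\<bar>1 / \<sigma>\<^sup>2 - 1\<bar> \<le> 4 * K\<^sup>2 / N" unfolding rho by simp
  \<comment> \<open>From \<open>N * (1 / \<sigma>\<^sup>2 - 1) = - \<tau> / \<sigma>\<^sup>2\<close>
    and \<open>b - \<tau> = a\<^sup>2 / N\<close>.\<close>
  have "N * (1 / \<sigma>\<^sup>2 - 1) + b = - \<tau> * (1 / \<sigma>\<^sup>2 - 1) + a\<^sup>2 / N"
  proof -
    have "N * (1 / \<sigma>\<^sup>2 - 1) = - \<tau> * (1 / \<sigma>\<^sup>2)" unfolding rho using N1 by simp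
    then show ?thesis by (simp add: \<tau>_def algebra_simps)
  qed
  also have "\<bar>\<dots>\<bar> \<le> \<bar>\<tau>\<bar> * \<bar>1 / \<sigma>\<^sup>2 - 1\<bar> + a\<^sup>2 / N"
    using aN by (intro order_trans[OF abs_triangle_ineq]) (simp add: abs_mult)
  also have "\<dots> \<le> (2 * K\<^sup>2) * (4 * K\<^sup>2 / N) + K\<^sup>2 / N"
    using \<tau> rho_le aN2 by (intro add_mono mult_mono) auto
  also have "\<dots> = (8 * K ^ 4 + K\<^sup>2) / N" by (simp add: add_divide_distrib power2_eq_square power4_eq_xxxx)
  also have "\<dots> \<le> 9 * K ^ 4 / N" using K4 N1 by (intro divide_right_mono) auto
  finally show "\<bar>N * (1 / \<sigma>\<^sup>2 - 1) + b\<bar> \<le> 9 * K ^ 4 / N" .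
qed


text \<open>The arithmetic core, freed from samples and sums. \<open>\<alpha>\<close> and
  \<open>\<alpha>'\<close> stand for the normalised sums of \<open>quad_part\<close> at
  \<open>s\<close> and at \<open>u\<close>, \<open>\<beta>\<close> for that of
  \<open>lin_part\<close>, \<open>Bs\<close> and \<open>Bu\<close> for the sample averages of
  \<open>(x - t) * indicator {..t} x\<close> at \<open>t = s\<close> and \<open>t = u\<close>,
  \<open>V\<close> for the empirical process and \<open>W\<close> for the sum of \<open>eta\<close>.
  The premise on \<open>\<alpha>' - \<alpha>\<close> is the window estimate.\<close>

lemma linearisation_bound:
  fixes N K a b \<sigma> s u e \<alpha> \<alpha>' \<beta> Bs Bu W V :: real
  assumes K: "1 \<le> K" and N: "4 * K\<^sup>2 \<le> N" and a: "\<bar>a\<bar> \<le> K" and b: "\<bar>b\<bar> \<le> K"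
    and \<sigma>: "0 \<le> \<sigma>" "\<sigma>\<^sup>2 = 1 + (b - a\<^sup>2 / N) / N"
    and u: "u = a / N + \<sigma> * s"
    and Bs: "Bs = - (phi s + s * Phi s) + \<beta> / N" and Bu: "\<bar>Bu - Bs\<bar> \<le> \<bar>u - s\<bar>"
    and V: "V = N * ((Phi u + \<alpha>' / N - a / N * Bu) / \<sigma>\<^sup>2 - Phi s)"
    and W: "W = \<alpha> + phi s * (1 / 2 * b * s + 2 * a) - Phi s * (b - a * s)"
    and \<Delta>: "(\<alpha>' - \<alpha>)\<^sup>2 \<le> \<bar>u - s\<bar> * ((1 + \<bar>s\<bar> + \<bar>u - s\<bar>)\<^sup>2 * K)"
  shows "(V - W)\<^sup>2 \<le> (6 * (67 * K ^ 6)\<^sup>2 + 144 * K ^ 7) / N * (\<alpha>\<^sup>2 + \<beta>\<^sup>2 + 8 * (1 + s ^ 4))"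
proof -
  define L where "L = 1 + \<bar>s\<bar>"
  \<comment> \<open>The three sources of error: \<open>\<rho>\<close> from the scale,
    \<open>e / N = u - s\<close> from the threshold, and \<open>r\<close> from the Taylor remainder
    of \<open>Phi\<close>, multiplied by \<open>N\<close>.\<close>
  define \<rho> where "\<rho> = 1 / \<sigma>\<^sup>2 - 1"
  define e where "e = N * (u - s)"
  define r where "r = N * (Phi u - Phi s) - e * phi s"
  define \<Delta>' where "\<Delta>' = \<alpha>' - \<alpha>"
  note S = scale_expansion[OF K N a b \<sigma>, folded \<rho>_def]
  have Kp: "K ^ i \<le> K ^ 6" if "i \<le> 6" for i using K that by (rule power_increasing[rotated])
  have Kp': "1 \<le> K ^ i" for i using K by (rule one_le_power)
  have K0: "0 \<le> K" using K by simp
  have N1: "1 \<le> N" using N Kp'[of 2] by linarith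
  have L1: "1 \<le> L" "\<bar>s\<bar> \<le> L" by (auto simp: L_def)
  have LL: "L \<le> L\<^sup>2" "1 \<le> L\<^sup>2" using L1(1) self_le_power[OF L1(1), of 2] by (simp_all only: one_le_power)
  have e_eq: "e = a + N * (\<sigma> - 1) * s"
    using N1 unfolding e_def u by (simp add: field_simps)
  have e_le: "\<bar>e\<bar> \<le> 2 * K\<^sup>2 * L"
  proof -
    have "\<bar>e\<bar> \<le> \<bar>a\<bar> + \<bar>N * (\<sigma> - 1)\<bar> * \<bar>s\<bar>"
      unfolding e_eq by (metis abs_mult abs_triangle_ineq)
    also have "\<dots> \<le> K\<^sup>2 * 1 + (2 * K\<^sup>2) * \<bar>s\<bar>"
      using a self_le_power[OF K, of 2] S(2) by (intro add_mono mult_right_mono) auto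
    also have "\<dots> \<le> 2 * K\<^sup>2 * L" by (simp add: L_def algebra_simps)
    finally show ?thesis .
  qed
  have us: "u - s = e / N" using N1 by (simp add: e_def)
  have us_le: "\<bar>u - s\<bar> \<le> 2 * K\<^sup>2 * L / N"
    unfolding us abs_divide using e_le N1 by (simp add: divide_right_mono)
  have us_le': "\<bar>u - s\<bar> \<le> 2 * K\<^sup>2 * L"
  proof -
    have "2 * K\<^sup>2 * L / N \<le> 2 * K\<^sup>2 * L / 1"
      using N1 L1 by (intro divide_left_mono) auto
    then show ?thesis using us_le by simp
  qed
  have r_le: "\<bar>r\<bar> \<le> 4 * K ^ 4 * L\<^sup>2 / N"
  proof -
    have "r = N * (Phi u - Phi s - (u - s) * phi s)"
      using N1 by (simp add: r_def e_def algebra_simps)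
    then have "\<bar>r\<bar> \<le> N * (u - s)\<^sup>2"
      using Phi_taylor[of u s] N1 by (simp add: abs_mult)
    also have "\<dots> = \<bar>e\<bar>\<^sup>2 / N" using N1 by (simp add: us power_divide power2_eq_square)
    also have "\<dots> \<le> (2 * K\<^sup>2 * L)\<^sup>2 / N"
      using e_le N1 by (intro divide_right_mono power_mono) auto
    also have "\<dots> = 4 * K ^ 4 * L\<^sup>2 / N" by (simp add: power_mult_distrib flip: power_mult)
    finally show ?thesis .
  qed
  have rho1: "\<bar>\<rho>\<bar> \<le> 1"
  proof -
    have "4 * K\<^sup>2 / N \<le> 1" using N N1 by simp
    then show ?thesis using S(4) by linarith
  qed
  \<comment> \<open>A common yardstick: every error term other than \<open>\<Delta>'\<close> is a
    constant times \<open>K ^ 6 * (G / N)\<close>.\<close>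
  define G where "G = \<bar>\<alpha>\<bar> + \<bar>\<beta>\<bar> + L\<^sup>2"
  have G: "\<bar>\<alpha>\<bar> \<le> G" "\<bar>\<beta>\<bar> \<le> G" "L \<le> G" "L\<^sup>2 \<le> G" "1 \<le> G" using LL by (auto simp: G_def)
  \<comment> \<open>An exact identity. To first order \<open>e\<close> is
    \<open>a + b * s / 2\<close>, \<open>N * \<rho>\<close> is \<open>- b\<close> and
    \<open>Bu\<close> is \<open>- (phi s + s * Phi s)\<close>; inserting these gives
    \<open>W\<close>, whose term \<open>2 * a\<close> comes once from the threshold and once from
    the mean subtracted in the summand.\<close>
  have expand: "V - W = \<rho> * (\<alpha> + e * phi s + r) + \<rho> * \<Delta>' + (N * \<rho> + b) * Phi s + (e - a - 1 / 2 * b * s) * phi s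
      + r + \<Delta>' - a * (\<rho> * Bu + (Bu - Bs) + \<beta> / N)"
  proof -
    have inv: "x / \<sigma>\<^sup>2 = (1 + \<rho>) * x" for x by (simp add: \<rho>_def)
    have Pu: "Phi u = Phi s + (e * phi s + r) / N" using N1 by (simp add: r_def field_simps)
    have "V = (1 + \<rho>) * (N * Phi s + e * phi s + r + \<alpha>' - a * Bu) - N * Phi s"
      unfolding V inv Pu using N1 by (simp add: field_simps)
    then show ?thesis
      unfolding W \<Delta>'_def Bs by (simp add: algebra_simps)
  qed
  have t1: "\<bar>\<rho> * (\<alpha> + e * phi s + r)\<bar> \<le> 28 * K ^ 6 * (G / N)"
  proof -
    have "\<bar>e * phi s\<bar> \<le> 2 * K\<^sup>2 * L"
      using e_le mult_mono[of "\<bar>e\<bar>" "2 * K\<^sup>2 * L" "phi s" 1] phi_le_1[of s] L1 by (simp add: abs_mult)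
    moreover have "4 * K ^ 4 * L\<^sup>2 / N \<le> 4 * K ^ 4 * L\<^sup>2 / 1"
      using N1 by (intro divide_left_mono) auto
    ultimately have "\<bar>\<alpha> + e * phi s + r\<bar> \<le> \<bar>\<alpha>\<bar> + 2 * K\<^sup>2 * L + 4 * K ^ 4 * L\<^sup>2"
      using r_le by linarith
    also have "\<dots> \<le> K ^ 4 * G + 2 * K ^ 4 * G + 4 * K ^ 4 * G"
    proof (intro add_mono)
      show "\<bar>\<alpha>\<bar> \<le> K ^ 4 * G" using mult_mono[OF Kp'[of 4] G(1)] G(5) by simp
      show "2 * K\<^sup>2 * L \<le> 2 * K ^ 4 * G" using K L1 G by (intro mult_mono power_increasing) auto
      show "4 * K ^ 4 * L\<^sup>2 \<le> 4 * K ^ 4 * G" using G by (intro mult_left_mono) auto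
    qed
    finally have "\<bar>\<alpha> + e * phi s + r\<bar> \<le> 7 * K ^ 4 * G" by (simp add: mult_ac)
    then have "\<bar>\<rho> * (\<alpha> + e * phi s + r)\<bar> \<le> (4 * K\<^sup>2 / N) * (7 * K ^ 4 * G)"
      unfolding abs_mult using S(4) N1 by (intro mult_mono) auto
    also have "\<dots> = 28 * K ^ 6 * (G / N)" by (simp add: eval_nat_numeral)
    finally show ?thesis .
  qed
  have t2: "\<bar>\<rho> * \<Delta>'\<bar> \<le> \<bar>\<Delta>'\<bar>"
    unfolding abs_mult using mult_right_mono[OF rho1, of "\<bar>\<Delta>'\<bar>"] by simp
  have t3: "\<bar>(N * \<rho> + b) * Phi s\<bar> \<le> 9 * K ^ 6 * (G / N)"
  proof -
    have "\<bar>(N * \<rho> + b) * Phi s\<bar> \<le> (9 * K ^ 4 / N) * 1"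
      unfolding abs_mult using S(5) Phi_bounds[of s] N1 by (intro mult_mono) auto
    also have "\<dots> \<le> (9 * K ^ 6 / N) * G"
      using Kp[of 4] G(5) N1 by (intro mult_mono divide_right_mono) auto
    finally show ?thesis by simp
  qed
  have t4: "\<bar>(e - a - 1 / 2 * b * s) * phi s\<bar> \<le> 3 * K ^ 6 * (G / N)"
  proof -
    have "(e - a - 1 / 2 * b * s) * phi s = (N * (\<sigma> - 1) - b / 2) * (s * phi s)"
      unfolding e_eq by (simp add: algebra_simps)
    also have "\<bar>\<dots>\<bar> \<le> (3 * K ^ 4 / N) * (L * 1)"
      unfolding abs_mult using S(3) L1 phi_le_1[of s] N1 by (intro mult_mono) auto
    also have "\<dots> \<le> (3 * K ^ 6 / N) * G"
      using Kp[of 4] G(3) L1 N1 by (intro mult_mono divide_right_mono) auto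
    finally show ?thesis by simp
  qed
  have t5: "\<bar>r\<bar> \<le> 4 * K ^ 6 * (G / N)"
  proof -
    have "4 * K ^ 4 * L\<^sup>2 / N \<le> 4 * K ^ 6 * G / N"
      using Kp[of 4] G(4) N1 by (intro divide_right_mono mult_mono) auto
    then show ?thesis using r_le by simp
  qed
  have us_G: "\<bar>u - s\<bar> \<le> 2 * K\<^sup>2 * (G / N)"
  proof -
    have "2 * K\<^sup>2 * L / N \<le> 2 * K\<^sup>2 * G / N" using G(3) N1 by (intro divide_right_mono mult_left_mono) auto
    then show ?thesis using us_le by simp
  qed
  have Bs_le: "\<bar>Bs\<bar> \<le> 2 * G + G"
  proof -
    have "\<bar>s * Phi s\<bar> \<le> L * 1" unfolding abs_mult using L1 Phi_bounds[of s] by (intro mult_mono) auto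
    moreover have "\<bar>\<beta> / N\<bar> \<le> \<bar>\<beta>\<bar> / 1" unfolding abs_divide using N1 by (intro divide_left_mono) auto
    moreover have "\<bar>phi s\<bar> \<le> 1" using phi_le_1[of s] by simp
    ultimately show ?thesis unfolding Bs using G by linarith
  qed
  have Bu_le: "\<bar>Bu\<bar> \<le> 5 * K\<^sup>2 * G"
  proof -
    have "2 * K\<^sup>2 * (G / N) \<le> 2 * K\<^sup>2 * (G / 1)"
      using N1 G by (intro mult_left_mono divide_left_mono) auto
    moreover have "G \<le> K\<^sup>2 * G" using mult_right_mono[OF Kp'[of 2], of G] G by simp
    ultimately show ?thesis using Bu us_G Bs_le by (simp add: abs_le_iff) linarith
  qed
  have t6: "\<bar>a * (\<rho> * Bu + (Bu - Bs) + \<beta> / N)\<bar> \<le> 23 * K ^ 6 * (G / N)"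
  proof -
    have GN: "0 \<le> G / N" using G N1 by simp
    have "\<bar>\<rho> * Bu\<bar> \<le> (4 * K\<^sup>2 / N) * (5 * K\<^sup>2 * G)"
      unfolding abs_mult using S(4) Bu_le N1 by (intro mult_mono) auto
    also have "\<dots> = 20 * K ^ 4 * (G / N)" by (simp add: eval_nat_numeral)
    finally have 1: "\<bar>\<rho> * Bu\<bar> \<le> 20 * K ^ 4 * (G / N)" .
    have 2: "2 * K\<^sup>2 * (G / N) \<le> 2 * K ^ 4 * (G / N)"
      using K GN by (intro mult_right_mono mult_left_mono power_increasing) auto
    have "\<bar>\<beta> / N\<bar> \<le> G / N" unfolding abs_divide using N1 G by (simp add: divide_right_mono)
    also have "\<dots> \<le> K ^ 4 * (G / N)" using mult_right_mono[OF Kp'[of 4] GN] by simp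
    finally have "\<bar>\<rho> * Bu + (Bu - Bs) + \<beta> / N\<bar> \<le> 20 * K ^ 4 * (G / N) + 2 * K ^ 4 * (G / N) + K ^ 4 * (G / N)"
      using 1 2 Bu us_G by linarith
    then have "\<bar>\<rho> * Bu + (Bu - Bs) + \<beta> / N\<bar> \<le> 23 * K ^ 4 * (G / N)" by (simp add: mult_ac)
    then have "\<bar>a * (\<rho> * Bu + (Bu - Bs) + \<beta> / N)\<bar> \<le> K * (23 * K ^ 4 * (G / N))"
      unfolding abs_mult using a K by (intro mult_mono) auto
    also have "\<dots> = 23 * K ^ 5 * (G / N)" by (simp add: eval_nat_numeral)
    also have "\<dots> \<le> 23 * K ^ 6 * (G / N)"
      using Kp[of 5] GN by (intro mult_right_mono) auto
    finally show ?thesis .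
  qed
  \<comment> \<open>67 = 28 + 9 + 3 + 4 + 23. The window term occurs twice, by itself and multiplied
    by \<open>\<rho>\<close>.\<close>
  have tot: "\<bar>V - W\<bar> \<le> 67 * K ^ 6 * (G / N) + 2 * \<bar>\<Delta>'\<bar>"
  proof -
    have sum7: "\<bar>p1 + p2 + p3 + p4 + p5 + D - p6\<bar> \<le> 67 * k * y + 2 * \<bar>D\<bar>"
      if "\<bar>p1\<bar> \<le> 28 * k * y" "\<bar>p2\<bar> \<le> \<bar>D\<bar>" "\<bar>p3\<bar> \<le> 9 * k * y" "\<bar>p4\<bar> \<le> 3 * k * y" "\<bar>p5\<bar> \<le> 4 * k * y"
        "\<bar>p6\<bar> \<le> 23 * k * y" for p1 p2 p3 p4 p5 p6 D k y :: real
    proof (rule abs_leI)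
      note bounds = that[THEN abs_le_D1] that[THEN abs_le_D2] abs_ge_self[of D] abs_ge_minus_self[of D]
      show "p1 + p2 + p3 + p4 + p5 + D - p6 \<le> 67 * k * y + 2 * \<bar>D\<bar>" using bounds by linarith
      show "- (p1 + p2 + p3 + p4 + p5 + D - p6) \<le> 67 * k * y + 2 * \<bar>D\<bar>" using bounds by linarith
    qed
    show ?thesis unfolding expand by (rule sum7[OF t1 t2 t3 t4 t5 t6])
  qed
  define H where "H = \<alpha>\<^sup>2 + \<beta>\<^sup>2 + L ^ 4"
  \<comment> \<open>Squaring \<open>G\<close> creates the fourth power of \<open>L\<close>; this is
    the growth that the weight must integrate.\<close>
  have L4: "L ^ 4 \<le> 8 * (1 + s ^ 4)"
  proof -
    have sq: "(x + y)\<^sup>2 \<le> 2 * (x\<^sup>2 + y\<^sup>2)" for x y :: real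
      using sum_squares_bound[of x y] by (simp add: power2_sum)
    have "L ^ 4 = (L\<^sup>2)\<^sup>2" by simp
    also have "\<dots> \<le> (2 * (1 + s\<^sup>2))\<^sup>2"
      using sq[of 1 "\<bar>s\<bar>"] unfolding L_def by (intro power_mono) auto
    also have "\<dots> = 4 * (1 + s\<^sup>2)\<^sup>2" unfolding power_mult_distrib by simp
    also have "\<dots> \<le> 4 * (2 * (1\<^sup>2 + (s\<^sup>2)\<^sup>2))" by (intro mult_left_mono sq) auto
    finally show ?thesis by simp
  qed
  have G2: "G\<^sup>2 \<le> 3 * H"
  proof -
    have "(x + y + z)\<^sup>2 \<le> 3 * (x\<^sup>2 + y\<^sup>2 + z\<^sup>2)" for x y z :: real
      using sum_squares_bound[of x y] sum_squares_bound[of x z] sum_squares_bound[of y z]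
      by (simp add: power2_eq_square algebra_simps)
    from this[of "\<bar>\<alpha>\<bar>" "\<bar>\<beta>\<bar>" "L\<^sup>2"] show ?thesis by (simp add: G_def H_def)
  qed
  have H0: "0 \<le> H" "L ^ 4 \<le> H" by (auto simp: H_def)
  \<comment> \<open>One power of \<open>N\<close> is given away, since
    \<open>\<Delta>'\<^sup>2\<close> is only of order \<open>1 / N\<close> anyway.\<close>
  have GN2: "(G / N)\<^sup>2 \<le> 3 * H / N"
  proof -
    have "(G / N)\<^sup>2 \<le> 3 * H / N\<^sup>2" unfolding power_divide using G2 by (intro divide_right_mono) auto
    also have "\<dots> \<le> 3 * H / N"
      using H0 N1 self_le_power[OF N1, of 2] by (intro divide_left_mono) auto
    finally show ?thesis .
  qed
  have D2: "\<Delta>'\<^sup>2 \<le> 18 * K ^ 7 * (H / N)"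
  proof -
    have "L \<le> K\<^sup>2 * L" using mult_right_mono[OF Kp'[of 2], of L] L1 by simp
    moreover have "1 + \<bar>s\<bar> = L" by (simp add: L_def)
    ultimately have "1 + \<bar>s\<bar> + \<bar>u - s\<bar> \<le> 3 * K\<^sup>2 * L" using us_le' by linarith
    then have "(1 + \<bar>s\<bar> + \<bar>u - s\<bar>)\<^sup>2 \<le> (3 * K\<^sup>2 * L)\<^sup>2"
      by (intro power_mono) auto
    then have "\<bar>u - s\<bar> * ((1 + \<bar>s\<bar> + \<bar>u - s\<bar>)\<^sup>2 * K) \<le> (2 * K\<^sup>2 * L / N) * ((3 * K\<^sup>2 * L)\<^sup>2 * K)"
      using us_le K L1 N1 by (intro mult_mono) auto
    also have "\<dots> = 18 * K ^ 7 * (L ^ 3 / N)" by (simp add: power_mult_distrib eval_nat_numeral)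
    also have "\<dots> \<le> 18 * K ^ 7 * (H / N)"
    proof -
      have "L ^ 3 \<le> L ^ 4" using L1(1) by (intro power_increasing) auto
      then show ?thesis using H0 N1 K0 by (intro mult_left_mono divide_right_mono) auto
    qed
    finally show ?thesis using \<Delta> by (simp add: \<Delta>'_def)
  qed
  have "(V - W)\<^sup>2 \<le> (67 * K ^ 6 * (G / N) + 2 * \<bar>\<Delta>'\<bar>)\<^sup>2"
    using power_mono[OF tot, of 2] by simp
  also have "\<dots> \<le> 2 * (67 * K ^ 6)\<^sup>2 * (G / N)\<^sup>2 + 8 * \<Delta>'\<^sup>2"
    using sum_squares_bound[of "67 * K ^ 6 * (G / N)" "2 * \<bar>\<Delta>'\<bar>"]
    unfolding power2_sum by (simp only: power_mult_distrib power2_abs) simp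
  also have "\<dots> \<le> 2 * (67 * K ^ 6)\<^sup>2 * (3 * H / N) + 8 * (18 * K ^ 7 * (H / N))"
    using GN2 D2 by (intro add_mono mult_left_mono) auto
  also have "\<dots> = (6 * (67 * K ^ 6)\<^sup>2 + 144 * K ^ 7) / N * H"
    by (simp add: add_divide_distrib algebra_simps)
  also have "\<dots> \<le> (6 * (67 * K ^ 6)\<^sup>2 + 144 * K ^ 7) / N * (\<alpha>\<^sup>2 + \<beta>\<^sup>2 + 8 * (1 + s ^ 4))"
    using L4 N1 K0 by (intro mult_left_mono) (auto simp: H_def)
  finally show ?thesis .
qed


text \<open>\<open>eta\<close> is \<open>quad_part\<close> corrected by multiples of
  \<open>y\<^sup>2 - 1\<close> and \<open>y\<close>, the effects of estimating variance and mean.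
  The right-hand side is the \<open>W\<close> of \<open>linearisation_bound\<close>.\<close>

lemma normsum_eta:
  "normsum n (\<lambda>y. eta y s) x = normsum n (quad_part s) x
    + phi s * (1 / 2 * normsum n (\<lambda>y. y\<^sup>2 - 1) x * s + 2 * normsum n (\<lambda>y. y) x)
    - Phi s * (normsum n (\<lambda>y. y\<^sup>2 - 1) x - normsum n (\<lambda>y. y) x * s)"
proof -
  have "eta y s = quad_part s y + (1 / 2 * s * phi s - Phi s) * (y\<^sup>2 - 1) + (2 * phi s + s * Phi s) * y" for y
    by (simp add: eta_def quad_part_def field_simps)
  then have "normsum n (\<lambda>y. eta y s) x = normsum n (quad_part s) x
      + (1 / 2 * s * phi s - Phi s) * normsum n (\<lambda>y. y\<^sup>2 - 1) x + (2 * phi s + s * Phi s) * normsum n (\<lambda>y. y) x"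
    by (simp add: normsum_def sum.distrib add_divide_distrib sum_distrib_left)
  then show ?thesis by (simp add: algebra_simps)
qed

lemma emp_process_linearisation:
  fixes x :: "nat \<Rightarrow> real" and K :: real
  assumes n: "1 \<le> n" and K: "1 \<le> K" and N: "4 * K\<^sup>2 \<le> sqrt (real n)"
    and a: "\<bar>normsum n (\<lambda>y. y) x\<bar> \<le> K" and b: "\<bar>normsum n (\<lambda>y. y\<^sup>2 - 1) x\<bar> \<le> K"
    and R: "(\<integral>\<^sup>+v. ennreal ((normsum n (slope_part v) x)\<^sup>2 / (1 + v\<^sup>2)) \<partial>lborel) \<le> ennreal K"
  shows "(emp_process n x s - normsum n (\<lambda>y. eta y s) x)\<^sup>2
    \<le> (6 * (67 * K ^ 6)\<^sup>2 + 144 * K ^ 7) / sqrt (real n)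
      * ((normsum n (quad_part s) x)\<^sup>2 + (normsum n (lin_part s) x)\<^sup>2 + 8 * (1 + s ^ 4))"
proof -
  define N where "N = sqrt (real n)"
  have N0: "0 < N" "N * N = real n" using n by (auto simp: N_def)
  define m where "m = sample_mean n x"
  define \<sigma> where "\<sigma> = sample_sd n x"
  \<comment> \<open>The threshold \<open>s\<close> for the scaled residuals, pulled back to the
    scale of the observations.\<close>
  define u where "u = m + \<sigma> * s"
  define B where "B t = (\<Sum>j=1..n. (x j - t) * indicator {..t} (x j)) / real n" for t
  define a' where "a' = normsum n (\<lambda>y. y) x"
  define b' where "b' = normsum n (\<lambda>y. y\<^sup>2 - 1) x"
  have m_eq: "m = a' / N"
    by (simp add: m_def a'_def sample_mean_def normsum_def N0(2) flip: N_def)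
  have \<sigma>0: "0 \<le> \<sigma>" by (simp add: \<sigma>_def sample_sd_def sum_nonneg)
  have sum_sq: "(\<Sum>k=1..n. (x k - m)\<^sup>2) / real n = 1 + (b' - a'\<^sup>2 / N) / N"
  proof -
    have sx: "(\<Sum>k=1..n. x k) = real n * m" using n by (simp add: m_def sample_mean_def)
    have "b' = ((\<Sum>k=1..n. (x k)\<^sup>2) - real n) / N"
      by (simp add: b'_def normsum_def sum_subtractf N_def)
    then have sx2: "(\<Sum>k=1..n. (x k)\<^sup>2) = real n + b' * N" using N0 by (simp add: field_simps)
    have "(\<Sum>k=1..n. (x k - m)\<^sup>2) = (\<Sum>k=1..n. (x k)\<^sup>2) - 2 * m * (\<Sum>k=1..n. x k) + real n * m\<^sup>2"
      by (simp add: power2_diff sum.distrib sum_subtractf sum_distrib_left mult_ac)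
    also have "\<dots> = N * N + b' * N - N * N * m\<^sup>2" unfolding sx sx2 N0(2)[symmetric] by (simp add: power2_eq_square)
    also have "\<dots> / (N * N) = 1 + (b' - a'\<^sup>2 / N) / N"
      unfolding m_eq using N0(1) by (simp add: field_simps power2_eq_square)
    finally show ?thesis unfolding N0(2) .
  qed
  have \<sigma>2: "\<sigma>\<^sup>2 = 1 + (b' - a'\<^sup>2 / N) / N"
    unfolding sum_sq[symmetric] by (simp add: \<sigma>_def sample_sd_def m_def sum_nonneg)
  have \<sigma>pos: "0 < \<sigma>"
    using scale_expansion(1)[OF K N[folded N_def] a[folded a'_def] b[folded b'_def] \<sigma>0 \<sigma>2] .
  have B_lip: "\<bar>B p - B q\<bar> \<le> \<bar>p - q\<bar>" for p q
  proof -
    have "\<bar>(\<Sum>j=1..n. (x j - p) * indicator {..p} (x j) - (x j - q) * indicator {..q} (x j))\<bar> \<le> (\<Sum>j=1..n. \<bar>p - q\<bar>)"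
      by (rule order_trans[OF sum_abs]) (intro sum_mono, auto simp: indicator_def)
    then have "\<bar>B p - B q\<bar> \<le> (real n * \<bar>p - q\<bar>) / real n"
      unfolding B_def diff_divide_distrib[symmetric] sum_subtractf[symmetric] abs_divide
      by (intro frac_le) (use n in auto)
    then show ?thesis using n by simp
  qed
  have B_eq: "B s = - (phi s + s * Phi s) + normsum n (lin_part s) x / N"
  proof -
    have "normsum n (lin_part s) x = ((\<Sum>j=1..n. (x j - s) * indicator {..s} (x j)) + real n * (phi s + s * Phi s)) / N"
      by (simp add: normsum_def lin_part_def sum.distrib N_def distrib_left add.assoc)
    then have "normsum n (lin_part s) x / N = B s + (phi s + s * Phi s)"
      using N0 n by (simp add: B_def add_divide_distrib)
    then show ?thesis by simp
  qed
  have A_eq: "(\<Sum>j=1..n. x j * (x j - u) * indicator {..u} (x j)) / real n = Phi u + normsum n (quad_part u) x / N"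
  proof -
    have "normsum n (quad_part u) x = ((\<Sum>j=1..n. x j * (x j - u) * indicator {..u} (x j)) - real n * Phi u) / N"
      by (simp add: normsum_def quad_part_def sum_subtractf N_def)
    then have "normsum n (quad_part u) x / N = (\<Sum>j=1..n. x j * (x j - u) * indicator {..u} (x j)) / real n - Phi u"
      using N0 n by (simp add: diff_divide_distrib)
    then show ?thesis by simp
  qed
  have V: "emp_process n x s = N * ((Phi u + normsum n (quad_part u) x / N - a' / N * B u) / \<sigma>\<^sup>2 - Phi s)"
  proof -
    \<comment> \<open>\<open>(x j - m) * (x j - u) / \<sigma>\<^sup>2\<close>, split so that the
      mean \<open>m\<close> multiplies a sum of its own, which becomes \<open>B u\<close>.\<close>
    have summand: "scaled_residual n x j * (scaled_residual n x j - s) * indicator {..s} (scaled_residual n x j)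
        = (x j * (x j - u) * indicator {..u} (x j) - m * ((x j - u) * indicator {..u} (x j))) / \<sigma>\<^sup>2" for j
    proof -
      have "scaled_residual n x j \<le> s \<longleftrightarrow> x j \<le> u"
        using \<sigma>pos by (simp add: scaled_residual_def u_def flip: m_def \<sigma>_def) (simp add: field_simps)
      then have ind: "indicator {..s} (scaled_residual n x j) = (indicator {..u} (x j) :: real)"
        by (simp add: indicator_def)
      have "scaled_residual n x j * (scaled_residual n x j - s) = ((x j - m) * (x j - u)) / \<sigma>\<^sup>2"
        using \<sigma>pos by (simp add: scaled_residual_def u_def field_simps power2_eq_square flip: m_def \<sigma>_def)
      then show ?thesis unfolding ind by (simp add: algebra_simps)
    qed
    have "(1 / real n) * (\<Sum>j=1..n. scaled_residual n x j * (scaled_residual n x j - s) * indicator {..s} (scaled_residual n x j))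
        = ((\<Sum>j=1..n. x j * (x j - u) * indicator {..u} (x j)) / real n - m * B u) / \<sigma>\<^sup>2"
      unfolding summand sum_divide_distrib[symmetric] sum_subtractf sum_distrib_left[symmetric] B_def
      by (simp add: diff_divide_distrib mult.commute)
    then show ?thesis
      unfolding emp_process_def A_eq N_def[symmetric] m_eq by simp
  qed
  have \<Delta>: "(normsum n (quad_part u) x - normsum n (quad_part s) x)\<^sup>2 \<le> \<bar>u - s\<bar> * ((1 + \<bar>s\<bar> + \<bar>u - s\<bar>)\<^sup>2 * K)"
  proof -
    \<comment> \<open>Valid for every \<open>v\<close> between \<open>s\<close> and
      \<open>u\<close>, in whichever order the two stand.\<close>
    have bd: "1 + v\<^sup>2 \<le> (1 + \<bar>s\<bar> + \<bar>u - s\<bar>)\<^sup>2" if "\<bar>v\<bar> \<le> \<bar>s\<bar> + \<bar>u - s\<bar>" for v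
    proof -
      have "1 + v\<^sup>2 \<le> (1 + \<bar>v\<bar>)\<^sup>2" by (simp add: power2_sum)
      also have "\<dots> \<le> (1 + \<bar>s\<bar> + \<bar>u - s\<bar>)\<^sup>2" using that by (intro power_mono) auto
      finally show ?thesis .
    qed
    show ?thesis
    proof (cases "s \<le> u")
      case True
      show ?thesis
        using normsum_quad_part_diff_le[OF True R, of "(1 + \<bar>s\<bar> + \<bar>u - s\<bar>)\<^sup>2"] bd K True by auto
    next
      case False
      then have "u \<le> s" by simp
      show ?thesis
        using normsum_quad_part_diff_le[OF \<open>u \<le> s\<close> R, of "(1 + \<bar>s\<bar> + \<bar>u - s\<bar>)\<^sup>2"] bd K \<open>u \<le> s\<close>
        by (auto simp: power2_commute)
    qed
  qed
  show ?thesis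
    unfolding N_def[symmetric]
    by (rule linearisation_bound[OF K N[folded N_def] a[folded a'_def] b[folded b'_def] \<sigma>0 \<sigma>2 _ B_eq B_lip V
        normsum_eta[of n s x, folded a'_def b'_def] \<Delta>]) (simp add: u_def m_eq)
qed

lemma G2_eq_emp_process: "G2 \<omega> n x = (\<integral>t. (emp_process n x t)\<^sup>2 * \<omega> t \<partial>lborel)"
  unfolding G2_def emp_process_def power_mult_distrib by (simp add: mult.assoc)

section \<open>The kernel with the true derivatives\<close>

lemma continuous_kernel_K2:
  assumes d: "\<And>k. k \<in> {1, 2, 3} \<Longrightarrow> continuous_on UNIV (d k)"
  shows "continuous_on UNIV (\<lambda>z. kernel_K2 d (fst z) (snd z))"
proof -
  have d': "continuous_on A (\<lambda>z. d k (f z))" if "continuous_on A f" "k \<in> {1, 2, 3}" for A k and f :: "'z::topological_space \<Rightarrow> real"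
    using continuous_on_compose2[OF d that(1)] that(2) by simp
  show ?thesis
    unfolding kernel_K2_def Psi1_def Psi2_def Psi3_def Psi4_def
    by (intro continuous_intros d') auto
qed

lemma phi_derivs_eq:
  "phi_derivs 1 = (\<lambda>x. - x * phi x)"
  "phi_derivs 2 = (\<lambda>x. (x\<^sup>2 - 1) * phi x)"
  "phi_derivs 3 = (\<lambda>x. (3 * x - x ^ 3) * phi x)"
proof -
  have 1: "deriv phi = (\<lambda>x. - x * phi x)"
    by (rule ext) (rule DERIV_imp_deriv[OF DERIV_phi])
  have 2: "deriv (\<lambda>x. - x * phi x) = (\<lambda>x. (x\<^sup>2 - 1) * phi x)"
    by (rule ext, rule DERIV_imp_deriv)
      (auto intro!: derivative_eq_intros DERIV_phi simp: algebra_simps power2_eq_square)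
  have 3: "deriv (\<lambda>x. (x\<^sup>2 - 1) * phi x) = (\<lambda>x. (3 * x - x ^ 3) * phi x)"
    by (rule ext, rule DERIV_imp_deriv)
      (auto intro!: derivative_eq_intros DERIV_phi simp: algebra_simps power2_eq_square power3_eq_cube)
  show "phi_derivs 1 = (\<lambda>x. - x * phi x)" by (simp add: phi_derivs_def 1)
  show "phi_derivs 2 = (\<lambda>x. (x\<^sup>2 - 1) * phi x)"
  proof -
    have "phi_derivs 2 = deriv (deriv phi)" by (simp add: phi_derivs_def numeral_2_eq_2)
    then show ?thesis by (simp only: 1 2)
  qed
  show "phi_derivs 3 = (\<lambda>x. (3 * x - x ^ 3) * phi x)"
  proof -
    have "phi_derivs 3 = deriv (deriv (deriv phi))" by (simp add: phi_derivs_def numeral_3_eq_3)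
    then show ?thesis by (simp only: 1 2 3)
  qed
qed

lemma kernel_K2_phi_derivs_3_3: "kernel_K2 phi_derivs 3 3 < 0"
proof -
  define f where "f = phi 3"
  define F where "F = Phi 3"
  have K: "kernel_K2 phi_derivs 3 3 = 6 * f * (1 - 2 * F) + 12 * F * (1 - F) + 27 / 2 * f\<^sup>2"
    unfolding kernel_K2_def Psi1_def Psi2_def Psi3_def Psi4_def phi_derivs_eq[unfolded One_nat_def] One_nat_def min.idem
      f_def[symmetric] F_def[symmetric]
    by (simp add: f_def[symmetric] F_def[symmetric] algebra_simps power2_eq_square)
  \<comment> \<open>The integral of \<open>x - 3\<close> over \<open>x > 3\<close> is nonnegative
    and equals \<open>f - 3 * (1 - F)\<close>.\<close>
  have mills: "3 * (1 - F) \<le> f"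
  proof -
    have i: "integrable gauss (\<lambda>x. poly4 (- 3) 1 0 0 0 x - poly4 (- 3) 1 0 0 0 x * indicator {..3} x)"
      by (intro Bochner_Integration.integrable_diff poly4_integral(1) poly4_halfline_integral(1))
    have "0 \<le> (\<integral>x. poly4 (- 3) 1 0 0 0 x - poly4 (- 3) 1 0 0 0 x * indicator {..3} x \<partial>gauss)"
      by (rule integral_nonneg_AE) (auto simp: poly4_def indicator_def)
    also have "\<dots> = - 3 + f + 3 * F"
      by (subst Bochner_Integration.integral_diff[OF poly4_integral(1) poly4_halfline_integral(1)])
        (simp add: poly4_integral(2) poly4_halfline_integral(2) gmoment_0 gmoment_simps f_def F_def)
    finally show ?thesis by simp
  qed
  have f0: "0 < f" by (simp add: f_def normal_density_pos)
  have f1: "f \<le> 1 / 10"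
  proof -
    have "1 + 9 / 2 + (9 / 2)\<^sup>2 / 2 \<le> exp (9 / 2 :: real)" by (rule exp_lower_Taylor_quadratic) simp
    then have "10 \<le> exp (9 / 2 :: real)" by (simp add: power2_eq_square)
    then have "exp (- (9 / 2)) \<le> 1 / (10 :: real)" by (simp add: exp_minus field_simps)
    moreover have "1 / sqrt (2 * pi) \<le> 1" using pi_gt3 by (simp add: divide_le_eq)
    ultimately have "1 / sqrt (2 * pi) * exp (- (9 / 2)) \<le> 1 * (1 / 10)" by (intro mult_mono) auto
    then show ?thesis by (simp add: f_def std_normal_density_def)
  qed
  have F1: "0 \<le> 1 - F" "0 \<le> F" using Phi_bounds[of 3] by (simp_all add: F_def)
  have "12 * F * (1 - F) \<le> 4 * f"
  proof -
    have "F * (3 * (1 - F)) \<le> 1 * f" using mills F1 by (intro mult_mono) auto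
    then show ?thesis by (simp add: algebra_simps)
  qed
  moreover have "6 * f * (1 - 2 * F) \<le> 6 * f * (- 1 + 2 / 3 * f)"
    using mills f0 by (intro mult_left_mono) auto
  moreover have "f\<^sup>2 \<le> f * (1 / 10)" unfolding power2_eq_square using f0 f1 by (intro mult_left_mono) auto
  \<comment> \<open>The linear terms give \<open>4 * f - 6 * f\<close>, the quadratic ones 4 + 27/2
    = 35/2 times \<open>f\<^sup>2\<close>; with \<open>f \<le> 1 / 10\<close> the former
    prevail.\<close>
  ultimately have "kernel_K2 phi_derivs 3 3 \<le> - 2 * f + 35 / 2 * (f * (1 / 10))"
    unfolding K by (simp add: power2_eq_square algebra_simps)
  also have "\<dots> < 0" using f0 by simp
  finally show ?thesis .
qed

text \<open>The covariance form at the indicator of a short interval around \<open>t0\<close> is a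
  second moment, hence nonnegative; a negative diagonal value would make the kernel negative on the
  whole small square, which has positive mass. Continuity is essential here because the covariance
  condition sees \<open>K\<close> only under integrals.\<close>

lemma covariance_kernel_diagonal_nonneg:
  fixes K :: "real \<Rightarrow> real \<Rightarrow> real"
  assumes cont: "continuous_on UNIV (\<lambda>z. K (fst z) (snd z))"
    and \<mu>: "finite_measure \<mu>" "sets \<mu> = sets borel" and pos: "\<And>a b. a < b \<Longrightarrow> 0 < measure \<mu> {a..b}"
    and cov: "has_covariance_kernel N \<mu> Z K"
  shows "0 \<le> K t0 t0"
proof (rule ccontr)
  interpret finite_borel_measure \<mu>
    using \<mu> by (auto simp: finite_borel_measure_def finite_borel_measure_axioms_def)
  define k where "k = - K t0 t0"
  assume "\<not> 0 \<le> K t0 t0"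
  then have k: "0 < k" by (simp add: k_def)
  have [measurable]: "(\<lambda>z. K (fst z) (snd z)) \<in> borel_measurable (borel \<Otimes>\<^sub>M borel)"
    using borel_measurable_continuous_onI[OF cont] by (simp add: borel_prod)
  obtain e where e: "e > 0" "\<And>z. dist z (t0, t0) < e \<Longrightarrow> dist (K (fst z) (snd z)) (K t0 t0) < k / 2"
    using cont k unfolding continuous_on_iff by (metis UNIV_I fst_conv snd_conv half_gt_zero)
  \<comment> \<open>With each coordinate within \<open>e / 3\<close> the distance to the diagonal
    point is at most \<open>2 * e / 3\<close>.\<close>
  define J where "J = {t0 - e / 3..t0 + e / 3}"
  have near: "\<bar>K s t + k\<bar> < k / 2" if "s \<in> J" "t \<in> J" for s t
  proof -
    have "dist (s, t) (t0, t0) \<le> dist s t0 + dist t t0"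
      unfolding dist_Pair_Pair by (rule sqrt_sum_squares_le_sum) auto
    also have "\<dots> < e" using that e(1) by (auto simp: J_def dist_real_def abs_if)
    finally show ?thesis using e(2)[of "(s, t)"] by (simp add: dist_real_def k_def)
  qed
  define g where "g = (indicator J :: real \<Rightarrow> real)"
  have J [measurable]: "J \<in> sets borel" by (simp add: J_def)
  have g: "g \<in> L2_space \<mu>" unfolding g_def by (rule indicator_L2[OF J])
  have mJ: "0 < measure \<mu> J" using pos[of "t0 - e / 3" "t0 + e / 3"] e(1) by (simp add: J_def)
  have ig: "integrable \<mu> g" unfolding g_def
    by (rule integrable_real_indicator) (auto simp: less_top[symmetric])
  have Kb: "\<bar>K s t * g s * g t\<bar> \<le> 2 * k * g t" for s t
    using near[of s t] k by (auto simp: g_def indicator_def abs_if split: if_splits)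
  have i1: "integrable \<mu> (\<lambda>t. K s t * g s * g t)" for s
  proof (rule Bochner_Integration.integrable_bound[OF integrable_mult_right[OF ig, of "2 * k"]])
    show "(\<lambda>t. K s t * g s * g t) \<in> borel_measurable \<mu>"
    proof -
      have "(\<lambda>t. K s t) \<in> borel_measurable borel"
        using measurable_compose[OF measurable_Pair1'[of s borel borel] \<open>(\<lambda>z. K (fst z) (snd z)) \<in> _\<close>] by simp
      then show ?thesis by (simp add: g_def)
    qed
    show "AE t in \<mu>. norm (K s t * g s * g t) \<le> norm (2 * k * g t)"
      using Kb k by (auto simp: g_def)
  qed
  define I where "I s = (\<integral>t. K s t * g s * g t \<partial>\<mu>)" for s
  have intg: "(\<integral>t. g t \<partial>\<mu>) = measure \<mu> J" by (simp add: g_def)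
  have I_le: "I s \<le> - (k / 2 * measure \<mu> J) * g s" for s
  proof -
    have "I s \<le> (\<integral>t. (- (k / 2) * g s) * g t \<partial>\<mu>)"
      unfolding I_def
    proof (intro integral_mono i1 integrable_mult_right ig)
      show "K s t * g s * g t \<le> (- (k / 2) * g s) * g t" for t
        using near[of s t] by (auto simp: g_def indicator_def abs_if split: if_splits)
    qed
    then show ?thesis by (simp add: intg mult_ac)
  qed
  have I_abs: "\<bar>I s\<bar> \<le> (2 * k * measure \<mu> J) * g s" for s
  proof (cases "s \<in> J")
    case True
    have "\<bar>I s\<bar> \<le> (\<integral>t. \<bar>K s t * g s * g t\<bar> \<partial>\<mu>)"
      unfolding I_def by (rule integral_abs_bound)
    also have "\<dots> \<le> (\<integral>t. 2 * k * g t \<partial>\<mu>)"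
      by (intro integral_mono integrable_abs i1 integrable_mult_right ig Kb)
    finally show ?thesis using True by (simp add: intg g_def)
  next
    case False
    then show ?thesis by (simp add: I_def g_def)
  qed
  have iI: "integrable \<mu> I"
  proof (rule Bochner_Integration.integrable_bound[OF integrable_mult_right[OF ig, of "2 * k * measure \<mu> J"]])
    show "I \<in> borel_measurable \<mu>"
      unfolding I_def[abs_def] g_def
    proof (rule borel_measurable_lebesgue_integral)
      have "(\<lambda>z. K (fst z) (snd z) * indicator J (fst z) * indicator J (snd z)) \<in> borel_measurable (borel \<Otimes>\<^sub>M borel)"
        by measurable
      then show "(\<lambda>(s, t). K s t * indicator J s * indicator J t) \<in> borel_measurable (\<mu> \<Otimes>\<^sub>M \<mu>)"
        by (simp add: split_beta' cong: measurable_cong_sets sets_pair_measure_cong)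
    qed
    show "AE s in \<mu>. norm (I s) \<le> norm (2 * k * measure \<mu> J * g s)"
      using I_abs k mJ by (auto simp: g_def abs_mult)
  qed
  have "(\<integral>s. I s \<partial>\<mu>) \<le> (\<integral>s. - (k / 2 * measure \<mu> J) * g s \<partial>\<mu>)"
    by (intro integral_mono iI integrable_mult_right ig I_le)
  also have "\<dots> < 0" using k mJ by (simp add: intg)
  finally have "(\<integral>s. I s \<partial>\<mu>) < 0" .
  moreover have "(\<integral>w. L2_inner \<mu> (Z w) g * L2_inner \<mu> (Z w) g \<partial>N) = (\<integral>s. I s \<partial>\<mu>)"
    using cov g unfolding has_covariance_kernel_def I_def by blast
  moreover have "0 \<le> (\<integral>w. L2_inner \<mu> (Z w) g * L2_inner \<mu> (Z w) g \<partial>N)"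
    by (rule integral_nonneg_AE) auto
  ultimately show False by simp
qed

lemma continuous_phi_derivs: "k \<in> {1, 2, 3} \<Longrightarrow> continuous_on UNIV (phi_derivs k)"
  unfolding insert_iff empty_iff
  by (elim disjE; simp only: phi_derivs_eq; intro continuous_intros)

section \<open>Projections of the linearised process\<close>

text \<open>The gateway to all exchanges of integrals below: separated bounds such as
  \<open>eta_bound\<close> yield product integrability at once.\<close>

lemma (in pair_sigma_finite) integrable_product_bound:
  fixes f :: "'a \<times> 'b \<Rightarrow> real"
  assumes f: "f \<in> borel_measurable (M1 \<Otimes>\<^sub>M M2)" and u: "integrable M1 u" and v: "integrable M2 v"
    and bd: "\<And>x y. \<bar>f (x, y)\<bar> \<le> u x * v y"
  shows "integrable (M1 \<Otimes>\<^sub>M M2) f"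
proof -
  have "integrable (M1 \<Otimes>\<^sub>M M2) (\<lambda>(x, y). \<bar>u x\<bar> * \<bar>v y\<bar>)"
  proof (rule Fubini_integrable)
    have [measurable]: "u \<in> borel_measurable M1" "v \<in> borel_measurable M2" using u v by auto
    show "(\<lambda>(x, y). \<bar>u x\<bar> * \<bar>v y\<bar>) \<in> borel_measurable (M1 \<Otimes>\<^sub>M M2)" by measurable
    show "integrable M1 (\<lambda>x. \<integral>y. norm (case (x, y) of (x, y) \<Rightarrow> \<bar>u x\<bar> * \<bar>v y\<bar>) \<partial>M2)"
      using u by (simp add: abs_mult)
    show "AE x in M1. integrable M2 (\<lambda>y. case (x, y) of (x, y) \<Rightarrow> \<bar>u x\<bar> * \<bar>v y\<bar>)"
      using v by simp
  qed
  then show ?thesis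
  proof (rule Bochner_Integration.integrable_bound[OF _ f])
    have "norm (f z) \<le> norm (case z of (x, y) \<Rightarrow> \<bar>u x\<bar> * \<bar>v y\<bar>)" for z
      using bd[of "fst z" "snd z"] abs_ge_self[of "u (fst z) * v (snd z)"]
      by (cases z) (simp add: abs_mult)
    then show "AE z in M1 \<Otimes>\<^sub>M M2. norm (f z) \<le> norm (case z of (x, y) \<Rightarrow> \<bar>u x\<bar> * \<bar>v y\<bar>)"
      by simp
  qed
qed

lemma gauss_one_plus_square:
  "integrable gauss (\<lambda>x. 1 + x\<^sup>2)" "integrable gauss (\<lambda>x. (1 + x\<^sup>2)\<^sup>2)"
  "(\<integral>x. (1 + x\<^sup>2)\<^sup>2 \<partial>gauss) = 6"
proof -
  \<comment> \<open>The value 6 is 1 + 2 * 1 + 3, from the second and fourth moments 1 and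
    3.\<close>
  have eq: "(1 + x\<^sup>2)\<^sup>2 = poly4 1 0 2 0 1 x" for x :: real
    by (simp add: poly4_def power2_sum flip: power_mult)
  show "integrable gauss (\<lambda>x. 1 + x\<^sup>2)" using gauss_power_integrable[of 2] by simp
  show "integrable gauss (\<lambda>x. (1 + x\<^sup>2)\<^sup>2)" unfolding eq by (rule poly4_integral(1))
  show "(\<integral>x. (1 + x\<^sup>2)\<^sup>2 \<partial>gauss) = 6" unfolding eq poly4_integral(2) by simp
qed

lemma gauss_square_bound:
  assumes [measurable]: "f \<in> borel_measurable borel" and bd: "\<And>x. \<bar>f x\<bar> \<le> (1 + x\<^sup>2) * g"
  shows "integrable gauss (\<lambda>x. (f x)\<^sup>2)" "(\<integral>x. (f x)\<^sup>2 \<partial>gauss) \<le> 6 * g\<^sup>2" "integrable gauss f"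
proof -
  have sq: "(f x)\<^sup>2 \<le> g\<^sup>2 * (1 + x\<^sup>2)\<^sup>2" for x
    using power_mono[OF bd[of x], of 2] by (simp add: power_mult_distrib mult.commute)
  show i: "integrable gauss (\<lambda>x. (f x)\<^sup>2)"
    by (rule Bochner_Integration.integrable_bound[OF integrable_mult_right[OF gauss_one_plus_square(2), of "g\<^sup>2"]])
      (use sq in auto)
  then show "integrable gauss f" by (rule gauss.square_integrable_imp_integrable[rotated]) simp
  have "(\<integral>x. (f x)\<^sup>2 \<partial>gauss) \<le> (\<integral>x. g\<^sup>2 * (1 + x\<^sup>2)\<^sup>2 \<partial>gauss)"
    by (intro integral_mono i integrable_mult_right gauss_one_plus_square sq)
  then show "(\<integral>x. (f x)\<^sup>2 \<partial>gauss) \<le> 6 * g\<^sup>2" by (simp add: gauss_one_plus_square(3) mult.commute)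
qed

lemma zeta_eq:
  assumes [measurable]: "c \<in> borel_measurable borel"
  shows "zeta c s = (\<integral>x. eta x s * c x \<partial>gauss)"
proof -
  have [measurable]: "(\<lambda>x. eta x s) \<in> borel_measurable borel"
    using measurable_compose[OF measurable_Pair2'[of s borel borel] eta_measurable] by simp
  show ?thesis
    unfolding zeta_def by (subst gauss_integral) (auto simp: mult_ac)
qed

section \<open>The weighted space and the functionals of the kernel function\<close>

locale weight =
  fixes \<omega> :: "real \<Rightarrow> real"
  assumes \<omega>_pos: "\<And>t. 0 < \<omega> t" and \<omega>_cont: "continuous_on UNIV \<omega>"
    and \<omega>_moment: "integrable lborel (\<lambda>t. t ^ 4 * \<omega> t)"
begin

abbreviation \<mu> :: "real measure" where
  "\<mu> \<equiv> weighted_lebesgue \<omega>"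

lemma \<omega>_measurable [measurable]: "\<omega> \<in> borel_measurable borel"
  using \<omega>_cont by (rule borel_measurable_continuous_onI)

text \<open>Outside [-1, 1] the weight is dominated by \<open>t ^ 4 * \<omega> t\<close>, inside it
  is continuous on a compact interval.\<close>

lemma integrable_\<omega>: "integrable lborel \<omega>"
proof (rule Bochner_Integration.integrable_bound)
  have "set_integrable lborel {-1..1} \<omega>"
    by (rule borel_integrable_atLeastAtMost'[OF continuous_on_subset[OF \<omega>_cont]]) simp
  then show "integrable lborel (\<lambda>t. indicator {-1..1} t *\<^sub>R \<omega> t + t ^ 4 * \<omega> t)"
    unfolding set_integrable_def using \<omega>_moment by (rule Bochner_Integration.integrable_add)
  have "\<omega> t \<le> indicator {-1..1} t * \<omega> t + t ^ 4 * \<omega> t" for t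
  proof (cases "t \<in> {-1..1}")
    case True
    then show ?thesis using \<omega>_pos[of t] by simp
  next
    case False
    then have "1 ^ 4 \<le> \<bar>t\<bar> ^ 4" by (intro power_mono) auto
    then have "1 * \<omega> t \<le> t ^ 4 * \<omega> t"
      using \<omega>_pos[of t] by (intro mult_right_mono) auto
    then show ?thesis using False by simp
  qed
  then show "AE t in lborel. norm (\<omega> t) \<le> norm (indicator {-1..1} t *\<^sub>R \<omega> t + t ^ 4 * \<omega> t)"
    using \<omega>_pos by (auto simp: less_imp_le intro!: AE_I2 order_trans[OF _ abs_ge_self])
qed simp

lemma sets_\<mu>: "sets \<mu> = sets borel"
  by (simp add: weighted_lebesgue_def)

lemma finite_measure_\<mu>: "finite_measure \<mu>"
proof
  have "emeasure \<mu> (space \<mu>) = (\<integral>\<^sup>+t. ennreal (\<omega> t) \<partial>lborel)"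
    by (simp add: weighted_lebesgue_def emeasure_density)
  also have "\<dots> < \<infinity>"
    using integrable_\<omega> \<omega>_pos by (simp add: nn_integral_eq_integral less_imp_le)
  finally show "emeasure \<mu> (space \<mu>) \<noteq> \<infinity>" by simp
qed

sublocale finite_borel_measure \<mu>
  using finite_measure_\<mu> sets_\<mu> by (auto simp: finite_borel_measure_def finite_borel_measure_axioms_def)

sublocale gauss_\<mu>: pair_sigma_finite gauss \<mu> ..

lemma \<mu>_integral: "f \<in> borel_measurable borel \<Longrightarrow> (\<integral>t. f t \<partial>\<mu>) = (\<integral>t. f t * \<omega> t \<partial>lborel)"
  for f :: "real \<Rightarrow> real"
  unfolding weighted_lebesgue_def using \<omega>_pos
  by (subst integral_density) (auto simp: less_imp_le mult.commute)

lemma \<mu>_integrable: "f \<in> borel_measurable borel \<Longrightarrow> integrable \<mu> f \<longleftrightarrow> integrable lborel (\<lambda>t. f t * \<omega> t)"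
  for f :: "real \<Rightarrow> real"
  unfolding weighted_lebesgue_def using \<omega>_pos
  by (subst integrable_density) (auto simp: less_imp_le mult.commute)

lemma \<mu>_Icc_pos: "a < b \<Longrightarrow> 0 < measure \<mu> {a..b}"
proof (rule ccontr)
  assume "a < b" and "\<not> 0 < measure \<mu> {a..b}"
  then have "emeasure \<mu> {a..b} = 0" by (simp add: zero_less_measure_iff emeasure_eq_measure)
  then have "(\<integral>\<^sup>+t. ennreal (\<omega> t) * indicator {a..b} t \<partial>lborel) = 0"
    by (simp add: weighted_lebesgue_def emeasure_density)
  then have "AE t in lborel. ennreal (\<omega> t) * indicator {a..b} t = 0"
    by (subst (asm) nn_integral_0_iff_AE) auto
  then have "AE t in lborel. t \<notin> {a..b}"
  proof eventually_elim
    case (elim t)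
    have "\<not> \<omega> t \<le> 0" using \<omega>_pos[of t] by simp
    then show ?case using elim by (auto simp: indicator_def ennreal_eq_0_iff split: if_splits)
  qed
  then have "emeasure lborel {t \<in> space lborel. t \<in> {a..b}} = 0"
    by (rule emeasure_eq_0_AE)
  moreover have "{t \<in> space lborel. t \<in> {a..b}} = {a..b}" by auto
  ultimately have "emeasure lborel {a..b} = 0" by (simp only:)
  then show False using \<open>a < b\<close> by simp
qed

lemma integrable_fourth: "integrable \<mu> (\<lambda>s. 1 + s ^ 4)"
  using \<omega>_moment integrable_\<omega> by (simp add: \<mu>_integrable distrib_right)

lemma one_plus_abs_square: "(1 + \<bar>s\<bar>)\<^sup>2 \<le> 4 * (1 + s ^ 4)" for s :: real
proof -
  have "(1 + \<bar>s\<bar>)\<^sup>2 \<le> 2 * (1 + s\<^sup>2)"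
    using sum_squares_bound[of 1 "\<bar>s\<bar>"] by (simp add: power2_sum)
  also have "\<dots> \<le> 2 * (2 * (1 + s ^ 4))"
  proof -
    have "2 * (1 + p) \<le> 2 * (2 * (1 + q))" if "2 * p \<le> 1 + q" "0 \<le> q" for p q :: real
      using that by simp
    moreover have "2 * s\<^sup>2 \<le> 1 + s ^ 4" using sum_squares_bound[of 1 "s\<^sup>2"] by (simp flip: power_mult)
    moreover have "0 \<le> s ^ 4" by simp
    ultimately show ?thesis by blast
  qed
  finally show ?thesis by simp
qed

lemma L2_linear_growth:
  assumes [measurable]: "f \<in> borel_measurable borel" and bd: "\<And>s. \<bar>f s\<bar> \<le> c * (1 + \<bar>s\<bar>)"
  shows "f \<in> L2_space \<mu>"
proof -
  have "(f s)\<^sup>2 \<le> c\<^sup>2 * (4 * (1 + s ^ 4))" for s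
  proof -
    have "\<bar>f s\<bar>\<^sup>2 \<le> (c * (1 + \<bar>s\<bar>))\<^sup>2" by (intro power_mono bd) auto
    also have "\<dots> \<le> c\<^sup>2 * (4 * (1 + s ^ 4))"
      unfolding power_mult_distrib by (intro mult_left_mono one_plus_abs_square) auto
    finally show ?thesis by simp
  qed
  then have "integrable \<mu> (\<lambda>s. (f s)\<^sup>2)"
    by (intro Bochner_Integration.integrable_bound[OF integrable_mult_right[OF integrable_mult_right[OF integrable_fourth, of 4], of "c\<^sup>2"]])
      (auto intro!: AE_I2 order_trans[OF _ abs_ge_self])
  then show ?thesis by (simp add: L2_space_def)
qed

lemma integrable_linear: "integrable \<mu> (\<lambda>s. 1 + \<bar>s\<bar>)"
proof -
  have "(\<lambda>s. 1 + \<bar>s\<bar>) \<in> L2_space \<mu>" by (rule L2_linear_growth[of _ 1]) auto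
  from L2_spaceD(2)[OF this] show ?thesis
    by (rule square_integrable_imp_integrable[rotated]) simp
qed

lemma eta_measurable1 [measurable]: "(\<lambda>x. eta x s) \<in> borel_measurable borel"
  using measurable_compose[OF measurable_Pair2'[of s borel borel] eta_measurable] by simp

lemma eta_measurable2 [measurable]: "eta x \<in> borel_measurable borel"
  using measurable_compose[OF measurable_Pair1'[of x borel borel] eta_measurable] by simp

lemma eta_L2: "eta x \<in> L2_space \<mu>"
  by (rule L2_linear_growth[OF _ eta_bound[of x, unfolded mult.assoc[symmetric]]]) simp

lemma zeta_L2:
  assumes [measurable]: "c \<in> borel_measurable borel" and c: "\<And>x. \<bar>c x\<bar> \<le> C"
  shows "zeta c \<in> L2_space \<mu>"
proof (rule L2_linear_growth)
  have C0: "0 \<le> C" using c[of 0] by linarith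
  show "zeta c \<in> borel_measurable borel"
    unfolding zeta_def[abs_def] by measurable
  fix s
  have bd: "\<bar>eta x s * c x\<bar> \<le> (1 + x\<^sup>2) * (4 * (1 + \<bar>s\<bar>) * C)" for x
  proof -
    have "\<bar>eta x s * c x\<bar> \<le> (4 * (1 + x\<^sup>2) * (1 + \<bar>s\<bar>)) * C"
      unfolding abs_mult using eta_bound[of x s] c[of x] C0 by (intro mult_mono) auto
    then show ?thesis by (simp add: algebra_simps)
  qed
  have i: "integrable gauss (\<lambda>x. eta x s * c x)"
    by (rule gauss_square_bound(3)[OF _ bd]) simp
  have "\<bar>zeta c s\<bar> \<le> (\<integral>x. \<bar>eta x s * c x\<bar> \<partial>gauss)"
    unfolding zeta_eq[OF assms(1)] by (rule integral_abs_bound)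
  also have "\<dots> \<le> (\<integral>x. (1 + x\<^sup>2) * (4 * (1 + \<bar>s\<bar>) * C) \<partial>gauss)"
    using i bd by (intro integral_mono integrable_abs integrable_mult_left gauss_one_plus_square) auto
  also have "\<dots> = (\<integral>x. 1 + x\<^sup>2 \<partial>gauss) * (4 * C) * (1 + \<bar>s\<bar>)"
    by (simp add: mult_ac)
  finally show "\<bar>zeta c s\<bar> \<le> (\<integral>x. 1 + x\<^sup>2 \<partial>gauss) * (4 * C) * (1 + \<bar>s\<bar>)" .
qed

text \<open>The summand of the one-dimensional central limit theorem: pairing the linearised process
  with \<open>g\<close> gives the normalised sum of this function, see
  \<open>normsum_eta_inner\<close>. It is studied for bounded \<open>g\<close>, which includes the
  step functions.\<close>

definition eta_inner :: "(real \<Rightarrow> real) \<Rightarrow> real \<Rightarrow> real" where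
  "eta_inner g x = L2_inner \<mu> (eta x) g"

context
  fixes g :: "real \<Rightarrow> real" and B :: real
  assumes g_meas [measurable]: "g \<in> borel_measurable borel" and g_bound: "\<And>s. \<bar>g s\<bar> \<le> B"
begin

lemma B_nonneg: "0 \<le> B"
  using g_bound[of 0] by linarith

lemma eta_g_bound: "\<bar>eta x s * g s\<bar> \<le> (1 + x\<^sup>2) * (4 * B * (1 + \<bar>s\<bar>))"
proof -
  have "\<bar>eta x s * g s\<bar> \<le> (4 * (1 + x\<^sup>2) * (1 + \<bar>s\<bar>)) * B"
    unfolding abs_mult using eta_bound[of x s] g_bound[of s] B_nonneg by (intro mult_mono) auto
  then show ?thesis by (simp add: algebra_simps)
qed

lemma eta_inner_measurable [measurable]: "eta_inner g \<in> borel_measurable borel"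
  unfolding eta_inner_def[abs_def] L2_inner_def
  by (rule borel_measurable_lebesgue_integral) measurable

lemma eta_inner_bound: "\<bar>eta_inner g x\<bar> \<le> (1 + x\<^sup>2) * (4 * B * (\<integral>s. 1 + \<bar>s\<bar> \<partial>\<mu>))"
proof -
  have i: "integrable \<mu> (\<lambda>s. (1 + x\<^sup>2) * (4 * B * (1 + \<bar>s\<bar>)))"
    by (intro integrable_mult_right integrable_linear)
  have "\<bar>eta_inner g x\<bar> \<le> (\<integral>s. \<bar>eta x s * g s\<bar> \<partial>\<mu>)"
    unfolding eta_inner_def L2_inner_def by (rule integral_abs_bound)
  also have "\<dots> \<le> (\<integral>s. (1 + x\<^sup>2) * (4 * B * (1 + \<bar>s\<bar>)) \<partial>\<mu>)"
  proof (rule integral_mono[OF _ i eta_g_bound])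
    show "integrable \<mu> (\<lambda>s. \<bar>eta x s * g s\<bar>)"
      by (rule Bochner_Integration.integrable_bound[OF i])
        (use eta_g_bound in \<open>auto intro!: AE_I2 order_trans[OF _ abs_ge_self]\<close>)
  qed
  finally show ?thesis by simp
qed

lemmas eta_inner_square_integrable = gauss_square_bound(1)[OF eta_inner_measurable eta_inner_bound]
lemmas eta_inner_integrable = gauss_square_bound(3)[OF eta_inner_measurable eta_inner_bound]

lemma eta_inner_zeta:
  assumes [measurable]: "c \<in> borel_measurable borel" and c: "\<And>x. \<bar>c x\<bar> \<le> C"
  shows "(\<integral>x. eta_inner g x * c x \<partial>gauss) = L2_inner \<mu> (zeta c) g"
proof -
  have C0: "0 \<le> C" using c[of 0] by linarith
  have i: "integrable (gauss \<Otimes>\<^sub>M \<mu>) (\<lambda>(x, s). eta x s * g s * c x)"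
  proof (rule gauss_\<mu>.integrable_product_bound)
    show "(\<lambda>(x, s). eta x s * g s * c x) \<in> borel_measurable (gauss \<Otimes>\<^sub>M \<mu>)" by measurable
    show "integrable gauss (\<lambda>x. 1 + x\<^sup>2)" by (rule gauss_one_plus_square)
    show "integrable \<mu> (\<lambda>s. C * (4 * B * (1 + \<bar>s\<bar>)))" by (intro integrable_mult_right integrable_linear)
    have "\<bar>eta x s * g s * c x\<bar> \<le> ((1 + x\<^sup>2) * (4 * B * (1 + \<bar>s\<bar>))) * C" for x s
      unfolding abs_mult[of "eta x s * g s"] using eta_g_bound[of x s] c[of x] B_nonneg by (intro mult_mono) auto
    then show "\<bar>case (x, s) of (x, s) \<Rightarrow> eta x s * g s * c x\<bar> \<le> (1 + x\<^sup>2) * (C * (4 * B * (1 + \<bar>s\<bar>)))" for x s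
      by (simp add: mult_ac)
  qed
  have "(\<integral>x. eta_inner g x * c x \<partial>gauss) = (\<integral>x. (\<integral>s. eta x s * g s * c x \<partial>\<mu>) \<partial>gauss)"
    by (simp add: eta_inner_def L2_inner_def)
  also have "\<dots> = (\<integral>s. (\<integral>x. eta x s * g s * c x \<partial>gauss) \<partial>\<mu>)"
    using gauss_\<mu>.Fubini_integral[OF i] ..
  also have "\<dots> = (\<integral>s. zeta c s * g s \<partial>\<mu>)"
    by (intro Bochner_Integration.integral_cong refl)
      (simp add: zeta_eq mult.assoc mult.left_commute[of _ "g _"] mult.commute[of _ "g _"])
  finally show ?thesis by (simp add: L2_inner_def)
qed

text \<open>The case \<open>c = 1\<close> of \<open>eta_inner_zeta\<close>, where
  \<open>zeta\<close> vanishes since \<open>eta\<close> is centred.\<close>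

lemma eta_inner_centred: "(\<integral>x. eta_inner g x \<partial>gauss) = 0"
proof -
  have "zeta (\<lambda>x. 1) s = 0" for s by (simp add: zeta_eq eta_centred)
  then show ?thesis using eta_inner_zeta[of "\<lambda>x. 1" 1] by (simp add: L2_inner_def)
qed

text \<open>Identifies the variance of the limit theorem with the covariance form assumed of
  \<open>Z\<close>. The square is opened one factor at a time, by two applications of Fubini, until
  \<open>eta_covariance\<close> applies pointwise.\<close>

lemma eta_inner_variance:
  "(\<integral>x. (eta_inner g x)\<^sup>2 \<partial>gauss) = (\<integral>s. (\<integral>t. kernel_K2 phi_powers s t * g s * g t \<partial>\<mu>) \<partial>\<mu>)"
proof -
  define \<Omega> where "\<Omega> = (\<integral>s. 1 + \<bar>s\<bar> \<partial>\<mu>)"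
  have \<Omega>: "0 \<le> \<Omega>" unfolding \<Omega>_def by (rule integral_nonneg_AE) auto
  have i: "integrable (gauss \<Otimes>\<^sub>M \<mu>) (\<lambda>(x, s). eta x s * g s * eta_inner g x)"
  proof (rule gauss_\<mu>.integrable_product_bound)
    show "(\<lambda>(x, s). eta x s * g s * eta_inner g x) \<in> borel_measurable (gauss \<Otimes>\<^sub>M \<mu>)" by measurable
    show "integrable gauss (\<lambda>x. (1 + x\<^sup>2)\<^sup>2)" by (rule gauss_one_plus_square)
    show "integrable \<mu> (\<lambda>s. (4 * B * \<Omega>) * (4 * B * (1 + \<bar>s\<bar>)))" by (intro integrable_mult_right integrable_linear)
    have bd: "\<bar>eta x s * g s * eta_inner g x\<bar> \<le> ((1 + x\<^sup>2) * (4 * B * (1 + \<bar>s\<bar>))) * ((1 + x\<^sup>2) * (4 * B * \<Omega>))" for x s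
      unfolding abs_mult[of "eta x s * g s"] using eta_g_bound[of x s] eta_inner_bound[of x, folded \<Omega>_def] B_nonneg
      by (intro mult_mono) auto
    show "\<bar>case (x, s) of (x, s) \<Rightarrow> eta x s * g s * eta_inner g x\<bar>
        \<le> (1 + x\<^sup>2)\<^sup>2 * ((4 * B * \<Omega>) * (4 * B * (1 + \<bar>s\<bar>)))" for x s
      using bd[of x s] by (simp add: power2_eq_square algebra_simps)
  qed
  have j: "integrable (gauss \<Otimes>\<^sub>M \<mu>) (\<lambda>(x, t). eta x s * g s * (eta x t * g t))" for s
  proof (rule gauss_\<mu>.integrable_product_bound)
    show "(\<lambda>(x, t). eta x s * g s * (eta x t * g t)) \<in> borel_measurable (gauss \<Otimes>\<^sub>M \<mu>)" by measurable
    show "integrable gauss (\<lambda>x. (1 + x\<^sup>2)\<^sup>2)" by (rule gauss_one_plus_square)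
    show "integrable \<mu> (\<lambda>t. (4 * B * (1 + \<bar>s\<bar>)) * (4 * B * (1 + \<bar>t\<bar>)))" by (intro integrable_mult_right integrable_linear)
    have bd: "\<bar>eta x s * g s * (eta x t * g t)\<bar> \<le> ((1 + x\<^sup>2) * (4 * B * (1 + \<bar>s\<bar>))) * ((1 + x\<^sup>2) * (4 * B * (1 + \<bar>t\<bar>)))" for x t
      unfolding abs_mult[of "eta x s * g s"] using eta_g_bound[of x s] eta_g_bound[of x t] B_nonneg
      by (intro mult_mono) auto
    show "\<bar>case (x, t) of (x, t) \<Rightarrow> eta x s * g s * (eta x t * g t)\<bar>
        \<le> (1 + x\<^sup>2)\<^sup>2 * ((4 * B * (1 + \<bar>s\<bar>)) * (4 * B * (1 + \<bar>t\<bar>)))" for x t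
      using bd[of x t] by (simp add: power2_eq_square algebra_simps)
  qed
  have inner: "(\<integral>x. eta x s * g s * eta_inner g x \<partial>gauss) = (\<integral>t. kernel_K2 phi_powers s t * g s * g t \<partial>\<mu>)" for s
  proof -
    have "(\<integral>x. eta x s * g s * eta_inner g x \<partial>gauss) = (\<integral>x. (\<integral>t. eta x s * g s * (eta x t * g t) \<partial>\<mu>) \<partial>gauss)"
      by (simp add: eta_inner_def L2_inner_def)
    also have "\<dots> = (\<integral>t. (\<integral>x. eta x s * g s * (eta x t * g t) \<partial>gauss) \<partial>\<mu>)"
      using gauss_\<mu>.Fubini_integral[OF j] ..
    also have "\<dots> = (\<integral>t. kernel_K2 phi_powers s t * g s * g t \<partial>\<mu>)"
    proof (intro Bochner_Integration.integral_cong refl)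
      fix t
      have "(\<integral>x. eta x s * g s * (eta x t * g t) \<partial>gauss) = (\<integral>x. (g s * g t) * (eta x s * eta x t) \<partial>gauss)"
        by (simp add: mult_ac)
      also have "\<dots> = (g s * g t) * (\<integral>x. eta x s * eta x t \<partial>gauss)"
        by (rule integral_mult_right_zero)
      finally show "(\<integral>x. eta x s * g s * (eta x t * g t) \<partial>gauss) = kernel_K2 phi_powers s t * g s * g t"
        by (simp add: eta_covariance(2) mult_ac)
    qed
    finally show ?thesis .
  qed
  have "(\<integral>x. (eta_inner g x)\<^sup>2 \<partial>gauss) = (\<integral>x. (\<integral>s. eta x s * g s * eta_inner g x \<partial>\<mu>) \<partial>gauss)"
    by (simp add: eta_inner_def L2_inner_def power2_eq_square)
  also have "\<dots> = (\<integral>s. (\<integral>x. eta x s * g s * eta_inner g x \<partial>gauss) \<partial>\<mu>)"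
    using gauss_\<mu>.Fubini_integral[OF i] ..
  finally show ?thesis by (simp only: inner)
qed

end

text \<open>The projection acts on the variable \<open>s\<close> with \<open>x\<close> fixed; by
  linearity the normalised sum of the residuals is the projection error of the whole
  process.\<close>

definition eta_resid :: "nat \<Rightarrow> real \<Rightarrow> real \<Rightarrow> real" where
  "eta_resid m s x = eta x s - step_proj \<mu> m (eta x) s"

lemma eta_resid_alt:
  "eta_resid m s x = eta x s - (\<Sum>i\<in>step_cells m. eta_inner (indicator (cell m i)) x / measure \<mu> (cell m i) * indicator (cell m i) s)"
  by (simp add: eta_resid_def step_proj_def eta_inner_def)

lemma eta_inner_cell:
  "eta_inner (indicator (cell m i)) \<in> borel_measurable borel"
  "integrable gauss (eta_inner (indicator (cell m i)))"
  "(\<integral>x. eta_inner (indicator (cell m i)) x \<partial>gauss) = 0"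
  "\<bar>eta_inner (indicator (cell m i)) x\<bar> \<le> (1 + x\<^sup>2) * (4 * 1 * (\<integral>s. 1 + \<bar>s\<bar> \<partial>\<mu>))"
proof -
  have m: "indicator (cell m i) \<in> borel_measurable borel" "\<bar>indicator (cell m i) s\<bar> \<le> (1::real)" for s
    by (auto simp: indicator_def)
  show "eta_inner (indicator (cell m i)) \<in> borel_measurable borel"
    "integrable gauss (eta_inner (indicator (cell m i)))"
    "(\<integral>x. eta_inner (indicator (cell m i)) x \<partial>gauss) = 0"
    "\<bar>eta_inner (indicator (cell m i)) x\<bar> \<le> (1 + x\<^sup>2) * (4 * 1 * (\<integral>s. 1 + \<bar>s\<bar> \<partial>\<mu>))"
    using eta_inner_measurable[OF m] eta_inner_integrable[OF m] eta_inner_centred[OF m] eta_inner_bound[OF m]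
    by blast+
qed

lemma eta_resid_measurable [measurable]: "(\<lambda>(x, s). eta_resid m s x) \<in> borel_measurable (borel \<Otimes>\<^sub>M borel)"
  unfolding eta_resid_alt using eta_inner_cell(1)[measurable] by measurable

text \<open>The constant may depend on \<open>m\<close>: the bound secures integrability only, while
  the size of the residual is measured by \<open>proj_error\<close>.\<close>

lemma eta_resid_bound: "\<exists>c. \<forall>x s. \<bar>eta_resid m s x\<bar> \<le> (1 + x\<^sup>2) * (c * (1 + \<bar>s\<bar>))"
proof -
  define D where "D = (\<Sum>i\<in>step_cells m. 4 * 1 * (\<integral>s. 1 + \<bar>s\<bar> \<partial>\<mu>) / measure \<mu> (cell m i))"
  have \<Omega>: "0 \<le> (\<integral>s. 1 + \<bar>s\<bar> \<partial>\<mu>)" by (rule integral_nonneg_AE) auto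
  then have D0: "0 \<le> D" unfolding D_def by (intro sum_nonneg) auto
  have "\<bar>eta_resid m s x\<bar> \<le> (1 + x\<^sup>2) * ((4 + D) * (1 + \<bar>s\<bar>))" for x s
  proof -
    have "\<bar>\<Sum>i\<in>step_cells m. eta_inner (indicator (cell m i)) x / measure \<mu> (cell m i) * indicator (cell m i) s\<bar>
        \<le> (\<Sum>i\<in>step_cells m. (1 + x\<^sup>2) * (4 * 1 * (\<integral>s. 1 + \<bar>s\<bar> \<partial>\<mu>)) / measure \<mu> (cell m i) * 1)"
      unfolding abs_mult abs_divide
      by (rule order_trans[OF sum_abs])
        (auto simp: abs_mult abs_divide indicator_def intro!: sum_mono divide_right_mono eta_inner_cell(4)[unfolded mult_1_right] \<Omega>
          intro: divide_nonneg_nonneg)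
    also have "\<dots> = (1 + x\<^sup>2) * D" by (simp add: D_def sum_distrib_left)
    also have "\<dots> \<le> (1 + x\<^sup>2) * (D * (1 + \<bar>s\<bar>))"
      using D0 mult_left_mono[of 1 "1 + \<bar>s\<bar>" D] by (intro mult_left_mono) auto
    finally have "\<bar>eta_resid m s x\<bar> \<le> 4 * (1 + x\<^sup>2) * (1 + \<bar>s\<bar>) + (1 + x\<^sup>2) * (D * (1 + \<bar>s\<bar>))"
      unfolding eta_resid_alt
      by (intro order_trans[OF abs_triangle_ineq4] add_mono eta_bound)
    then show ?thesis by (simp add: algebra_simps)
  qed
  then show ?thesis by blast
qed

lemma eta_resid_centred: "(\<integral>x. eta_resid m s x \<partial>gauss) = 0"
proof -
  have i: "integrable gauss (\<lambda>x. eta x s)"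
    by (rule gauss_square_bound(3)[of _ "4 * (1 + \<bar>s\<bar>)"]) (use eta_bound[of _ s] in \<open>auto simp: algebra_simps\<close>)
  have "(\<integral>x. (\<Sum>i\<in>step_cells m. eta_inner (indicator (cell m i)) x / measure \<mu> (cell m i) * indicator (cell m i) s) \<partial>gauss)
      = (\<Sum>i\<in>step_cells m. \<integral>x. eta_inner (indicator (cell m i)) x / measure \<mu> (cell m i) * indicator (cell m i) s \<partial>gauss)"
    by (intro Bochner_Integration.integral_sum integrable_mult_left integrable_divide eta_inner_cell)
  then show ?thesis
    unfolding eta_resid_alt using i eta_inner_cell(2,3)
    by (subst Bochner_Integration.integral_diff)
      (auto simp: eta_centred intro!: Bochner_Integration.integrable_sum integrable_mult_left integrable_divide)
qed

text \<open>Taken under \<open>gauss\<close> and thus free of \<open>n\<close>; this is what makes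
  the projection error uniform along the rows.\<close>

definition proj_error :: "nat \<Rightarrow> real" where
  "proj_error m = (\<integral>x. (\<integral>s. (eta_resid m s x)\<^sup>2 \<partial>\<mu>) \<partial>gauss)"

text \<open>Pointwise in \<open>x\<close> by density of the step functions, with a majorant because
  a projection residual is no longer than the function itself.\<close>

lemma proj_error_tendsto: "proj_error \<longlonglongrightarrow> 0"
proof -
  define \<Omega> where "\<Omega> = (\<integral>s. 16 * (4 * (1 + s ^ 4)) \<partial>\<mu>)"
  have "(\<lambda>m. \<integral>x. (\<integral>s. (eta_resid m s x)\<^sup>2 \<partial>\<mu>) \<partial>gauss) \<longlonglongrightarrow> (\<integral>x. 0 \<partial>gauss)"
  proof (rule integral_dominated_convergence[where w = "\<lambda>x. (1 + x\<^sup>2)\<^sup>2 * \<Omega>"])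
    show "integrable gauss (\<lambda>x. (1 + x\<^sup>2)\<^sup>2 * \<Omega>)" by (intro integrable_mult_left gauss_one_plus_square)
    show "AE x in gauss. (\<lambda>m. \<integral>s. (eta_resid m s x)\<^sup>2 \<partial>\<mu>) \<longlonglongrightarrow> 0"
      using step_approximable_L2[OF eta_L2] by (simp add: step_approximable_def eta_resid_def)
    fix m
    show "(\<lambda>x. \<integral>s. (eta_resid m s x)\<^sup>2 \<partial>\<mu>) \<in> borel_measurable gauss"
      by (rule borel_measurable_lebesgue_integral) measurable
    show "AE x in gauss. norm (\<integral>s. (eta_resid m s x)\<^sup>2 \<partial>\<mu>) \<le> (1 + x\<^sup>2)\<^sup>2 * \<Omega>"
    proof (rule AE_I2)
      fix x
      have sq: "(eta x s)\<^sup>2 \<le> (1 + x\<^sup>2)\<^sup>2 * (16 * (4 * (1 + s ^ 4)))" for s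
      proof -
        have "(eta x s)\<^sup>2 \<le> (4 * (1 + x\<^sup>2) * (1 + \<bar>s\<bar>))\<^sup>2"
          using power_mono[OF eta_bound[of x s] abs_ge_zero, of 2] by simp
        also have "\<dots> = (1 + x\<^sup>2)\<^sup>2 * (16 * (1 + \<bar>s\<bar>)\<^sup>2)" by (simp only: power_mult_distrib) simp
        also have "\<dots> \<le> (1 + x\<^sup>2)\<^sup>2 * (16 * (4 * (1 + s ^ 4)))"
          by (intro mult_left_mono one_plus_abs_square) auto
        finally show ?thesis .
      qed
      have "(\<integral>s. (eta_resid m s x)\<^sup>2 \<partial>\<mu>) \<le> (\<integral>s. (eta x s)\<^sup>2 \<partial>\<mu>)"
        unfolding eta_resid_def dist_step_proj[OF eta_L2] step_norm2_def by (simp add: sum_nonneg)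
      also have "\<dots> \<le> (\<integral>s. (1 + x\<^sup>2)\<^sup>2 * (16 * (4 * (1 + s ^ 4))) \<partial>\<mu>)"
        by (intro integral_mono L2_spaceD(2)[OF eta_L2] integrable_mult_right integrable_fourth sq)
      also have "\<dots> = (1 + x\<^sup>2)\<^sup>2 * \<Omega>"
        unfolding \<Omega>_def by (rule integral_mult_right_zero)
      finally show "norm (\<integral>s. (eta_resid m s x)\<^sup>2 \<partial>\<mu>) \<le> (1 + x\<^sup>2)\<^sup>2 * \<Omega>" by simp
    qed
  qed simp
  then show ?thesis by (simp add: proj_error_def[abs_def])
qed

end

section \<open>Second moment bounds along the rows\<close>

lemma exp_neg_lipschitz:
  fixes x y :: real
  assumes "0 \<le> x" "0 \<le> y"
  shows "\<bar>exp (- x) - exp (- y)\<bar> \<le> \<bar>x - y\<bar>"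
proof -
  have le: "\<bar>exp (- x) - exp (- y)\<bar> \<le> \<bar>x - y\<bar>" if "0 \<le> x" "x \<le> y" for x y :: real
  proof -
    have "exp (- x) - exp (- y) = exp (- x) * (1 - exp (- (y - x)))"
      by (simp add: algebra_simps flip: exp_add)
    also have "\<dots> \<le> 1 * (y - x)"
    proof (intro mult_mono)
      show "1 - exp (- (y - x)) \<le> y - x" using exp_ge_add_one_self[of "- (y - x)"] by linarith
    qed (use that in auto)
    finally show ?thesis using that by simp
  qed
  show ?thesis
    using le[of x y] le[of y x] assms by (cases "x \<le> y") (auto simp: abs_minus_commute)
qed

lemma integrable_lborel_inverse_square: "integrable lborel (\<lambda>v::real. 1 / (1 + v\<^sup>2))"
proof -
  have "einterval (-\<infinity>) \<infinity> = (UNIV :: real set)" by (auto simp: einterval_def)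
  then show ?thesis
    using integrable_inverse_1_plus_square by (simp add: set_integrable_def inverse_eq_divide)
qed

text \<open>A centred Gaussian law is determined by its second moment, in the degenerate case too:
  there the mean condition forces the point mass to 0.\<close>

lemma gaussian_law_char:
  assumes N: "prob_space N" and Y [measurable]: "Y \<in> borel_measurable N"
    and law: "gaussian_law (distr N borel Y)" and mean: "(\<integral>w. Y w \<partial>N) = 0"
  shows "(\<integral>w. iexp (Y w) \<partial>N) = complex_of_real (exp (- ((\<integral>w. (Y w)\<^sup>2 \<partial>N) / 2)))"
proof -
  have d: "(\<integral>w. f (Y w) \<partial>N) = (\<integral>y. f y \<partial>distr N borel Y)"
    if "f \<in> borel_measurable borel" for f :: "real \<Rightarrow> 'z::{banach, second_countable_topology}"
    using that by (simp add: integral_distr)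
  have mean': "(\<integral>y. y \<partial>distr N borel Y) = 0" using mean d[of "\<lambda>y. y"] by simp
  show ?thesis
    using law unfolding gaussian_law_def
  proof (elim disjE exE conjE)
    fix m assume eq: "distr N borel Y = return borel m"
    have r: "(\<integral>w. f (Y w) \<partial>N) = f m" if "f \<in> borel_measurable borel"
      for f :: "real \<Rightarrow> 'z::{banach, second_countable_topology}"
      using d[OF that] that by (simp add: eq integral_return)
    have "m = 0" using r[of "\<lambda>y. y"] mean by simp
    then show ?thesis using r[of iexp] r[of "\<lambda>y. y\<^sup>2"] by simp
  next
    fix m \<sigma> :: real
    assume \<sigma>: "0 < \<sigma>" and eq: "distr N borel Y = density lborel (\<lambda>x. ennreal (normal_density m \<sigma> x))"
    have dens: "(\<integral>y. f y \<partial>distr N borel Y) = (\<integral>y. normal_density m \<sigma> y *\<^sub>R f y \<partial>lborel)"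
      if "f \<in> borel_measurable borel" for f :: "real \<Rightarrow> 'z::{banach, second_countable_topology}"
      unfolding eq using that by (subst integral_density) auto
    have m: "m = 0"
      using mean' integral_normal_moment_nz_1[OF \<sigma>, of m] by (simp add: dens)
    have v: "(\<integral>w. (Y w)\<^sup>2 \<partial>N) = \<sigma>\<^sup>2"
    proof -
      have "(\<integral>w. (Y w)\<^sup>2 \<partial>N) = (\<integral>y. y\<^sup>2 \<partial>distr N borel Y)" by (rule d) simp
      also have "\<dots> = (\<integral>y. normal_density m \<sigma> y *\<^sub>R y\<^sup>2 \<partial>lborel)" by (rule dens) simp
      finally show ?thesis using integral_normal_moment_even[OF \<sigma>, of 0 1] by (simp add: m fact_numeral)
    qed
    \<comment> \<open>\<open>Y\<close> has the law of \<open>\<sigma>\<close> times a standard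
      normal variable, which reduces its characteristic function to
      \<open>exp_neg_half_square\<close>.\<close>
    have "distributed gauss lborel (\<lambda>x. 0 + \<sigma> * x) (normal_density (0 + \<sigma> * 0) (\<bar>\<sigma>\<bar> * 1))"
      using \<sigma> by (intro gauss.normal_density_affine) (auto simp: distributed_def distr_id2)
    then have "distr gauss lborel (\<lambda>x. \<sigma> * x) = density lborel (\<lambda>x. ennreal (normal_density m \<sigma> x))"
      using \<sigma> by (simp add: distributed_def m)
    then have sc: "distr gauss borel (\<lambda>x. \<sigma> * x) = distr N borel Y"
      unfolding eq by (metis distr_cong sets_lborel)
    have "(\<integral>w. iexp (Y w) \<partial>N) = (\<integral>y. iexp y \<partial>distr gauss borel (\<lambda>x. \<sigma> * x))"
      unfolding sc by (rule d) simp
    also have "\<dots> = (\<integral>x. iexp (\<sigma> * x) \<partial>gauss)" by (subst integral_distr) auto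
    also have "\<dots> = complex_of_real (exp (- (\<sigma>\<^sup>2 / 2)))" by (simp only: exp_neg_half_square)
    finally show ?thesis by (simp only: v)
  qed
qed

context alternative_row
begin

definition moment_const :: real where
  "moment_const = 1 + C + C\<^sup>2"

lemma moment_const_nonneg: "0 \<le> moment_const"
  using C_nonneg by (simp add: moment_const_def)

lemma normsum_joint_measurable:
  assumes f: "(\<lambda>(x, v). f v x) \<in> borel_measurable (borel \<Otimes>\<^sub>M \<nu>)"
  shows "(\<lambda>(w, v). normsum n (f v) (\<lambda>k. X k w)) \<in> borel_measurable (M \<Otimes>\<^sub>M \<nu>)"
proof -
  have "(\<lambda>z. f (snd z) (X j (fst z))) \<in> borel_measurable (M \<Otimes>\<^sub>M \<nu>)" if j: "j \<in> {1..n}" for j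
  proof -
    have "(\<lambda>z. (X j (fst z), snd z)) \<in> M \<Otimes>\<^sub>M \<nu> \<rightarrow>\<^sub>M borel \<Otimes>\<^sub>M \<nu>" using j by measurable
    from measurable_compose[OF this f] show ?thesis by simp
  qed
  then show ?thesis
    unfolding normsum_def split_beta' by (intro borel_measurable_divide borel_measurable_sum) auto
qed

text \<open>Tonelli turns second moments at each fixed parameter \<open>v\<close> into a bound for
  the integral over all \<open>v\<close> at once; no supremum over thresholds is involved.
  Nonnegative integrals are used since finiteness is part of what is being proved.\<close>

lemma nn_integral_normsum_square:
  fixes f :: "'v \<Rightarrow> real \<Rightarrow> real"
  assumes \<nu>: "sigma_finite_measure \<nu>"
    and f: "(\<lambda>(x, v). f v x) \<in> borel_measurable (borel \<Otimes>\<^sub>M \<nu>)" and fv: "\<And>v. f v \<in> borel_measurable borel"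
    and q [measurable]: "q \<in> borel_measurable \<nu>" and q0: "\<And>v. 0 \<le> q v"
    and bd: "\<And>v x. \<bar>f v x\<bar> \<le> (1 + x\<^sup>2) * g v"
    and f0: "\<And>v. (\<integral>x. f v x \<partial>gauss) = 0"
  shows "(\<integral>\<^sup>+w. (\<integral>\<^sup>+v. ennreal (q v * (normsum n (f v) (\<lambda>k. X k w))\<^sup>2) \<partial>\<nu>) \<partial>M)
    \<le> (\<integral>\<^sup>+v. ennreal (moment_const * (q v * (\<integral>x. (f v x)\<^sup>2 \<partial>gauss))) \<partial>\<nu>)"
proof -
  interpret P: pair_sigma_finite M \<nu>
    using \<nu> by (simp add: pair_sigma_finite_def sigma_finite_measure_axioms)
  have m: "(\<lambda>(w, v). ennreal (q v * (normsum n (f v) (\<lambda>k. X k w))\<^sup>2)) \<in> borel_measurable (M \<Otimes>\<^sub>M \<nu>)"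
    using normsum_joint_measurable[OF f] unfolding split_beta' by measurable
  have "(\<integral>\<^sup>+w. ennreal (q v * (normsum n (f v) (\<lambda>k. X k w))\<^sup>2) \<partial>M)
      \<le> ennreal (moment_const * (q v * (\<integral>x. (f v x)\<^sup>2 \<partial>gauss)))" for v
  proof -
    note sm = normsum_second_moment[OF fv gauss_square_bound(1)[OF fv bd] f0, of v]
    have "(\<integral>\<^sup>+w. ennreal (q v * (normsum n (f v) (\<lambda>k. X k w))\<^sup>2) \<partial>M)
        = ennreal (\<integral>w. q v * (normsum n (f v) (\<lambda>k. X k w))\<^sup>2 \<partial>M)"
      using sm(1) q0[of v] by (intro nn_integral_eq_integral) auto
    also have "\<dots> \<le> ennreal (moment_const * (q v * (\<integral>x. (f v x)\<^sup>2 \<partial>gauss)))"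
      using mult_left_mono[OF sm(2) q0[of v]] by (intro ennreal_leI) (simp add: moment_const_def mult_ac)
    finally show ?thesis .
  qed
  then have "(\<integral>\<^sup>+v. (\<integral>\<^sup>+w. ennreal (q v * (normsum n (f v) (\<lambda>k. X k w))\<^sup>2) \<partial>M) \<partial>\<nu>)
    \<le> (\<integral>\<^sup>+v. ennreal (moment_const * (q v * (\<integral>x. (f v x)\<^sup>2 \<partial>gauss))) \<partial>\<nu>)"
    by (intro nn_integral_mono)
  then show ?thesis using P.Fubini'[OF m] by simp
qed

lemma normsum_square_nn_integral_measurable:
  fixes \<nu> :: "real measure"
  assumes f: "(\<lambda>(x, s). f s x) \<in> borel_measurable (borel \<Otimes>\<^sub>M borel)" and q: "q \<in> borel_measurable borel"
    and \<nu>: "sigma_finite_measure \<nu>" "sets \<nu> = sets borel"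
  shows "(\<lambda>w. \<integral>\<^sup>+s. ennreal (q s * (normsum n (f s) (\<lambda>k. X k w))\<^sup>2) \<partial>\<nu>) \<in> borel_measurable M"
proof (rule sigma_finite_measure.borel_measurable_nn_integral[OF \<nu>(1)])
  have "(\<lambda>(x, s). f s x) \<in> borel_measurable (borel \<Otimes>\<^sub>M \<nu>)"
    using f measurable_cong_sets[OF sets_pair_measure_cong[OF refl \<nu>(2)] refl] by blast
  note [measurable] = normsum_joint_measurable[OF this]
  have [measurable]: "q \<in> borel_measurable \<nu>" using q measurable_cong_sets[OF \<nu>(2) refl] by blast
  show "(\<lambda>(w, s). ennreal (q s * (normsum n (f s) (\<lambda>k. X k w))\<^sup>2)) \<in> borel_measurable (M \<Otimes>\<^sub>M \<nu>)"
    by measurable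
qed

end

section \<open>Growth, centring and measurability of the three summand families\<close>

lemma quad_part_bound: "\<bar>quad_part s x\<bar> \<le> (1 + x\<^sup>2) * (2 * (1 + \<bar>s\<bar>))"
proof -
  have "\<bar>x * (x - s)\<bar> \<le> x\<^sup>2 + \<bar>x\<bar> * \<bar>s\<bar>"
    using abs_triangle_ineq4[of "x * x" "x * s"] by (simp add: power2_eq_square algebra_simps abs_mult)
  also have "\<dots> \<le> (1 + x\<^sup>2) + (1 + x\<^sup>2) * \<bar>s\<bar>"
    using abs_le_one_plus_square[of x] by (intro add_mono mult_right_mono) auto
  finally have "\<bar>x * (x - s) * indicator {..s} x\<bar> \<le> (1 + x\<^sup>2) * (1 + \<bar>s\<bar>)"
    by (auto simp: indicator_def algebra_simps)
  moreover have "\<bar>Phi s\<bar> \<le> (1 + x\<^sup>2) * (1 + \<bar>s\<bar>)"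
    using Phi_bounds[of s] mult_mono[of 1 "1 + x\<^sup>2" 1 "1 + \<bar>s\<bar>"] by auto
  ultimately show ?thesis
    unfolding quad_part_def using abs_triangle_ineq4[of "x * (x - s) * indicator {..s} x" "Phi s"] by linarith
qed

lemma lin_part_bound: "\<bar>lin_part s x\<bar> \<le> (1 + x\<^sup>2) * (2 * (1 + \<bar>s\<bar>))"
proof -
  have a: "\<bar>(x - s) * indicator {..s} x\<bar> \<le> \<bar>x\<bar> + \<bar>s\<bar>" by (auto simp: indicator_def)
  have b: "\<bar>s * Phi s\<bar> \<le> \<bar>s\<bar> * 1"
    unfolding abs_mult using Phi_bounds[of s] by (intro mult_left_mono) auto
  have c: "\<bar>phi s\<bar> \<le> 1" using phi_le_1[of s] by simp
  have "\<bar>lin_part s x\<bar> \<le> \<bar>(x - s) * indicator {..s} x\<bar> + \<bar>phi s\<bar> + \<bar>s * Phi s\<bar>"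
    unfolding lin_part_def by linarith
  also have "\<dots> \<le> (1 + x\<^sup>2) + 1 + 2 * \<bar>s\<bar>"
    using a b c abs_le_one_plus_square[of x] by linarith
  also have "\<dots> \<le> (1 + x\<^sup>2) * (2 * (1 + \<bar>s\<bar>))"
    by (simp add: algebra_simps)
  finally show ?thesis .
qed

lemma slope_part_bound: "\<bar>slope_part v x\<bar> \<le> (1 + x\<^sup>2) * 2"
proof -
  have "\<bar>x * indicator {..v} x\<bar> \<le> \<bar>x\<bar>" by (auto simp: indicator_def)
  moreover have "\<bar>phi v\<bar> \<le> 1" using phi_le_1[of v] by simp
  ultimately have "\<bar>slope_part v x\<bar> \<le> (1 + x\<^sup>2) + 1"
    unfolding slope_part_def
    using abs_le_one_plus_square[of x] abs_triangle_ineq[of "x * indicator {..v} x" "phi v"] by linarith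
  also have "\<dots> \<le> (1 + x\<^sup>2) * 2" by simp
  finally show ?thesis .
qed

lemma quad_part_centred: "(\<integral>x. quad_part s x \<partial>gauss) = 0"
proof -
  have eq: "quad_part s x = poly4 0 (- s) 1 0 0 x * indicator {..s} x - poly4 (Phi s) 0 0 0 0 x" for x
    by (simp add: quad_part_def poly4_def algebra_simps power2_eq_square)
  show ?thesis
    unfolding eq by (subst Bochner_Integration.integral_diff[OF poly4_halfline_integral(1) poly4_integral(1)])
      (simp add: poly4_halfline_integral(2) poly4_integral(2) gmoment_simps)
qed

lemma lin_part_centred: "(\<integral>x. lin_part s x \<partial>gauss) = 0"
proof -
  have eq: "lin_part s x = poly4 (- s) 1 0 0 0 x * indicator {..s} x - poly4 (- (phi s + s * Phi s)) 0 0 0 0 x" for x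
    by (simp add: lin_part_def poly4_def algebra_simps)
  show ?thesis
    unfolding eq by (subst Bochner_Integration.integral_diff[OF poly4_halfline_integral(1) poly4_integral(1)])
      (simp add: poly4_halfline_integral(2) poly4_integral(2) gmoment_simps gmoment_0)
qed

lemma slope_part_centred: "(\<integral>x. slope_part v x \<partial>gauss) = 0"
proof -
  have eq: "slope_part v x = poly4 0 1 0 0 0 x * indicator {..v} x - poly4 (- phi v) 0 0 0 0 x" for x
    by (simp add: slope_part_def poly4_def)
  show ?thesis
    unfolding eq by (subst Bochner_Integration.integral_diff[OF poly4_halfline_integral(1) poly4_integral(1)])
      (simp add: poly4_halfline_integral(2) poly4_integral(2) gmoment_simps)
qed

lemma quad_part_measurable [measurable]: "(\<lambda>(x, s). quad_part s x) \<in> borel_measurable (borel \<Otimes>\<^sub>M borel)"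
proof -
  have "(\<lambda>(x, s). quad_part s x) = (\<lambda>z. fst z * (fst z - snd z) * (if fst z \<le> snd z then 1 else 0) - Phi (snd z))"
    by (auto simp: quad_part_def fun_eq_iff)
  then show ?thesis by simp
qed

lemma lin_part_measurable [measurable]: "(\<lambda>(x, s). lin_part s x) \<in> borel_measurable (borel \<Otimes>\<^sub>M borel)"
proof -
  have "(\<lambda>(x, s). lin_part s x) = (\<lambda>z. (fst z - snd z) * (if fst z \<le> snd z then 1 else 0) + phi (snd z) + snd z * Phi (snd z))"
    by (auto simp: lin_part_def fun_eq_iff)
  then show ?thesis by simp
qed

lemma measurable_section:
  assumes "(\<lambda>(x, s). f s x) \<in> borel_measurable (borel \<Otimes>\<^sub>M borel)"
  shows "f s \<in> borel_measurable borel" "(\<lambda>s. f s x) \<in> borel_measurable borel"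
  using measurable_compose[OF measurable_Pair2'[of s borel borel] assms]
    measurable_compose[OF measurable_Pair1'[of x borel borel] assms] by simp_all

context weight
begin

text \<open>A bound on \<open>total_dev n x\<close> is all that the linearisation needs to know about the sample \<open>x\<close>.
  The factors 1 make the integrals instances of \<open>nn_integral_normsum_square\<close>.\<close>

definition total_dev :: "nat \<Rightarrow> (nat \<Rightarrow> real) \<Rightarrow> ennreal" where
  "total_dev n x = ennreal ((normsum n (\<lambda>y. y) x)\<^sup>2) + ennreal ((normsum n (\<lambda>y. y\<^sup>2 - 1) x)\<^sup>2)
    + (\<integral>\<^sup>+v. ennreal (1 / (1 + v\<^sup>2) * (normsum n (slope_part v) x)\<^sup>2) \<partial>lborel)
    + (\<integral>\<^sup>+s. ennreal (1 * (normsum n (quad_part s) x)\<^sup>2) \<partial>\<mu>)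
    + (\<integral>\<^sup>+s. ennreal (1 * (normsum n (lin_part s) x)\<^sup>2) \<partial>\<mu>)
    + (\<integral>\<^sup>+s. ennreal (1 * (normsum n (\<lambda>y. eta y s) x)\<^sup>2) \<partial>\<mu>)"

lemma nn_integral_linear_growth_finite:
  assumes f: "\<And>s. f s \<in> borel_measurable borel" and bd: "\<And>s x. \<bar>f s x\<bar> \<le> (1 + x\<^sup>2) * (c * (1 + \<bar>s\<bar>))" and k: "0 \<le> k"
  shows "(\<integral>\<^sup>+s. ennreal (k * (1 * (\<integral>x. (f s x)\<^sup>2 \<partial>gauss))) \<partial>\<mu>) \<le> ennreal (\<integral>s. k * (6 * (c\<^sup>2 * (4 * (1 + s ^ 4)))) \<partial>\<mu>)"
proof -
  have "k * (1 * (\<integral>x. (f s x)\<^sup>2 \<partial>gauss)) \<le> k * (6 * (c\<^sup>2 * (4 * (1 + s ^ 4))))" for s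
  proof -
    have "(\<integral>x. (f s x)\<^sup>2 \<partial>gauss) \<le> 6 * (c * (1 + \<bar>s\<bar>))\<^sup>2" by (rule gauss_square_bound(2)[OF f bd])
    also have "\<dots> \<le> 6 * (c\<^sup>2 * (4 * (1 + s ^ 4)))"
      unfolding power_mult_distrib by (intro mult_left_mono one_plus_abs_square) auto
    finally show ?thesis using k by (simp add: mult_left_mono)
  qed
  then have "(\<integral>\<^sup>+s. ennreal (k * (1 * (\<integral>x. (f s x)\<^sup>2 \<partial>gauss))) \<partial>\<mu>)
      \<le> (\<integral>\<^sup>+s. ennreal (k * (6 * (c\<^sup>2 * (4 * (1 + s ^ 4))))) \<partial>\<mu>)"
    by (intro nn_integral_mono ennreal_leI)
  also have "\<dots> = ennreal (\<integral>s. k * (6 * (c\<^sup>2 * (4 * (1 + s ^ 4)))) \<partial>\<mu>)"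
    using k by (intro nn_integral_eq_integral integrable_mult_right integrable_fourth) auto
  finally show ?thesis .
qed

lemma total_dev_terms_measurable:
  assumes "alternative_row M c C n X"
  shows "(\<lambda>w. ennreal ((normsum n (\<lambda>y. y) (\<lambda>k. X k w))\<^sup>2)) \<in> borel_measurable M"
    "(\<lambda>w. ennreal ((normsum n (\<lambda>y. y\<^sup>2 - 1) (\<lambda>k. X k w))\<^sup>2)) \<in> borel_measurable M"
    "(\<lambda>w. \<integral>\<^sup>+v. ennreal (1 / (1 + v\<^sup>2) * (normsum n (slope_part v) (\<lambda>k. X k w))\<^sup>2) \<partial>lborel) \<in> borel_measurable M"
    "(\<lambda>w. \<integral>\<^sup>+s. ennreal (1 * (normsum n (quad_part s) (\<lambda>k. X k w))\<^sup>2) \<partial>\<mu>) \<in> borel_measurable M"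
    "(\<lambda>w. \<integral>\<^sup>+s. ennreal (1 * (normsum n (lin_part s) (\<lambda>k. X k w))\<^sup>2) \<partial>\<mu>) \<in> borel_measurable M"
    "(\<lambda>w. \<integral>\<^sup>+s. ennreal (1 * (normsum n (\<lambda>y. eta y s) (\<lambda>k. X k w))\<^sup>2) \<partial>\<mu>) \<in> borel_measurable M"
proof -
  interpret R: alternative_row M c C n X by fact
  show "(\<lambda>w. ennreal ((normsum n (\<lambda>y. y) (\<lambda>k. X k w))\<^sup>2)) \<in> borel_measurable M"
    "(\<lambda>w. ennreal ((normsum n (\<lambda>y. y\<^sup>2 - 1) (\<lambda>k. X k w))\<^sup>2)) \<in> borel_measurable M"
    "(\<lambda>w. \<integral>\<^sup>+v. ennreal (1 / (1 + v\<^sup>2) * (normsum n (slope_part v) (\<lambda>k. X k w))\<^sup>2) \<partial>lborel) \<in> borel_measurable M"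
    "(\<lambda>w. \<integral>\<^sup>+s. ennreal (1 * (normsum n (quad_part s) (\<lambda>k. X k w))\<^sup>2) \<partial>\<mu>) \<in> borel_measurable M"
    "(\<lambda>w. \<integral>\<^sup>+s. ennreal (1 * (normsum n (lin_part s) (\<lambda>k. X k w))\<^sup>2) \<partial>\<mu>) \<in> borel_measurable M"
    "(\<lambda>w. \<integral>\<^sup>+s. ennreal (1 * (normsum n (\<lambda>y. eta y s) (\<lambda>k. X k w))\<^sup>2) \<partial>\<mu>) \<in> borel_measurable M"
    by (rule measurable_compose[OF _ measurable_ennreal] borel_measurable_power R.normsum_measurable
        R.normsum_square_nn_integral_measurable quad_part_measurable lin_part_measurable slope_part_measurable eta_measurable
        | simp add: sigma_finite_lborel sigma_finite_measure_axioms sets_\<mu>)+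
qed

lemma total_dev_measurable:
  assumes "alternative_row M c C n X"
  shows "(\<lambda>w. total_dev n (\<lambda>k. X k w)) \<in> borel_measurable M"
  unfolding total_dev_def by (intro borel_measurable_add total_dev_terms_measurable[OF assms])

text \<open>The order of quantifiers matters: \<open>D\<close> depends on \<open>C\<close> and the
  weight but neither on \<open>n\<close> nor on the row, so one level \<open>K\<close> in Markov's
  inequality serves all rows. A negative \<open>C\<close> admits no row at all.\<close>

lemma total_dev_expectation:
  "\<exists>D::real. 0 \<le> D \<and> (\<forall>(M::'a measure) c n X. alternative_row M c C n X
    \<longrightarrow> (\<integral>\<^sup>+w. total_dev n (\<lambda>k. X k w) \<partial>M) \<le> ennreal D)"
proof (cases "0 \<le> C")
  case True
  define k where "k = 1 + C + C\<^sup>2"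
  have k: "0 \<le> k" using True by (simp add: k_def)
  define D0 where "D0 c = (\<integral>s. k * (6 * (c\<^sup>2 * (4 * (1 + s ^ 4)))) \<partial>\<mu>)" for c
  define D1 where "D1 = (\<integral>v. k * (1 / (1 + v\<^sup>2) * (6 * 2\<^sup>2)) \<partial>lborel)"
  have D0: "0 \<le> D0 c" for c unfolding D0_def using k by (intro integral_nonneg_AE) auto
  have D1: "0 \<le> D1" unfolding D1_def using k by (intro integral_nonneg_AE) auto
  have pos: "0 \<le> 1 / (1 + v\<^sup>2)" for v :: real by simp
  \<comment> \<open>1 and 2 are the Gaussian variances of \<open>y\<close> and
    \<open>y\<^sup>2 - 1\<close>; the arguments 2, 2, 4 of \<open>D0\<close> are the constants in
    \<open>quad_part_bound\<close>, \<open>lin_part_bound\<close> and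
    \<open>eta_bound\<close>.\<close>
  define D where "D = k * 1 + k * 2 + D1 + D0 2 + D0 2 + D0 4"
  have "(\<integral>\<^sup>+w. total_dev n (\<lambda>k. X k w) \<partial>M) \<le> ennreal D" if "alternative_row M c C n X" for M :: "'a measure" and c n X
  proof -
    interpret R: alternative_row M c C n X by fact
    have mc: "R.moment_const = k" by (simp add: R.moment_const_def k_def)
    note sec = measurable_section
    have e1: "(\<integral>\<^sup>+w. ennreal ((normsum n (\<lambda>y. y) (\<lambda>k. X k w))\<^sup>2) \<partial>M) \<le> ennreal (k * 1)"
    proof -
      have i: "integrable gauss (\<lambda>y. y\<^sup>2)" using gauss_power_integrable[of 2] .
      note sm = R.normsum_second_moment[OF _ i gauss_moments(1)]
      show ?thesis using sm gauss_moments(2)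
        by (subst nn_integral_eq_integral) (auto simp: k_def intro!: ennreal_leI)
    qed
    have e2: "(\<integral>\<^sup>+w. ennreal ((normsum n (\<lambda>y. y\<^sup>2 - 1) (\<lambda>k. X k w))\<^sup>2) \<partial>M) \<le> ennreal (k * 2)"
    proof -
      have eq: "(y\<^sup>2 - 1)\<^sup>2 = poly4 1 0 (- 2) 0 1 y" "y\<^sup>2 - 1 = poly4 (- 1) 0 1 0 0 y" for y :: real
        by (simp_all add: poly4_def power2_diff flip: power_mult)
      have i: "integrable gauss (\<lambda>y. (y\<^sup>2 - 1)\<^sup>2)" unfolding eq(1) by (rule poly4_integral(1))
      have z: "(\<integral>y. y\<^sup>2 - 1 \<partial>gauss) = 0" unfolding eq(2) poly4_integral(2) by simp
      have v: "(\<integral>y. (y\<^sup>2 - 1)\<^sup>2 \<partial>gauss) = 2" unfolding eq(1) poly4_integral(2) by simp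
      note sm = R.normsum_second_moment[OF _ i z]
      show ?thesis using sm v
        by (subst nn_integral_eq_integral) (auto simp: k_def intro!: ennreal_leI)
    qed
    have e3: "(\<integral>\<^sup>+w. (\<integral>\<^sup>+v. ennreal (1 / (1 + v\<^sup>2) * (normsum n (slope_part v) (\<lambda>k. X k w))\<^sup>2) \<partial>lborel) \<partial>M) \<le> ennreal D1"
    proof -
      have "(\<integral>\<^sup>+w. (\<integral>\<^sup>+v. ennreal (1 / (1 + v\<^sup>2) * (normsum n (slope_part v) (\<lambda>k. X k w))\<^sup>2) \<partial>lborel) \<partial>M)
          \<le> (\<integral>\<^sup>+v. ennreal (k * (1 / (1 + v\<^sup>2) * (\<integral>x. (slope_part v x)\<^sup>2 \<partial>gauss))) \<partial>lborel)"
        unfolding mc[symmetric]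
        by (rule R.nn_integral_normsum_square[OF _ _ sec(1)[OF slope_part_measurable] _ pos slope_part_bound slope_part_centred])
          (auto intro: sigma_finite_lborel)
      also have "\<dots> \<le> (\<integral>\<^sup>+v. ennreal (k * (1 / (1 + v\<^sup>2) * (6 * 2\<^sup>2))) \<partial>lborel)"
        by (intro nn_integral_mono ennreal_leI mult_left_mono k pos
            gauss_square_bound(2)[OF sec(1)[OF slope_part_measurable] slope_part_bound])
      also have "\<dots> = ennreal D1"
        unfolding D1_def using k pos
        by (intro nn_integral_eq_integral integrable_mult_right integrable_mult_left integrable_lborel_inverse_square) auto
      finally show ?thesis .
    qed
    have e: "(\<integral>\<^sup>+w. (\<integral>\<^sup>+s. ennreal (1 * (normsum n (f s) (\<lambda>k. X k w))\<^sup>2) \<partial>\<mu>) \<partial>M) \<le> ennreal (D0 a)"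
      if f: "(\<lambda>(x, s). f s x) \<in> borel_measurable (borel \<Otimes>\<^sub>M borel)" and bd: "\<And>s x. \<bar>f s x\<bar> \<le> (1 + x\<^sup>2) * (a * (1 + \<bar>s\<bar>))"
        and f0: "\<And>s. (\<integral>x. f s x \<partial>gauss) = 0" for f a
    proof -
      have f': "(\<lambda>(x, s). f s x) \<in> borel_measurable (borel \<Otimes>\<^sub>M \<mu>)" using f by measurable
      have "(\<integral>\<^sup>+w. (\<integral>\<^sup>+s. ennreal (1 * (normsum n (f s) (\<lambda>k. X k w))\<^sup>2) \<partial>\<mu>) \<partial>M)
          \<le> (\<integral>\<^sup>+s. ennreal (k * (1 * (\<integral>x. (f s x)\<^sup>2 \<partial>gauss))) \<partial>\<mu>)"
        unfolding mc[symmetric]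
        by (rule R.nn_integral_normsum_square[OF _ f' sec(1)[OF f] _ _ bd f0]) (auto intro: sigma_finite_measure_axioms)
      also have "\<dots> \<le> ennreal (D0 a)"
        unfolding D0_def by (rule nn_integral_linear_growth_finite[OF sec(1)[OF f] bd k])
      finally show ?thesis .
    qed
    note m = total_dev_terms_measurable[OF that]
    have "(\<integral>\<^sup>+w. total_dev n (\<lambda>k. X k w) \<partial>M)
        \<le> ennreal (k * 1) + ennreal (k * 2) + ennreal D1 + ennreal (D0 2) + ennreal (D0 2) + ennreal (D0 4)"
      unfolding total_dev_def
      by (subst nn_integral_add nn_integral_add nn_integral_add nn_integral_add nn_integral_add; (intro borel_measurable_add m)?)+
        (intro add_mono e1 e2 e3 e quad_part_measurable quad_part_bound quad_part_centred lin_part_measurable lin_part_bound lin_part_centred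
          eta_measurable eta_centred, use eta_bound in \<open>auto simp: algebra_simps\<close>)
    also have "\<dots> = ennreal D"
      unfolding D_def using k D0 D1 by (simp add: ennreal_plus[symmetric] del: ennreal_plus)
    finally show ?thesis .
  qed
  moreover have "0 \<le> D" unfolding D_def using k D0 D1 by (intro add_nonneg_nonneg) auto
  ultimately show ?thesis by blast
next
  case False
  have "\<not> alternative_row M c C n X" for M :: "'a measure" and c n X
    using False alternative_row.C_nonneg by blast
  then show ?thesis by (intro exI[of _ 0]) auto
qed

end

section \<open>Comparison with the linearised process\<close>

lemma emp_process_joint_measurable:
  assumes X: "\<And>k. k \<in> {1..n} \<Longrightarrow> X k \<in> borel_measurable M"
  shows "(\<lambda>(w, t). emp_process n (\<lambda>k. X k w) t) \<in> borel_measurable (M \<Otimes>\<^sub>M borel)"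
proof -
  have [measurable]: "(\<lambda>z. X k (fst z)) \<in> borel_measurable (M \<Otimes>\<^sub>M borel)" if "k \<in> {1..n}" for k
    using measurable_compose[OF measurable_fst X[OF that]] .
  have mean [measurable]: "(\<lambda>z. sample_mean n (\<lambda>k. X k (fst z))) \<in> borel_measurable (M \<Otimes>\<^sub>M borel)"
    unfolding sample_mean_def by measurable
  have sd [measurable]: "(\<lambda>z. sample_sd n (\<lambda>k. X k (fst z))) \<in> borel_measurable (M \<Otimes>\<^sub>M borel)"
    unfolding sample_sd_def by measurable
  have r [measurable]: "(\<lambda>z. scaled_residual n (\<lambda>k. X k (fst z)) j) \<in> borel_measurable (M \<Otimes>\<^sub>M borel)" if "j \<in> {1..n}" for j
    unfolding scaled_residual_def using that by measurable
  have ind: "indicator {..t} y = (if y \<le> t then 1 else 0 :: real)" for t y :: real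
    by simp
  show ?thesis
    unfolding emp_process_def split_beta' ind by measurable
qed

lemma ennreal_sum6_leD:
  fixes p1 p2 p3 p4 p5 p6 K :: ennreal
  assumes "p1 + p2 + p3 + p4 + p5 + p6 \<le> K"
  shows "p1 \<le> K" "p2 \<le> K" "p3 \<le> K" "p4 \<le> K" "p5 \<le> K" "p6 \<le> K"
proof -
  have "p1 \<le> p1 + p2 + p3 + p4 + p5 + p6" "p2 \<le> p1 + p2 + p3 + p4 + p5 + p6"
    "p3 \<le> p1 + p2 + p3 + p4 + p5 + p6" "p4 \<le> p1 + p2 + p3 + p4 + p5 + p6"
    "p5 \<le> p1 + p2 + p3 + p4 + p5 + p6" "p6 \<le> p1 + p2 + p3 + p4 + p5 + p6"
    unfolding le_iff_add
    by (rule exI[of _ "p2 + p3 + p4 + p5 + p6"], simp add: ac_simps)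
      (rule exI[of _ "p1 + p3 + p4 + p5 + p6"], simp add: ac_simps,
       rule exI[of _ "p1 + p2 + p4 + p5 + p6"], simp add: ac_simps,
       rule exI[of _ "p1 + p2 + p3 + p5 + p6"], simp add: ac_simps,
       rule exI[of _ "p1 + p2 + p3 + p4 + p6"], simp add: ac_simps,
       rule exI[of _ "p1 + p2 + p3 + p4 + p5"], simp add: ac_simps)
  then show "p1 \<le> K" "p2 \<le> K" "p3 \<le> K" "p4 \<le> K" "p5 \<le> K" "p6 \<le> K"
    using assms by (blast intro: order_trans)+
qed

text \<open>Expanding the square around \<open>W\<close> requires a bound on the norm of
  \<open>W\<close> alone.\<close>

lemma L2_square_integral_close:
  assumes V: "V \<in> L2_space M" and W: "W \<in> L2_space M"
    and d: "(\<integral>s. (V s - W s)\<^sup>2 \<partial>M) \<le> d" and K: "(\<integral>s. (W s)\<^sup>2 \<partial>M) \<le> K"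
  shows "\<bar>(\<integral>s. (V s)\<^sup>2 \<partial>M) - (\<integral>s. (W s)\<^sup>2 \<partial>M)\<bar> \<le> d + 2 * (sqrt K * sqrt d)"
proof -
  have D: "(\<lambda>s. V s - W s) \<in> L2_space M" by (rule L2_diff[OF V W])
  have "(V s)\<^sup>2 = (W s)\<^sup>2 + 2 * (W s * (V s - W s)) + (V s - W s)\<^sup>2" for s
    by (simp add: power2_eq_square algebra_simps)
  then have "(\<integral>s. (V s)\<^sup>2 \<partial>M) = (\<integral>s. (W s)\<^sup>2 \<partial>M) + 2 * L2_inner M W (\<lambda>s. V s - W s) + (\<integral>s. (V s - W s)\<^sup>2 \<partial>M)"
    using L2_spaceD(2)[OF W] L2_spaceD(2)[OF D] L2_mult_integrable[OF W D] by (simp add: L2_inner_def)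
  moreover have "\<bar>L2_inner M W (\<lambda>s. V s - W s)\<bar> \<le> sqrt K * sqrt d"
    by (rule order_trans[OF L2_inner_Cauchy_Schwarz[OF W D]])
      (auto simp: L2_nrm_def intro!: mult_mono real_sqrt_le_mono K d order_trans[OF _ K])
  moreover have "0 \<le> (\<integral>s. (V s - W s)\<^sup>2 \<partial>M)" by simp
  moreover have "\<bar>x - y\<bar> \<le> d + 2 * z" if "x = y + 2 * p + q" "\<bar>p\<bar> \<le> z" "0 \<le> q" "q \<le> d" for x y p q z :: real
    using that by linarith
  ultimately show ?thesis using d by blast
qed

context weight
begin

lemma normsum_L2:
  assumes f: "(\<lambda>(x, s). f s x) \<in> borel_measurable (borel \<Otimes>\<^sub>M borel)"
    and bd: "\<And>s x. \<bar>f s x\<bar> \<le> (1 + x\<^sup>2) * (a * (1 + \<bar>s\<bar>))"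
  shows "(\<lambda>s. normsum n (f s) x) \<in> L2_space \<mu>"
proof -
  have "(\<lambda>s. f s y) \<in> L2_space \<mu>" for y
    by (rule L2_linear_growth[OF measurable_section(2)[OF f], of _ "(1 + y\<^sup>2) * a"])
      (use bd[of _ y] in \<open>simp add: mult.assoc\<close>)
  then have "(\<lambda>s. 1 / sqrt (real n) * (\<Sum>j=1..n. f s (x j))) \<in> L2_space \<mu>"
    by (intro L2_cmult L2_sum)
  then show ?thesis by (simp add: normsum_def)
qed

lemma eta_bound': "\<bar>eta x s\<bar> \<le> (1 + x\<^sup>2) * (4 * (1 + \<bar>s\<bar>))"
  using eta_bound[of x s] by (simp add: algebra_simps)

lemmas normsum_eta_L2 = normsum_L2[OF eta_measurable eta_bound']

lemma emp_process_L2: "emp_process n x \<in> L2_space \<mu>"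
proof -
  let ?Y = "scaled_residual n x"
  have m: "emp_process n x \<in> borel_measurable borel"
    \<comment> \<open>Joint measurability, applied to constant random variables on a one-point
      space, covers a fixed sample.\<close>
    using measurable_compose[OF measurable_Pair1'[of "()" "count_space UNIV" borel]
        emp_process_joint_measurable[of n "\<lambda>k _. x k" "count_space UNIV"]] by simp
  define c where "c = (1 / real n) * (\<Sum>j=1..n. \<bar>?Y j\<bar> * (\<bar>?Y j\<bar> + 1)) + 1"
  show ?thesis
  proof (rule L2_linear_growth[OF m])
    fix t
    have "\<bar>?Y j * (?Y j - t) * indicator {..t} (?Y j)\<bar> \<le> \<bar>?Y j\<bar> * (\<bar>?Y j\<bar> + 1) * (1 + \<bar>t\<bar>)" for j
    proof -
      have "\<bar>?Y j * (?Y j - t) * indicator {..t} (?Y j)\<bar> \<le> \<bar>?Y j\<bar> * \<bar>?Y j - t\<bar>"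
        by (auto simp: indicator_def abs_mult)
      also have "\<dots> \<le> \<bar>?Y j\<bar> * ((\<bar>?Y j\<bar> + 1) * (1 + \<bar>t\<bar>))"
        by (intro mult_left_mono) (auto simp: algebra_simps intro: order_trans[OF abs_triangle_ineq4])
      finally show ?thesis by (simp add: mult.assoc)
    qed
    then have "\<bar>\<Sum>j=1..n. ?Y j * (?Y j - t) * indicator {..t} (?Y j)\<bar> \<le> (\<Sum>j=1..n. \<bar>?Y j\<bar> * (\<bar>?Y j\<bar> + 1)) * (1 + \<bar>t\<bar>)"
      unfolding sum_distrib_right by (intro order_trans[OF sum_abs] sum_mono)
    then have "\<bar>(1 / real n) * (\<Sum>j=1..n. ?Y j * (?Y j - t) * indicator {..t} (?Y j))\<bar>
        \<le> (1 / real n) * ((\<Sum>j=1..n. \<bar>?Y j\<bar> * (\<bar>?Y j\<bar> + 1)) * (1 + \<bar>t\<bar>))"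
      unfolding abs_mult[of "1 / real n"] by (intro mult_mono) auto
    moreover have "\<bar>Phi t\<bar> \<le> 1 * (1 + \<bar>t\<bar>)" using Phi_bounds[of t] by simp
    ultimately have "\<bar>(1 / real n) * (\<Sum>j=1..n. ?Y j * (?Y j - t) * indicator {..t} (?Y j)) - Phi t\<bar> \<le> c * (1 + \<bar>t\<bar>)"
      unfolding c_def distrib_right mult.assoc by (intro order_trans[OF abs_triangle_ineq4] add_mono)
    then have "sqrt (real n) * \<bar>(1 / real n) * (\<Sum>j=1..n. ?Y j * (?Y j - t) * indicator {..t} (?Y j)) - Phi t\<bar>
        \<le> sqrt (real n) * (c * (1 + \<bar>t\<bar>))" by (intro mult_left_mono) auto
    then show "\<bar>emp_process n x t\<bar> \<le> (sqrt (real n) * c) * (1 + \<bar>t\<bar>)"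
      unfolding emp_process_def abs_mult by (simp add: mult.assoc)
  qed
qed

text \<open>The constant of \<open>emp_process_linearisation\<close> after integration over
  \<open>s\<close>, with \<open>K\<close> bounding the integrals of both squared sums.\<close>

definition dev_const :: "real \<Rightarrow> real" where
  "dev_const K = (6 * (67 * K ^ 6)\<^sup>2 + 144 * K ^ 7) * (K + K + 8 * (\<integral>s. 1 + s ^ 4 \<partial>\<mu>))"

text \<open>The bound of \<open>L2_square_integral_close\<close> for squared distance
  \<open>dev_const K / sqrt n\<close> and squared norm \<open>K\<close>.\<close>

definition dev_rate :: "real \<Rightarrow> nat \<Rightarrow> real" where
  "dev_rate K n = dev_const K / sqrt (real n) + 2 * (sqrt K * sqrt (dev_const K / sqrt (real n)))"

lemma dev_rate_tendsto: "dev_rate K \<longlonglongrightarrow> 0"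
proof -
  have "(\<lambda>n. 1 / sqrt (real n)) \<longlonglongrightarrow> 0"
    by (intro tendsto_divide_0[OF tendsto_const] filterlim_at_top_imp_at_infinity
        filterlim_compose[OF sqrt_at_top] filterlim_real_sequentially)
  from tendsto_mult_right_zero[OF this, of "dev_const K"]
  have 1: "(\<lambda>n. dev_const K / sqrt (real n)) \<longlonglongrightarrow> 0" by simp
  from tendsto_add[OF 1 tendsto_mult_right_zero[OF tendsto_mult_right_zero[OF tendsto_real_sqrt[OF 1, simplified], of "sqrt K"], of 2]]
  show ?thesis unfolding dev_rate_def[abs_def] by simp
qed

lemma emp_process_norm_close:
  assumes n: "1 \<le> n" and K: "1 \<le> K" and N: "4 * K\<^sup>2 \<le> sqrt (real n)" and T: "total_dev n x \<le> ennreal K"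
  shows "\<bar>(\<integral>s. (emp_process n x s)\<^sup>2 \<partial>\<mu>) - (\<integral>s. (normsum n (\<lambda>y. eta y s) x)\<^sup>2 \<partial>\<mu>)\<bar> \<le> dev_rate K n"
proof -
  note parts = ennreal_sum6_leD[OF T[unfolded total_dev_def]]
  have abs: "\<bar>a\<bar> \<le> K" if "ennreal (a\<^sup>2) \<le> ennreal K" for a
  proof -
    have "a\<^sup>2 \<le> K" using that K by simp
    also have "K \<le> K\<^sup>2" using K self_le_power[OF K, of 2] by simp
    finally show ?thesis using K abs_le_square_iff[of a K] by simp
  qed
  have int: "(\<integral>s. (g s)\<^sup>2 \<partial>\<mu>) \<le> K" if "g \<in> L2_space \<mu>" "(\<integral>\<^sup>+s. ennreal (1 * (g s)\<^sup>2) \<partial>\<mu>) \<le> ennreal K" for g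
    using that(2) K L2_spaceD(2)[OF that(1)] by (simp add: nn_integral_eq_integral)
  have a2: "(\<lambda>s. normsum n (quad_part s) x) \<in> L2_space \<mu>" "(\<lambda>s. normsum n (lin_part s) x) \<in> L2_space \<mu>"
    using normsum_L2[OF quad_part_measurable quad_part_bound] normsum_L2[OF lin_part_measurable lin_part_bound] by blast+
  define c where "c = 6 * (67 * K ^ 6)\<^sup>2 + 144 * K ^ 7"
  have c: "0 \<le> c" using K by (simp add: c_def)
  have R: "(\<integral>\<^sup>+v. ennreal ((normsum n (slope_part v) x)\<^sup>2 / (1 + v\<^sup>2)) \<partial>lborel) \<le> ennreal K"
    using parts(3) by simp
  have D: "(\<lambda>s. emp_process n x s - normsum n (\<lambda>y. eta y s) x) \<in> L2_space \<mu>"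
    by (intro L2_diff emp_process_L2 normsum_eta_L2)
  have "(\<integral>s. (emp_process n x s - normsum n (\<lambda>y. eta y s) x)\<^sup>2 \<partial>\<mu>)
      \<le> (\<integral>s. c / sqrt (real n) * ((normsum n (quad_part s) x)\<^sup>2 + (normsum n (lin_part s) x)\<^sup>2 + 8 * (1 + s ^ 4)) \<partial>\<mu>)"
    unfolding c_def
    by (intro integral_mono L2_spaceD(2)[OF D] integrable_mult_right Bochner_Integration.integrable_add
        L2_spaceD(2)[OF a2(1)] L2_spaceD(2)[OF a2(2)] integrable_fourth
        emp_process_linearisation[OF n K N abs[OF parts(1)] abs[OF parts(2)] R])
  also have "\<dots> = c / sqrt (real n) * ((\<integral>s. (normsum n (quad_part s) x)\<^sup>2 \<partial>\<mu>) + (\<integral>s. (normsum n (lin_part s) x)\<^sup>2 \<partial>\<mu>) + 8 * (\<integral>s. 1 + s ^ 4 \<partial>\<mu>))"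
    using L2_spaceD(2)[OF a2(1)] L2_spaceD(2)[OF a2(2)] integrable_fourth
    by (simp only: integral_mult_right_zero Bochner_Integration.integral_add Bochner_Integration.integrable_add integrable_mult_right)
  also have "\<dots> \<le> c / sqrt (real n) * (K + K + 8 * (\<integral>s. 1 + s ^ 4 \<partial>\<mu>))"
    using c by (intro mult_left_mono add_mono int a2 parts(4) parts(5) order_refl) auto
  also have "\<dots> = dev_const K / sqrt (real n)"
    by (simp add: dev_const_def c_def)
  finally show ?thesis
    unfolding dev_rate_def
    by (intro L2_square_integral_close emp_process_L2 normsum_eta_L2 int parts(6))
qed

section \<open>Laplace transforms of the norm and of its approximations\<close>

lemma L2_norm_measurable:
  fixes f :: "'a \<Rightarrow> real \<Rightarrow> real"
  assumes "(\<lambda>(w, t). f w t) \<in> borel_measurable (M \<Otimes>\<^sub>M borel)"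
  shows "(\<lambda>w. \<integral>t. (f w t)\<^sup>2 \<partial>\<mu>) \<in> borel_measurable M"
proof (rule borel_measurable_lebesgue_integral)
  have [measurable]: "(\<lambda>(w, t). f w t) \<in> borel_measurable (M \<Otimes>\<^sub>M \<mu>)"
    using assms measurable_cong_sets[OF sets_pair_measure_cong[OF refl sets_\<mu>] refl] by blast
  show "(\<lambda>(w, t). (f w t)\<^sup>2) \<in> borel_measurable (M \<Otimes>\<^sub>M \<mu>)" by measurable
qed

lemma emp_norm_measurable:
  assumes "alternative_row M c C n X"
  shows "(\<lambda>w. \<integral>t. (emp_process n (\<lambda>k. X k w) t)\<^sup>2 \<partial>\<mu>) \<in> borel_measurable M"
    "(\<lambda>w. \<integral>t. (normsum n (\<lambda>y. eta y t) (\<lambda>k. X k w))\<^sup>2 \<partial>\<mu>) \<in> borel_measurable M"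
proof -
  interpret R: alternative_row M c C n X by fact
  show "(\<lambda>w. \<integral>t. (emp_process n (\<lambda>k. X k w) t)\<^sup>2 \<partial>\<mu>) \<in> borel_measurable M"
    by (intro L2_norm_measurable emp_process_joint_measurable R.measurable_X)
  show "(\<lambda>w. \<integral>t. (normsum n (\<lambda>y. eta y t) (\<lambda>k. X k w))\<^sup>2 \<partial>\<mu>) \<in> borel_measurable M"
    by (intro L2_norm_measurable R.normsum_joint_measurable eta_measurable)
qed

text \<open>Where \<open>total_dev\<close> stays below \<open>K\<close> the squared norms are close
  and the exponential is Lipschitz; elsewhere the exponentials differ by at most 1, on an event of
  probability at most \<open>D / K\<close>.\<close>

lemma emp_process_laplace_close:
  assumes row: "alternative_row M c C n X" and K: "1 \<le> K" and N: "4 * K\<^sup>2 \<le> sqrt (real n)"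
    and D: "(\<integral>\<^sup>+w. total_dev n (\<lambda>k. X k w) \<partial>M) \<le> ennreal D" "0 \<le> D" and l: "0 \<le> l"
  shows "\<bar>(\<integral>w. exp (- (l * (\<integral>s. (emp_process n (\<lambda>k. X k w) s)\<^sup>2 \<partial>\<mu>))) \<partial>M)
    - (\<integral>w. exp (- (l * (\<integral>s. (normsum n (\<lambda>y. eta y s) (\<lambda>k. X k w))\<^sup>2 \<partial>\<mu>))) \<partial>M)\<bar> \<le> l * dev_rate K n + D / K"
proof -
  interpret R: alternative_row M c C n X by fact
  define v where "v w = (\<integral>s. (emp_process n (\<lambda>k. X k w) s)\<^sup>2 \<partial>\<mu>)" for w
  define u where "u w = (\<integral>s. (normsum n (\<lambda>y. eta y s) (\<lambda>k. X k w))\<^sup>2 \<partial>\<mu>)" for w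
  define T where "T w = total_dev n (\<lambda>k. X k w)" for w
  have [measurable]: "v \<in> borel_measurable M" "u \<in> borel_measurable M" "T \<in> borel_measurable M"
    using emp_norm_measurable[OF row] total_dev_measurable[OF row] by (simp_all add: v_def[abs_def] u_def[abs_def] T_def[abs_def])
  have nn: "0 \<le> v w" "0 \<le> u w" for w by (simp_all add: v_def u_def)
  define B where "B = {w \<in> space M. 1 \<le> ennreal (1 / K) * T w}"
  have [measurable]: "B \<in> sets M" unfolding B_def by measurable
  have i: "integrable M (\<lambda>w. exp (- (l * g w)))" if [measurable]: "g \<in> borel_measurable M" and "\<And>w. 0 \<le> g w" for g
    using that(2) l by (intro R.integrable_const_bound[of _ 1]) auto
  have rate0: "0 \<le> dev_rate K n"
    using K by (auto simp: dev_rate_def dev_const_def intro!: add_nonneg_nonneg mult_nonneg_nonneg divide_nonneg_nonneg integral_nonneg_AE)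
  have ptw: "\<bar>exp (- (l * v w)) - exp (- (l * u w))\<bar> \<le> l * dev_rate K n + indicator B w" if w: "w \<in> space M" for w
  proof (cases "w \<in> B")
    case True
    have e: "0 \<le> exp (- (l * v w))" "exp (- (l * v w)) \<le> 1" "0 \<le> exp (- (l * u w))" "exp (- (l * u w)) \<le> 1"
      using nn l by auto
    have "\<bar>exp (- (l * v w)) - exp (- (l * u w))\<bar> \<le> 1" using e by linarith
    moreover have "0 \<le> l * dev_rate K n" using rate0 l by simp
    ultimately show ?thesis using True by simp
  next
    case False
    then have "ennreal (1 / K) * T w < 1" using w by (simp add: B_def not_le)
    then have "ennreal K * (ennreal (1 / K) * T w) \<le> ennreal K * 1" by (intro mult_left_mono) auto
    moreover have "ennreal K * (ennreal (1 / K) * T w) = T w"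
      using K by (simp add: mult.assoc[symmetric] ennreal_mult[symmetric])
    ultimately have "T w \<le> ennreal K" by simp
    then have "\<bar>v w - u w\<bar> \<le> dev_rate K n"
      unfolding v_def u_def T_def by (rule emp_process_norm_close[OF R.n_ge K N])
    then have "\<bar>l * v w - l * u w\<bar> \<le> l * dev_rate K n"
      using l by (simp add: abs_mult mult_left_mono flip: right_diff_distrib)
    moreover have "\<bar>exp (- (l * v w)) - exp (- (l * u w))\<bar> \<le> \<bar>l * v w - l * u w\<bar>"
      using nn l by (intro exp_neg_lipschitz) auto
    ultimately show ?thesis using False by simp
  qed
  have PB: "measure M B \<le> D / K"
  proof -
    have "emeasure M B \<le> ennreal (1 / K) * (\<integral>\<^sup>+w. T w * indicator (space M) w \<partial>M)"
      unfolding B_def by (rule nn_integral_Markov_inequality) auto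
    also have "(\<integral>\<^sup>+w. T w * indicator (space M) w \<partial>M) = (\<integral>\<^sup>+w. T w \<partial>M)"
      by (intro nn_integral_cong) simp
    also have "ennreal (1 / K) * (\<integral>\<^sup>+w. T w \<partial>M) \<le> ennreal (1 / K) * ennreal D"
      using D(1) by (intro mult_left_mono) (auto simp: T_def)
    also have "\<dots> = ennreal (D / K)" using K D(2) by (simp flip: ennreal_mult)
    finally show ?thesis using D(2) K by (simp add: R.emeasure_eq_measure)
  qed
  have "\<bar>(\<integral>w. exp (- (l * v w)) \<partial>M) - (\<integral>w. exp (- (l * u w)) \<partial>M)\<bar> = \<bar>\<integral>w. exp (- (l * v w)) - exp (- (l * u w)) \<partial>M\<bar>"
    using i[of v] i[of u] nn by simp
  also have "\<dots> \<le> (\<integral>w. \<bar>exp (- (l * v w)) - exp (- (l * u w))\<bar> \<partial>M)" by (rule integral_abs_bound)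
  also have "\<dots> \<le> (\<integral>w. l * dev_rate K n + indicator B w \<partial>M)"
    using i[of v] i[of u] nn ptw by (intro integral_mono integrable_abs Bochner_Integration.integrable_diff
        Bochner_Integration.integrable_add integrable_real_indicator) (auto simp: R.emeasure_eq_measure)
  also have "\<dots> = l * dev_rate K n + measure M B"
    by (subst Bochner_Integration.integral_add) (auto simp: R.prob_space R.emeasure_eq_measure)
  finally show ?thesis using PB by (simp add: v_def u_def)
qed

lemma emp_process_laplace_tendsto:
  assumes rows: "\<And>n. n0 \<le> n \<Longrightarrow> alternative_row (M n :: 'a measure) c C n (X n)" and l: "0 \<le> l"
  shows "(\<lambda>n. (\<integral>w. exp (- (l * (\<integral>s. (emp_process n (\<lambda>k. X n k w) s)\<^sup>2 \<partial>\<mu>))) \<partial>M n)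
    - (\<integral>w. exp (- (l * (\<integral>s. (normsum n (\<lambda>y. eta y s) (\<lambda>k. X n k w))\<^sup>2 \<partial>\<mu>))) \<partial>M n)) \<longlonglongrightarrow> 0"
    (is "?f \<longlonglongrightarrow> 0")
proof (rule LIMSEQ_I)
  fix r :: real assume r: "0 < r"
  obtain D where D: "0 \<le> D" "\<And>(M::'a measure) c n X. alternative_row M c C n X \<Longrightarrow> (\<integral>\<^sup>+w. total_dev n (\<lambda>k. X k w) \<partial>M) \<le> ennreal D"
    using total_dev_expectation[where 'a = 'a, of C] by blast
  \<comment> \<open>Chosen so that \<open>D / K = D * r / (r + 2 * D)\<close> is less than
    \<open>r / 2\<close>; only then is \<open>n\<close> sent to infinity.\<close>
  define K where "K = 1 + 2 * D / r"
  have K: "1 \<le> K" using D(1) r by (simp add: K_def)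
  have "D < r / 2 * K" using r D(1) by (simp add: K_def field_simps)
  then have DK: "D / K < r / 2" using K by (simp add: field_simps)
  have "(\<lambda>n. l * dev_rate K n) \<longlonglongrightarrow> 0" by (intro tendsto_mult_right_zero dev_rate_tendsto)
  then have "\<forall>\<^sub>F n in sequentially. l * dev_rate K n < r / 2" using r by (intro order_tendstoD(2)) auto
  moreover have "\<forall>\<^sub>F n in sequentially. 4 * K\<^sup>2 \<le> sqrt (real n)"
    by (rule filterlim_at_top[THEN iffD1, rule_format])
      (intro filterlim_compose[OF sqrt_at_top] filterlim_real_sequentially)
  ultimately have "\<forall>\<^sub>F n in sequentially. norm (?f n - 0) < r"
    using eventually_ge_at_top[of n0]
  proof eventually_elim
    case (elim n)
    note close = emp_process_laplace_close[OF rows[OF elim(3)] K elim(2) D(2)[OF rows[OF elim(3)]] D(1) l]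
    have "l * dev_rate K n + D / K < r" using elim(1) DK by linarith
    from order_le_less_trans[OF close this] show ?case by simp
  qed
  then show "\<exists>N. \<forall>n\<ge>N. norm (?f n - 0) < r" by (simp add: eventually_sequentially)
qed

lemma normsum_eta_inner:
  assumes g: "g \<in> borel_measurable borel" "\<And>s. \<bar>g s\<bar> \<le> B"
  shows "L2_inner \<mu> (\<lambda>s. normsum n (\<lambda>y. eta y s) x) g = normsum n (eta_inner g) x"
proof -
  have gL: "g \<in> L2_space \<mu>" using g measurable_cong_sets[OF sets_\<mu> refl] by (intro L2_bounded) auto
  have "L2_inner \<mu> (\<lambda>s. normsum n (\<lambda>y. eta y s) x) g = (\<integral>s. (\<Sum>j=1..n. eta (x j) s * g s) / sqrt (real n) \<partial>\<mu>)"
    by (simp add: L2_inner_def normsum_def sum_distrib_right)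
  also have "\<dots> = (\<Sum>j=1..n. \<integral>s. eta (x j) s * g s \<partial>\<mu>) / sqrt (real n)"
    by (simp only: integral_divide_zero Bochner_Integration.integral_sum[OF L2_mult_integrable[OF eta_L2 gL]])
  finally show ?thesis by (simp add: normsum_def eta_inner_def L2_inner_def)
qed

lemma normsum_eta_resid:
  "normsum n (\<lambda>y. eta y s) x - step_proj \<mu> m (\<lambda>s. normsum n (\<lambda>y. eta y s) x) s = normsum n (eta_resid m s) x"
proof -
  have ip: "L2_inner \<mu> (\<lambda>s. normsum n (\<lambda>y. eta y s) x) (indicator (cell m i)) = normsum n (eta_inner (indicator (cell m i))) x" for i
    by (rule normsum_eta_inner[of _ 1]) (auto simp: indicator_def)
  have "step_proj \<mu> m (\<lambda>s. normsum n (\<lambda>y. eta y s) x) s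
      = (\<Sum>i\<in>step_cells m. \<Sum>j=1..n. eta_inner (indicator (cell m i)) (x j) / measure \<mu> (cell m i) * indicator (cell m i) s / sqrt (real n))"
  proof -
    have "normsum n f x / p * q = (\<Sum>j=1..n. f (x j) / p * q / sqrt (real n))" for f p q
      by (simp add: normsum_def sum_distrib_left sum_divide_distrib mult_ac)
    then show ?thesis unfolding step_proj_def ip by simp
  qed
  also have "\<dots> = normsum n (\<lambda>y. \<Sum>i\<in>step_cells m. eta_inner (indicator (cell m i)) y / measure \<mu> (cell m i) * indicator (cell m i) s) x"
    unfolding normsum_def sum_divide_distrib by (rule sum.swap)
  finally show ?thesis
    unfolding eta_resid_alt by (simp add: normsum_def sum_subtractf diff_divide_distrib)
qed

text \<open>The exponential is Lipschitz, and the mean of the squared projection residual is bounded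
  by \<open>nn_integral_normsum_square\<close>, with a constant that is the same for every
  row.\<close>

lemma step_proj_laplace_close:
  assumes row: "alternative_row M c C n X" and l: "0 \<le> l"
  shows "\<bar>(\<integral>w. exp (- (l * (\<integral>s. (normsum n (\<lambda>y. eta y s) (\<lambda>k. X k w))\<^sup>2 \<partial>\<mu>))) \<partial>M)
    - (\<integral>w. exp (- (l * step_norm2 \<mu> m (\<lambda>s. normsum n (\<lambda>y. eta y s) (\<lambda>k. X k w)))) \<partial>M)\<bar> \<le> l * ((1 + C + C\<^sup>2) * proj_error m)"
proof -
  interpret R: alternative_row M c C n X by fact
  define W where "W w = (\<lambda>s. normsum n (\<lambda>y. eta y s) (\<lambda>k. X k w))" for w
  define u where "u w = (\<integral>s. (W w s)\<^sup>2 \<partial>\<mu>)" for w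
  define p where "p w = step_norm2 \<mu> m (W w)" for w
  define r where "r w = (\<integral>s. (normsum n (eta_resid m s) (\<lambda>k. X k w))\<^sup>2 \<partial>\<mu>)" for w
  obtain a where a: "\<And>x s. \<bar>eta_resid m s x\<bar> \<le> (1 + x\<^sup>2) * (a * (1 + \<bar>s\<bar>))" using eta_resid_bound by blast
  have WL: "W w \<in> L2_space \<mu>" for w unfolding W_def by (rule normsum_eta_L2)
  \<comment> \<open>Pythagoras: the loss of squared norm is the squared norm of the
    residual.\<close>
  have up: "u w - p w = r w" for w
    using dist_step_proj[OF WL, of w m] by (simp add: u_def p_def r_def W_def normsum_eta_resid)
  have r0: "0 \<le> r w" for w by (simp add: r_def)
  have p0: "0 \<le> p w" for w by (simp add: p_def step_norm2_def sum_nonneg)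
  have u0: "0 \<le> u w" for w by (simp add: u_def)
  have um [measurable]: "u \<in> borel_measurable M"
    using emp_norm_measurable(2)[OF row] by (simp add: u_def[abs_def] W_def)
  have rm [measurable]: "r \<in> borel_measurable M"
    unfolding r_def[abs_def] by (intro L2_norm_measurable R.normsum_joint_measurable eta_resid_measurable)
  have "p = (\<lambda>w. u w - r w)" using up by (auto simp: fun_eq_iff algebra_simps)
  then have [measurable]: "p \<in> borel_measurable M" by simp
  have i: "integrable M (\<lambda>w. exp (- (l * g w)))" if [measurable]: "g \<in> borel_measurable M" and "\<And>w. 0 \<le> g w" for g
    using that(2) l by (intro R.integrable_const_bound[of _ 1]) auto
  have "ennreal (\<integral>w. \<bar>exp (- (l * u w)) - exp (- (l * p w))\<bar> \<partial>M) = (\<integral>\<^sup>+w. ennreal \<bar>exp (- (l * u w)) - exp (- (l * p w))\<bar> \<partial>M)"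
    using i[OF um u0] i[of p] p0 by (intro nn_integral_eq_integral[symmetric]) auto
  also have "\<dots> \<le> (\<integral>\<^sup>+w. ennreal l * ennreal (r w) \<partial>M)"
  proof (intro nn_integral_mono)
    fix w
    have "\<bar>exp (- (l * u w)) - exp (- (l * p w))\<bar> \<le> \<bar>l * u w - l * p w\<bar>"
      using u0 p0 l by (intro exp_neg_lipschitz) auto
    also have "\<dots> = l * r w"
      using l r0[of w] by (simp add: up abs_mult flip: right_diff_distrib)
    finally show "ennreal \<bar>exp (- (l * u w)) - exp (- (l * p w))\<bar> \<le> ennreal l * ennreal (r w)"
      using l r0[of w] by (simp add: ennreal_leI flip: ennreal_mult)
  qed
  also have "\<dots> = ennreal l * (\<integral>\<^sup>+w. ennreal (r w) \<partial>M)" by (rule nn_integral_cmult) simp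
  also have "(\<integral>\<^sup>+w. ennreal (r w) \<partial>M) = (\<integral>\<^sup>+w. (\<integral>\<^sup>+s. ennreal (1 * (normsum n (eta_resid m s) (\<lambda>k. X k w))\<^sup>2) \<partial>\<mu>) \<partial>M)"
    unfolding r_def
    by (intro nn_integral_cong, subst nn_integral_eq_integral)
      (use L2_spaceD(2)[OF normsum_L2[OF eta_resid_measurable a]] in auto)
  also have "\<dots> \<le> (\<integral>\<^sup>+s. ennreal (R.moment_const * (1 * (\<integral>x. (eta_resid m s x)\<^sup>2 \<partial>gauss))) \<partial>\<mu>)"
  proof (rule R.nn_integral_normsum_square[OF sigma_finite_measure_axioms _ measurable_section(1)[OF eta_resid_measurable] _ _ a eta_resid_centred])
    show "(\<lambda>(x, s). eta_resid m s x) \<in> borel_measurable (borel \<Otimes>\<^sub>M \<mu>)"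
      using eta_resid_measurable measurable_cong_sets[OF sets_pair_measure_cong[OF refl sets_\<mu>] refl] by blast
  qed auto
  also have "\<dots> = ennreal (R.moment_const * proj_error m)"
  proof -
    have I: "integrable (gauss \<Otimes>\<^sub>M \<mu>) (\<lambda>(x, s). (eta_resid m s x)\<^sup>2)"
    proof (rule gauss_\<mu>.integrable_product_bound)
      show "(\<lambda>(x, s). (eta_resid m s x)\<^sup>2) \<in> borel_measurable (gauss \<Otimes>\<^sub>M \<mu>)" by measurable
      show "integrable gauss (\<lambda>x. (1 + x\<^sup>2)\<^sup>2)" by (rule gauss_one_plus_square)
      show "integrable \<mu> (\<lambda>s. a\<^sup>2 * (4 * (1 + s ^ 4)))" by (intro integrable_mult_right integrable_fourth)
      show "\<bar>case (x, s) of (x, s) \<Rightarrow> (eta_resid m s x)\<^sup>2\<bar> \<le> (1 + x\<^sup>2)\<^sup>2 * (a\<^sup>2 * (4 * (1 + s ^ 4)))" for x s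
      proof -
        have "(eta_resid m s x)\<^sup>2 \<le> ((1 + x\<^sup>2) * (a * (1 + \<bar>s\<bar>)))\<^sup>2"
          using power_mono[OF a[of s x] abs_ge_zero, of 2] by simp
        also have "\<dots> \<le> (1 + x\<^sup>2)\<^sup>2 * (a\<^sup>2 * (4 * (1 + s ^ 4)))"
          unfolding power_mult_distrib by (intro mult_left_mono one_plus_abs_square) auto
        finally show ?thesis by simp
      qed
    qed
    have "(\<integral>\<^sup>+s. ennreal (R.moment_const * (1 * (\<integral>x. (eta_resid m s x)\<^sup>2 \<partial>gauss))) \<partial>\<mu>)
        = ennreal (\<integral>s. R.moment_const * (1 * (\<integral>x. (eta_resid m s x)\<^sup>2 \<partial>gauss)) \<partial>\<mu>)"
      using gauss_\<mu>.integrable_snd[OF I] R.moment_const_nonneg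
      by (intro nn_integral_eq_integral integrable_mult_right) auto
    also have "(\<integral>s. R.moment_const * (1 * (\<integral>x. (eta_resid m s x)\<^sup>2 \<partial>gauss)) \<partial>\<mu>) = R.moment_const * proj_error m"
      unfolding proj_error_def gauss_\<mu>.Fubini_integral[OF I, symmetric] by simp
    finally show ?thesis .
  qed
  finally have "ennreal (\<integral>w. \<bar>exp (- (l * u w)) - exp (- (l * p w))\<bar> \<partial>M) \<le> ennreal l * ennreal (R.moment_const * proj_error m)"
    by (simp add: mult_left_mono)
  moreover have pe: "0 \<le> proj_error m"
    unfolding proj_error_def by (intro integral_nonneg_AE) auto
  ultimately have "(\<integral>w. \<bar>exp (- (l * u w)) - exp (- (l * p w))\<bar> \<partial>M) \<le> l * (R.moment_const * proj_error m)"
    using l R.moment_const_nonneg by (simp flip: ennreal_mult)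
  moreover have "\<bar>(\<integral>w. exp (- (l * u w)) \<partial>M) - (\<integral>w. exp (- (l * p w)) \<partial>M)\<bar> \<le> (\<integral>w. \<bar>exp (- (l * u w)) - exp (- (l * p w))\<bar> \<partial>M)"
    using i[OF um u0] i[of p] p0 integral_abs_bound[of M "\<lambda>w. exp (- (l * u w)) - exp (- (l * p w))"] by simp
  ultimately show ?thesis
    unfolding R.moment_const_def u_def p_def W_def by linarith
qed

end

section \<open>Convergence in distribution\<close>

context weight
begin

lemma step_function_inner:
  assumes f: "f \<in> L2_space \<mu>"
  shows "L2_inner \<mu> f (\<lambda>s. \<Sum>i\<in>step_cells m. b i * indicator (cell m i) s)
    = (\<Sum>i\<in>step_cells m. b i * L2_inner \<mu> f (indicator (cell m i)))"
proof -
  have "L2_inner \<mu> f (\<lambda>s. \<Sum>i\<in>step_cells m. b i * indicator (cell m i) s)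
      = (\<integral>s. (\<Sum>i\<in>step_cells m. b i * (f s * indicator (cell m i) s)) \<partial>\<mu>)"
    unfolding L2_inner_def sum_distrib_left by (simp only: mult.left_commute)
  also have "\<dots> = (\<Sum>i\<in>step_cells m. \<integral>s. b i * (f s * indicator (cell m i) s) \<partial>\<mu>)"
    by (intro Bochner_Integration.integral_sum integrable_mult_right L2_mult_integrable f indicator_L2 cell_measurable)
  finally show ?thesis by (simp only: integral_mult_right_zero L2_inner_def)
qed

lemma step_function_bounded:
  "\<bar>\<Sum>i\<in>step_cells m. b i * indicator (cell m i) s\<bar> \<le> (\<Sum>i\<in>step_cells m. \<bar>b i :: real\<bar>)"
  by (rule order_trans[OF sum_abs]) (intro sum_mono, auto simp: abs_mult indicator_def)

text \<open>Absorbs \<open>l\<close> and the cell masses into coefficients, as required by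
  \<open>laplace_sum_squares_conv\<close>. A null cell contributes 0 on both sides.\<close>

lemma step_norm2_laplace:
  assumes "0 \<le> l"
  shows "exp (- (l * step_norm2 \<mu> m f))
    = exp (- ((\<Sum>i\<in>step_cells m. (sqrt (2 * l / measure \<mu> (cell m i)) * L2_inner \<mu> f (indicator (cell m i)))\<^sup>2) / 2))"
proof -
  have "(sqrt (2 * l / measure \<mu> (cell m i)) * L2_inner \<mu> f (indicator (cell m i)))\<^sup>2
      = 2 * (l * ((L2_inner \<mu> f (indicator (cell m i)))\<^sup>2 / measure \<mu> (cell m i)))" for i
    using assms by (simp add: power_mult_distrib)
  then show ?thesis
    by (simp only: step_norm2_def sum_distrib_left[symmetric]) simp
qed

text \<open>The right-hand side is the limit in \<open>char_power_tendsto\<close> for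
  \<open>h = eta_inner g\<close>. The covariance form supplies the variance through
  \<open>eta_inner_variance\<close>, and \<open>zeta\<close> a constant phase through
  \<open>eta_inner_zeta\<close>.\<close>

lemma gaussian_element_char:
  assumes N: "prob_space N" and Z: "gaussian_L2_element N \<mu> Z" "centred_L2_element N \<mu> Z"
    "has_covariance_kernel N \<mu> Z (kernel_K2 phi_powers)"
    and c: "c \<in> borel_measurable borel" "\<And>x. \<bar>c x\<bar> \<le> C"
    and g: "g \<in> borel_measurable borel" "\<And>s. \<bar>g s\<bar> \<le> B"
  shows "(\<integral>w. iexp (L2_inner \<mu> (\<lambda>s. Z w s + zeta c s) g) \<partial>N)
    = exp (\<i> * (\<integral>x. eta_inner g x * c x \<partial>gauss) - (\<integral>x. (eta_inner g x)\<^sup>2 \<partial>gauss) / 2)"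
proof -
  have gL: "g \<in> L2_space \<mu>" using g measurable_cong_sets[OF sets_\<mu> refl] by (intro L2_bounded) auto
  have Zm: "Z \<in> measurable N (L2_borel \<mu>)" using Z(1) by (simp add: gaussian_L2_element_def)
  have ZL: "Z w \<in> L2_space \<mu>" if "w \<in> space N" for w
    using measurable_space[OF Zm that] by (simp add: space_L2_borel)
  have m: "(\<lambda>w. L2_inner \<mu> (Z w) g) \<in> borel_measurable N"
    using measurable_compose[OF Zm measurable_L2_inner[OF gL]] .
  have law: "gaussian_law (distr N borel (\<lambda>w. L2_inner \<mu> (Z w) g))"
    using Z(1) gL by (simp add: gaussian_L2_element_def)
  have mean: "(\<integral>w. L2_inner \<mu> (Z w) g \<partial>N) = 0"
    using Z(2) gL by (simp add: centred_L2_element_def)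
  have "(\<integral>w. (L2_inner \<mu> (Z w) g)\<^sup>2 \<partial>N) = (\<integral>s. (\<integral>t. kernel_K2 phi_powers s t * g s * g t \<partial>\<mu>) \<partial>\<mu>)"
    using Z(3) gL unfolding has_covariance_kernel_def power2_eq_square by blast
  then have var: "(\<integral>w. (L2_inner \<mu> (Z w) g)\<^sup>2 \<partial>N) = (\<integral>x. (eta_inner g x)\<^sup>2 \<partial>gauss)"
    using eta_inner_variance[OF g] by simp
  have "(\<integral>w. iexp (L2_inner \<mu> (\<lambda>s. Z w s + zeta c s) g) \<partial>N)
      = (\<integral>w. iexp (L2_inner \<mu> (zeta c) g) * iexp (L2_inner \<mu> (Z w) g) \<partial>N)"
  proof (intro Bochner_Integration.integral_cong refl)
    fix w assume "w \<in> space N"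
    then have "L2_inner \<mu> (\<lambda>s. Z w s + zeta c s) g = L2_inner \<mu> (Z w) g + L2_inner \<mu> (zeta c) g"
      by (intro L2_inner_add ZL zeta_L2[OF c] gL)
    then show "iexp (L2_inner \<mu> (\<lambda>s. Z w s + zeta c s) g) = iexp (L2_inner \<mu> (zeta c) g) * iexp (L2_inner \<mu> (Z w) g)"
      by (simp add: algebra_simps flip: exp_add)
  qed
  also have "\<dots> = iexp (L2_inner \<mu> (zeta c) g) * (\<integral>w. iexp (L2_inner \<mu> (Z w) g) \<partial>N)"
    by (rule integral_mult_right_zero)
  also have "(\<integral>w. iexp (L2_inner \<mu> (Z w) g) \<partial>N) = complex_of_real (exp (- ((\<integral>x. (eta_inner g x)\<^sup>2 \<partial>gauss) / 2)))"
    unfolding gaussian_law_char[OF N m law mean] var ..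
  also have "iexp (L2_inner \<mu> (zeta c) g) * complex_of_real (exp (- ((\<integral>x. (eta_inner g x)\<^sup>2 \<partial>gauss) / 2)))
      = exp (\<i> * (\<integral>x. eta_inner g x * c x \<partial>gauss) - (\<integral>x. (eta_inner g x)\<^sup>2 \<partial>gauss) / 2)"
    unfolding eta_inner_zeta[OF g c] exp_of_real[symmetric] by (simp flip: exp_add)
  finally show ?thesis .
qed

lemma gaussian_element_inner_measurable:
  assumes Z: "gaussian_L2_element N \<mu> Z" and z: "z \<in> L2_space \<mu>" and g: "g \<in> L2_space \<mu>"
  shows "(\<lambda>w. L2_inner \<mu> (\<lambda>s. Z w s + z s) g) \<in> borel_measurable N"
proof -
  have Zm: "Z \<in> measurable N (L2_borel \<mu>)" using Z by (simp add: gaussian_L2_element_def)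
  have "(\<lambda>w. L2_inner \<mu> (Z w) g + L2_inner \<mu> z g) \<in> borel_measurable N"
    using measurable_compose[OF Zm measurable_L2_inner[OF g]] by simp
  then show ?thesis
  proof (rule measurable_cong[THEN iffD1, rotated])
    fix w assume "w \<in> space N"
    then have "Z w \<in> L2_space \<mu>" using measurable_space[OF Zm] by (simp add: space_L2_borel)
    then show "L2_inner \<mu> (Z w) g + L2_inner \<mu> z g = L2_inner \<mu> (\<lambda>s. Z w s + z s) g"
      using L2_inner_add[OF _ z g] by simp
  qed
qed

lemma step_norm2_laplace_tendsto:
  assumes rows: "\<And>n. n0 \<le> n \<Longrightarrow> alternative_row (M n :: 'a measure) c C n (X n)"
    and c0: "(\<integral>x. c x \<partial>gauss) = 0"
    and N: "prob_space N" and Z: "gaussian_L2_element N \<mu> Z" "centred_L2_element N \<mu> Z"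
    "has_covariance_kernel N \<mu> Z (kernel_K2 phi_powers)"
    and l: "0 \<le> l"
  shows "(\<lambda>n. \<integral>w. exp (- (l * step_norm2 \<mu> m (\<lambda>s. normsum n (\<lambda>y. eta y s) (\<lambda>k. X n k w)))) \<partial>M n)
    \<longlonglongrightarrow> (\<integral>w. exp (- (l * step_norm2 \<mu> m (\<lambda>s. Z w s + zeta c s))) \<partial>N)"
proof -
  interpret R0: alternative_row "M n0" c C n0 "X n0" by (rule rows) simp
  have c: "c \<in> borel_measurable borel" "\<And>x. \<bar>c x\<bar> \<le> C" using R0.c_meas R0.c_bound by auto
  define b where "b i = sqrt (2 * l / measure \<mu> (cell m i))" for i
  define A where "A n i w = b i * L2_inner \<mu> (\<lambda>s. normsum n (\<lambda>y. eta y s) (\<lambda>k. X n k w)) (indicator (cell m i))" for n i w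
  define A' where "A' i w = b i * L2_inner \<mu> (\<lambda>s. Z w s + zeta c s) (indicator (cell m i))" for i w
  have ind: "indicator (cell m i) \<in> borel_measurable borel" "\<bar>indicator (cell m i) s\<bar> \<le> (1::real)" for i s
    by (auto simp: indicator_def)
  \<comment> \<open>Only rows from \<open>n0\<close> on are known to be rows of the array, hence the
    shifted index up to the end.\<close>
  have Am: "A (n + n0) i \<in> borel_measurable (M (n + n0))" for n i
  proof -
    interpret R: alternative_row "M (n + n0)" c C "n + n0" "X (n + n0)" by (rule rows) simp
    show ?thesis
      unfolding A_def[abs_def] normsum_eta_inner[OF ind]
      by (intro borel_measurable_times borel_measurable_const R.normsum_measurable eta_inner_measurable[OF ind])
  qed
  have A'm: "A' i \<in> borel_measurable N" for i
    unfolding A'_def[abs_def]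
    by (intro borel_measurable_times borel_measurable_const gaussian_element_inner_measurable[OF Z(1) zeta_L2[OF c]] indicator_L2 cell_measurable)
  have Zm: "Z \<in> measurable N (L2_borel \<mu>)" using Z(1) by (simp add: gaussian_L2_element_def)
  have ZL: "(\<lambda>s. Z w s + zeta c s) \<in> L2_space \<mu>" if "w \<in> space N" for w
    using measurable_space[OF Zm that] by (intro L2_add zeta_L2[OF c]) (simp add: space_L2_borel)
  have lim: "(\<lambda>n. \<integral>w. iexp (\<Sum>i\<in>step_cells m. \<xi> i * A (n + n0) i w) \<partial>M (n + n0)) \<longlonglongrightarrow> (\<integral>w. iexp (\<Sum>i\<in>step_cells m. \<xi> i * A' i w) \<partial>N)" for \<xi>
  proof -
    \<comment> \<open>The device of Cramer and Wold: a linear combination of cell functionals is the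
      functional of a single step function, so one-dimensional limits suffice.\<close>
    define g where "g s = (\<Sum>i\<in>step_cells m. (\<xi> i * b i) * indicator (cell m i) s)" for s
    define B where "B = (\<Sum>i\<in>step_cells m. \<bar>\<xi> i * b i\<bar>)"
    have g: "g \<in> borel_measurable borel" "\<And>s. \<bar>g s\<bar> \<le> B"
      unfolding B_def g_def[abs_def] by (measurable, rule step_function_bounded)
    define \<psi> where "\<psi> = exp (\<i> * (\<integral>x. eta_inner g x * c x \<partial>gauss) - (\<integral>x. (eta_inner g x)\<^sup>2 \<partial>gauss) / 2)"
    have "(\<Sum>i\<in>step_cells m. \<xi> i * A' i w) = L2_inner \<mu> (\<lambda>s. Z w s + zeta c s) g" if "w \<in> space N" for w
      unfolding A'_def g_def[abs_def] step_function_inner[OF ZL[OF that]] by (simp add: mult.assoc)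
    then have "(\<integral>w. iexp (\<Sum>i\<in>step_cells m. \<xi> i * A' i w) \<partial>N) = (\<integral>w. iexp (L2_inner \<mu> (\<lambda>s. Z w s + zeta c s) g) \<partial>N)"
      by (intro Bochner_Integration.integral_cong) auto
    also have "\<dots> = \<psi>" unfolding \<psi>_def by (rule gaussian_element_char[OF N Z c g])
    finally have rhs: "(\<integral>w. iexp (\<Sum>i\<in>step_cells m. \<xi> i * A' i w) \<partial>N) = \<psi>" .
    have sumA: "(\<Sum>i\<in>step_cells m. \<xi> i * A n i w) = normsum n (eta_inner g) (\<lambda>k. X n k w)" for n w
    proof -
      have "(\<Sum>i\<in>step_cells m. \<xi> i * A n i w) = L2_inner \<mu> (\<lambda>s. normsum n (\<lambda>y. eta y s) (\<lambda>k. X n k w)) g"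
        unfolding A_def g_def[abs_def] step_function_inner[OF normsum_eta_L2] by (simp add: mult.assoc)
      also have "\<dots> = normsum n (eta_inner g) (\<lambda>k. X n k w)" by (rule normsum_eta_inner[OF g])
      finally show ?thesis .
    qed
    have "(\<integral>w. iexp (\<Sum>i\<in>step_cells m. \<xi> i * A (n + n0) i w) \<partial>M (n + n0))
        = (\<integral>x. (1 + c x / sqrt (real (n + n0))) *\<^sub>R iexp (eta_inner g x / sqrt (real (n + n0))) \<partial>gauss) ^ (n + n0)" for n
    proof -
      interpret R: alternative_row "M (n + n0)" c C "n + n0" "X (n + n0)" by (rule rows) simp
      show ?thesis unfolding sumA by (rule R.char_normsum[OF eta_inner_measurable[OF g]])
    qed
    moreover have "(\<lambda>n. (\<integral>x. (1 + c x / sqrt (real (n + n0))) *\<^sub>R iexp (eta_inner g x / sqrt (real (n + n0))) \<partial>gauss) ^ (n + n0)) \<longlonglongrightarrow> \<psi>"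
      unfolding \<psi>_def
      by (rule LIMSEQ_ignore_initial_segment[OF char_power_tendsto[OF c(1) eta_inner_measurable[OF g] c(2) c0
            eta_inner_square_integrable[OF g] eta_inner_centred[OF g]]])
    ultimately show ?thesis unfolding rhs by simp
  qed
  have "(\<lambda>n. \<integral>w. exp (- ((\<Sum>i\<in>step_cells m. (A (n + n0) i w)\<^sup>2) / 2)) \<partial>M (n + n0))
      \<longlonglongrightarrow> (\<integral>w. exp (- ((\<Sum>i\<in>step_cells m. (A' i w)\<^sup>2) / 2)) \<partial>N)"
  proof (rule laplace_sum_squares_conv[OF _ N Am A'm finite_step_cells lim])
    show "prob_space (M (n + n0))" for n
      using rows[of "n + n0"] by (simp add: alternative_row_def)
  qed
  then have "(\<lambda>n. \<integral>w. exp (- (l * step_norm2 \<mu> m (\<lambda>s. normsum (n + n0) (\<lambda>y. eta y s) (\<lambda>k. X (n + n0) k w)))) \<partial>M (n + n0))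
      \<longlonglongrightarrow> (\<integral>w. exp (- (l * step_norm2 \<mu> m (\<lambda>s. Z w s + zeta c s))) \<partial>N)"
    unfolding step_norm2_laplace[OF l] A_def A'_def b_def .
  then show ?thesis by (rule LIMSEQ_offset)
qed

lemma step_norm2_measurable:
  assumes Z: "gaussian_L2_element N \<mu> Z" and z: "z \<in> L2_space \<mu>"
  shows "(\<lambda>w. step_norm2 \<mu> m (\<lambda>s. Z w s + z s)) \<in> borel_measurable N"
  unfolding step_norm2_def
  by (intro borel_measurable_sum borel_measurable_divide borel_measurable_power borel_measurable_const
      gaussian_element_inner_measurable[OF Z z] indicator_L2 cell_measurable)

text \<open>\<open>Z\<close> is measurable as a map into \<open>L2_borel\<close>, which gives no
  joint measurability of \<open>Z w s\<close> in \<open>w\<close> and \<open>s\<close>. The norm is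
  obtained as a limit of \<open>step_norm2\<close>, which involves inner products only.\<close>

lemma gaussian_element_norm_measurable:
  assumes Z: "gaussian_L2_element N \<mu> Z" and z: "z \<in> L2_space \<mu>"
  shows "(\<lambda>w. \<integral>s. (Z w s + z s)\<^sup>2 \<partial>\<mu>) \<in> borel_measurable N"
proof (rule borel_measurable_LIMSEQ_real[OF _ step_norm2_measurable[OF Z z]])
  fix w assume w: "w \<in> space N"
  have "Z \<in> measurable N (L2_borel \<mu>)" using Z by (simp add: gaussian_L2_element_def)
  from measurable_space[OF this w] have "Z w \<in> L2_space \<mu>" by (simp add: space_L2_borel)
  then show "(\<lambda>m. step_norm2 \<mu> m (\<lambda>s. Z w s + z s)) \<longlonglongrightarrow> (\<integral>s. (Z w s + z s)\<^sup>2 \<partial>\<mu>)"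
    by (intro step_norm2_tendsto L2_add z)
qed

lemma gaussian_element_laplace_tendsto:
  assumes N: "prob_space N" and Z: "gaussian_L2_element N \<mu> Z" and z: "z \<in> L2_space \<mu>" and l: "0 \<le> l"
  shows "(\<lambda>m. \<integral>w. exp (- (l * step_norm2 \<mu> m (\<lambda>s. Z w s + z s))) \<partial>N)
    \<longlonglongrightarrow> (\<integral>w. exp (- (l * (\<integral>s. (Z w s + z s)\<^sup>2 \<partial>\<mu>))) \<partial>N)"
proof -
  interpret N: prob_space N by fact
  have Zm: "Z \<in> measurable N (L2_borel \<mu>)" using Z by (simp add: gaussian_L2_element_def)
  have lim: "(\<lambda>m. exp (- (l * step_norm2 \<mu> m (\<lambda>s. Z w s + z s)))) \<longlonglongrightarrow> exp (- (l * (\<integral>s. (Z w s + z s)\<^sup>2 \<partial>\<mu>)))"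
    if "w \<in> space N" for w
    using measurable_space[OF Zm that]
    by (intro tendsto_intros step_norm2_tendsto L2_add z) (simp add: space_L2_borel)
  note [measurable] = step_norm2_measurable[OF Z z] gaussian_element_norm_measurable[OF Z z]
  have nn: "0 \<le> l * step_norm2 \<mu> m f" for m f
    using l by (simp add: step_norm2_def sum_nonneg)
  show ?thesis
  proof (rule integral_dominated_convergence[where w = "\<lambda>_. 1"])
    show "AE w in N. (\<lambda>m. exp (- (l * step_norm2 \<mu> m (\<lambda>s. Z w s + z s)))) \<longlonglongrightarrow> exp (- (l * (\<integral>s. (Z w s + z s)\<^sup>2 \<partial>\<mu>)))"
      by (rule AE_I2) (rule lim)
    show "AE w in N. norm (exp (- (l * step_norm2 \<mu> m (\<lambda>s. Z w s + z s)))) \<le> 1" for m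
      using nn by simp
    show "(\<lambda>w. exp (- (l * (\<integral>s. (Z w s + z s)\<^sup>2 \<partial>\<mu>)))) \<in> borel_measurable N" by measurable
    show "(\<lambda>w. exp (- (l * step_norm2 \<mu> m (\<lambda>s. Z w s + z s)))) \<in> borel_measurable N" for m by measurable
  qed simp
qed

text \<open>Two limits are interchanged. The projection level \<open>m\<close> is fixed first, by
  the error that is uniform in \<open>n\<close> and by convergence on the Gaussian side; then
  \<open>n\<close> tends to infinity at that level.\<close>

lemma emp_process_norm_laplace:
  assumes rows: "\<And>n. n0 \<le> n \<Longrightarrow> alternative_row (M n :: 'a measure) c C n (X n)"
    and c0: "(\<integral>x. c x \<partial>gauss) = 0"
    and N: "prob_space N" and Z: "gaussian_L2_element N \<mu> Z" "centred_L2_element N \<mu> Z"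
    "has_covariance_kernel N \<mu> Z (kernel_K2 phi_powers)"
    and l: "0 \<le> l"
  shows "(\<lambda>n. \<integral>w. exp (- (l * (\<integral>s. (emp_process n (\<lambda>k. X n k w) s)\<^sup>2 \<partial>\<mu>))) \<partial>M n)
    \<longlonglongrightarrow> (\<integral>w. exp (- (l * (\<integral>s. (Z w s + zeta c s)\<^sup>2 \<partial>\<mu>))) \<partial>N)" (is "?v \<longlonglongrightarrow> ?lim")
proof -
  interpret R0: alternative_row "M n0" c C n0 "X n0" by (rule rows) simp
  define u where "u n = (\<integral>w. exp (- (l * (\<integral>s. (normsum n (\<lambda>y. eta y s) (\<lambda>k. X n k w))\<^sup>2 \<partial>\<mu>))) \<partial>M n)" for n
  define p where "p m n = (\<integral>w. exp (- (l * step_norm2 \<mu> m (\<lambda>s. normsum n (\<lambda>y. eta y s) (\<lambda>k. X n k w)))) \<partial>M n)" for m n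
  define q where "q m = (\<integral>w. exp (- (l * step_norm2 \<mu> m (\<lambda>s. Z w s + zeta c s))) \<partial>N)" for m
  have vu: "(\<lambda>n. ?v n - u n) \<longlonglongrightarrow> 0"
    unfolding u_def by (rule emp_process_laplace_tendsto[OF rows l])
  have up: "\<bar>u n - p m n\<bar> \<le> l * ((1 + C + C\<^sup>2) * proj_error m)" if "n0 \<le> n" for n m
    unfolding u_def p_def by (rule step_proj_laplace_close[OF rows[OF that] l])
  have pq: "(\<lambda>n. p m n) \<longlonglongrightarrow> q m" for m
    unfolding p_def q_def by (rule step_norm2_laplace_tendsto[OF rows c0 N Z l])
  have ql: "q \<longlonglongrightarrow> ?lim"
    unfolding q_def[abs_def]
    by (rule gaussian_element_laplace_tendsto[OF N Z(1) zeta_L2[OF R0.c_meas R0.c_bound] l])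
  have err: "(\<lambda>m. l * ((1 + C + C\<^sup>2) * proj_error m)) \<longlonglongrightarrow> 0"
    by (intro tendsto_mult_right_zero proj_error_tendsto)
  have "u \<longlonglongrightarrow> ?lim"
  proof (rule LIMSEQ_I)
    fix r :: real assume r: "0 < r"
    have "\<forall>\<^sub>F m in sequentially. \<bar>q m - ?lim\<bar> < r / 3"
      using tendstoD[OF ql, of "r / 3"] r by (simp add: dist_real_def)
    moreover have "\<forall>\<^sub>F m in sequentially. l * ((1 + C + C\<^sup>2) * proj_error m) < r / 3"
      using r by (intro order_tendstoD(2)[OF err]) auto
    ultimately have "\<forall>\<^sub>F m in sequentially. \<bar>q m - ?lim\<bar> < r / 3 \<and> l * ((1 + C + C\<^sup>2) * proj_error m) < r / 3"
      by (rule eventually_conj)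
    then obtain m where m: "\<bar>q m - ?lim\<bar> < r / 3" "l * ((1 + C + C\<^sup>2) * proj_error m) < r / 3"
      by (auto simp: eventually_sequentially)
    have "\<forall>\<^sub>F n in sequentially. \<bar>p m n - q m\<bar> < r / 3"
      using tendstoD[OF pq[of m], of "r / 3"] r by (simp add: dist_real_def)
    then have "\<forall>\<^sub>F n in sequentially. norm (u n - ?lim) < r"
      using eventually_ge_at_top[of n0]
    proof eventually_elim
      case (elim n)
      have tri: "\<bar>a - d\<bar> < r" if "\<bar>a - b\<bar> < r / 3" "\<bar>b - c\<bar> < r / 3" "\<bar>c - d\<bar> < r / 3" for a b c d :: real
        using that by linarith
      from tri[OF order_le_less_trans[OF up[OF elim(2)] m(2)] elim(1) m(1)]
      show ?case by simp
    qed
    then show "\<exists>no. \<forall>n\<ge>no. norm (u n - ?lim) < r" by (simp add: eventually_sequentially)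
  qed
  from tendsto_add[OF vu this] show ?thesis by simp
qed

lemma emp_process_norm_weak_conv:
  assumes rows: "\<And>n. n0 \<le> n \<Longrightarrow> alternative_row (M n :: 'a measure) c C n (X n)"
    and c0: "(\<integral>x. c x \<partial>gauss) = 0"
    and N: "prob_space N" and Z: "gaussian_L2_element N \<mu> Z" "centred_L2_element N \<mu> Z"
    "has_covariance_kernel N \<mu> Z (kernel_K2 phi_powers)"
  shows "weak_conv_m (\<lambda>n. distr (M n) borel (\<lambda>w. G2 \<omega> n (\<lambda>k. X n k w)))
    (distr N borel (\<lambda>w. (L2_nrm \<mu> (\<lambda>s. Z w s + zeta c s))\<^sup>2))"
proof -
  interpret N: prob_space N by fact
  interpret R0: alternative_row "M n0" c C n0 "X n0" by (rule rows) simp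
  have G2: "G2 \<omega> n x = (\<integral>s. (emp_process n x s)\<^sup>2 \<partial>\<mu>)" for n x
  proof -
    have "emp_process n x \<in> borel_measurable borel"
      using L2_spaceD(1)[OF emp_process_L2] measurable_cong_sets[OF sets_\<mu> refl] by blast
    then show ?thesis unfolding G2_eq_emp_process by (subst \<mu>_integral) auto
  qed
  have nrm: "(L2_nrm \<mu> f)\<^sup>2 = (\<integral>s. (f s)\<^sup>2 \<partial>\<mu>)" for f
    by (simp add: L2_nrm_def)
  have Gm: "(\<lambda>w. G2 \<omega> (n + n0) (\<lambda>k. X (n + n0) k w)) \<in> borel_measurable (M (n + n0))" for n
    unfolding G2 by (rule emp_norm_measurable(1)[OF rows]) simp
  have Zm: "(\<lambda>w. (L2_nrm \<mu> (\<lambda>s. Z w s + zeta c s))\<^sup>2) \<in> borel_measurable N"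
    unfolding nrm by (rule gaussian_element_norm_measurable[OF Z(1) zeta_L2[OF R0.c_meas R0.c_bound]])
  have "weak_conv_m (\<lambda>n. distr (M (n + n0)) borel (\<lambda>w. G2 \<omega> (n + n0) (\<lambda>k. X (n + n0) k w)))
    (distr N borel (\<lambda>w. (L2_nrm \<mu> (\<lambda>s. Z w s + zeta c s))\<^sup>2))"
  proof (rule laplace_conv_imp_weak_conv)
    show "real_distribution (distr N borel (\<lambda>w. (L2_nrm \<mu> (\<lambda>s. Z w s + zeta c s))\<^sup>2))"
      using Zm by (rule N.real_distribution_distr)
    show "AE x in distr N borel (\<lambda>w. (L2_nrm \<mu> (\<lambda>s. Z w s + zeta c s))\<^sup>2). 0 \<le> x"
      using Zm by (subst AE_distr_iff) auto
    show "real_distribution (distr (M (n + n0)) borel (\<lambda>w. G2 \<omega> (n + n0) (\<lambda>k. X (n + n0) k w)))" for n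
    proof -
      interpret R: alternative_row "M (n + n0)" c C "n + n0" "X (n + n0)" by (rule rows) simp
      show ?thesis using Gm by (rule R.real_distribution_distr)
    qed
    show "AE x in distr (M (n + n0)) borel (\<lambda>w. G2 \<omega> (n + n0) (\<lambda>k. X (n + n0) k w)). 0 \<le> x" for n
      using Gm[of n] by (subst AE_distr_iff) (auto simp: G2)
    fix k :: nat
    have "(\<lambda>n. \<integral>w. exp (- (real k * G2 \<omega> (n + n0) (\<lambda>k. X (n + n0) k w))) \<partial>M (n + n0))
        \<longlonglongrightarrow> (\<integral>w. exp (- (real k * (L2_nrm \<mu> (\<lambda>s. Z w s + zeta c s))\<^sup>2)) \<partial>N)"
      unfolding G2 nrm
      by (rule LIMSEQ_ignore_initial_segment[OF emp_process_norm_laplace[OF rows c0 N Z of_nat_0_le_iff]])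
    then show "(\<lambda>n. \<integral>x. exp (- (real k * x)) \<partial>distr (M (n + n0)) borel (\<lambda>w. G2 \<omega> (n + n0) (\<lambda>k. X (n + n0) k w)))
        \<longlonglongrightarrow> (\<integral>x. exp (- (real k * x)) \<partial>distr N borel (\<lambda>w. (L2_nrm \<mu> (\<lambda>s. Z w s + zeta c s))\<^sup>2))"
      using Gm Zm by (subst (1 2) integral_distr) auto
  qed
  then show ?thesis
    unfolding weak_conv_m_def weak_conv_def by (blast intro: LIMSEQ_offset)
qed

end

theorem theorem5p1:
  fixes \<omega> c :: "real \<Rightarrow> real"
    and M :: "nat \<Rightarrow> 'a measure" and X :: "nat \<Rightarrow> nat \<Rightarrow> 'a \<Rightarrow> real"
    and N :: "'b measure" and Z :: "'b \<Rightarrow> real \<Rightarrow> real"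
    and d :: "nat \<Rightarrow> real \<Rightarrow> real"
  assumes \<omega>_pos: "\<And>t. 0 < \<omega> t"
    and \<omega>_cont: "continuous_on UNIV \<omega>"
    and \<omega>_moment: "integrable lborel (\<lambda>t. t ^ 4 * \<omega> t)"
    and c_meas: "c \<in> borel_measurable borel"
    and c_bounded: "bounded (range c)"
    and c_centred: "(\<integral>x. c x * phi x \<partial>lborel) = 0"
    and row_prob: "\<And>n. 1 \<le> n \<Longrightarrow> (\<forall>x. 0 \<le> alternative_density c n x) \<Longrightarrow> prob_space (M n)"
    and row_indep: "\<And>n. 1 \<le> n \<Longrightarrow> (\<forall>x. 0 \<le> alternative_density c n x) \<Longrightarrow>
                      prob_space.indep_vars (M n) (\<lambda>_. borel) (X n) {1..n}"
    and row_density: "\<And>n k. 1 \<le> n \<Longrightarrow> (\<forall>x. 0 \<le> alternative_density c n x) \<Longrightarrow> k \<in> {1..n} \<Longrightarrow>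
                      distributed (M n) lborel (X n k) (\<lambda>x. ennreal (alternative_density c n x))"
    and d: "d = phi_derivs \<or> d = phi_powers"
    and N_prob: "prob_space N"
    and Z_gaussian: "gaussian_L2_element N (weighted_lebesgue \<omega>) Z"
    and Z_centred: "centred_L2_element N (weighted_lebesgue \<omega>) Z"
    and Z_cov: "has_covariance_kernel N (weighted_lebesgue \<omega>) Z (kernel_K2 d)"
  shows "weak_conv_m
           (\<lambda>n. distr (M n) borel (\<lambda>w. G2 \<omega> n (\<lambda>k. X n k w)))
           (distr N borel (\<lambda>w. (L2_nrm (weighted_lebesgue \<omega>) (\<lambda>s. Z w s + zeta c s))\<^sup>2))"
proof -
  interpret weight \<omega> by (rule weight.intro[OF \<omega>_pos \<omega>_cont \<omega>_moment])
  have d_eq: "d = phi_powers"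
  proof (rule ccontr)
    assume "d \<noteq> phi_powers"
    with d have "d = phi_derivs" by blast
    from covariance_kernel_diagonal_nonneg[OF continuous_kernel_K2[OF continuous_phi_derivs]
        finite_measure_\<mu> sets_\<mu> \<mu>_Icc_pos Z_cov[unfolded this]]
    have "0 \<le> kernel_K2 phi_derivs 3 3" .
    then show False using kernel_K2_phi_derivs_3_3 by simp
  qed
  obtain C where C: "\<And>x. \<bar>c x\<bar> \<le> C"
    using c_bounded by (auto simp: bounded_iff)
  have C0: "0 \<le> C" using C[of 0] by linarith
  \<comment> \<open>From \<open>C\<^sup>2 \<le> n\<close> on the density is nonnegative, and the
    hypotheses on the rows become available.\<close>
  define n0 where "n0 = nat \<lceil>C\<^sup>2\<rceil> + 1"
  have row: "alternative_row (M n) c C n (X n)" if n: "n0 \<le> n" for n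
  proof -
    have n1: "1 \<le> n" using n by (simp add: n0_def)
    have "C\<^sup>2 \<le> real n" using n by (simp add: n0_def) linarith
    then have Cn: "C \<le> sqrt (real n)" using C0 by (simp add: real_le_rsqrt)
    have "0 \<le> alternative_density c n x" for x
    proof -
      have "- c x \<le> sqrt (real n)" using C[of x] Cn by linarith
      then have "0 \<le> 1 + 1 / sqrt (real n) * c x" using n1 by (simp add: field_simps)
      then show ?thesis by (simp add: alternative_density_def)
    qed
    then show ?thesis
      using row_prob[OF n1] row_indep[OF n1] row_density[OF n1] n1 c_meas C Cn
      by (simp add: alternative_row_def alternative_row_axioms_def)
  qed
  have c0: "(\<integral>x. c x \<partial>gauss) = 0"
    using c_centred c_meas by (simp add: gauss_integral mult.commute)
  show ?thesis
    by (rule emp_process_norm_weak_conv[OF row c0 N_prob Z_gaussian Z_centred Z_cov[unfolded d_eq]])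
qed

end
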